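(* Let $\mathcal E,\mathcal G$ be Hilbert spaces and let $F:[B(\mathcal H)^n]_1\to B(\mathcal H)\bar\otimes_{min}B(\mathcal E,\mathcal G)$ be a free holomorphic function with $\|F\|_\infty\le1$ and $\|F(0)\|<1$. If $z\in\mathbb B_n$, then $$\Psi_{F(z)}(F(X))\Psi_{F(z)}(F(X))^*\le\Phi_z(X)\Phi_z(X)^*\otimes I_{\mathcal G},\qquad X\in[B(\mathcal H)^n]_1,$$ where $\Psi_{F(z)}$ is the fractional transform and $\Phi_z$ is the free holomorphic automorphism of $[B(\mathcal H)^n]_1$ associated with $z$. Moreover, $$D_{F(z)^*}[I-F(X)F(z)^*]^{-1}[I-F(X)F(X)^*][I-F(z)F(X)^*]^{-1}D_{F(z)^*}\ \ge\ \left(\Delta_z(I-Xz^* )^{-1}(I-XX^* )(I-zX^* )^{-1}\Delta_z\right)\otimes I_{\mathcal G}$$ for any $z\in\mathbb B_n$ and $X\in[B(\mathcal H)^n]_1$.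
   Context: $\mathcal H$ is a separable infinite dimensional Hilbert space and $n\in\{1,2,\dots\}\cup\{\infty\}$. A tuple $X=(X_1,\dots,X_n)\in B(\mathcal H)^n$ is identified with the row operator $[X_1\,\cdots\,X_n]$; $XX^*=\sum_iX_iX_i^*$, $\|X\|=\|XX^*\|^{1/2}$, $[B(\mathcal H)^n]_1=\{X:\|X\|<1\}$. $\mathbb B_n$ is the open Euclidean unit ball of $\mathbb C^n$; $z\in\mathbb B_n$ is also viewed as the row $[z_1I,\dots,z_nI]$, so $Xz^*=\sum_i\bar z_iX_i$ and $zX^*=\sum_iz_iX_i^*$. $\mathbb F_n^+$ is the unital free semigroup on $g_1,\dots,g_n$; for $\alpha=g_{i_1}\cdots g_{i_k}$ put $|\alpha|=k$, $X_\alpha=X_{i_1}\cdots X_{i_k}$ ($X_\alpha=I$ for the neutral element, of length $0$). A free holomorphic function on $[B(\mathcal H)^n]_1$ with coefficients in $B(\mathcal E,\mathcal G)$ is a map $F(X)=\sum_{k=0}^\infty\sum_{|\alpha|=k}X_\alpha\otimes A_{(\alpha)}$ with $A_{(\alpha)}\in B(\mathcal E,\mathcal G)$, the series in $k$ converging in operator norm for all $X\in[B(\mathcal H)^n]_1$ ($\bar\otimes_{min}$ is the spatial tensor product). $\|F\|_\infty=\sup_{\|X\|<1}\|F(X)\|$. For $z\in\mathbb B_n$, $F(z)=\sum_\alpha z_\alpha A_{(\alpha)}$ is identified with $I_{\mathcal H}\otimes F(z)$. For contractions $A,B$ between the same Hilbert spaces with $\|A\|<1$: $D_A=(I-A^*A)^{1/2}$,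 $D_{A^*}=(I-AA^* )^{1/2}$, and the fractional transform is $\Psi_A(B)=A-D_{A^*}(I-BA^* )^{-1}BD_A$. For $z\in\mathbb B_n$, $\Delta_z=(1-\|z\|_2^2)^{1/2}I$, $\Delta_{z^*}=(I-z^*z)^{1/2}$, and $\Phi_z(X)=z-\Delta_z(I-\sum_i\bar z_iX_i)^{-1}[X_1,\dots,X_n]\Delta_{z^*}$. *)

theory Defs
  imports "HOL-Analysis.Analysis"
begin

section \<open>Complex Hilbert spaces\<close>

class complex_vector = real_vector +
  fixes scaleC :: "complex \<Rightarrow> 'a \<Rightarrow> 'a" (infixr "*\<^sub>C" 75)
  assumes scaleC_add_right: "c *\<^sub>C (x + y) = c *\<^sub>C x + c *\<^sub>C y"
    and scaleC_add_left: "(c + d) *\<^sub>C x = c *\<^sub>C x + d *\<^sub>C x"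
    and scaleC_scaleC: "c *\<^sub>C d *\<^sub>C x = (c * d) *\<^sub>C x"
    and scaleR_scaleC: "r *\<^sub>R x = complex_of_real r *\<^sub>C x"

lemma scaleC_one [simp]: "1 *\<^sub>C x = (x :: 'a :: complex_vector)"
  using scaleR_scaleC[of 1 x] by simp

global_interpretation complex_vector: vector_space "scaleC :: complex \<Rightarrow> 'a \<Rightarrow> 'a :: complex_vector"
  defines cspan = complex_vector.span
  by unfold_locales (simp_all add: scaleC_add_right scaleC_add_left scaleC_scaleC)

text \<open>A complex Hilbert space is a real Hilbert space with a compatible complex structure; the
  inner product \<open>cinner\<close> is linear in its first argument, and positive definiteness
  is inherited from \<open>inner = Re cinner\<close>.\<close>

class chilbert_space = complex_vector + real_inner + banach +
  fixes cinner :: "'a \<Rightarrow> 'a \<Rightarrow> complex"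
  assumes cinner_commute: "cinner x y = cnj (cinner y x)"
    and cinner_add_left: "cinner (x + y) z = cinner x z + cinner y z"
    and cinner_scaleC_left: "cinner (c *\<^sub>C x) y = c * cinner x y"
    and inner_eq_Re_cinner: "inner x y = Re (cinner x y)"

instantiation complex :: chilbert_space
begin
definition scaleC_complex :: "complex \<Rightarrow> complex \<Rightarrow> complex" where "scaleC_complex c x = c * x"
definition cinner_complex :: "complex \<Rightarrow> complex \<Rightarrow> complex" where "cinner_complex x y = x * cnj y"
instance
  by standard (simp_all add: scaleC_complex_def cinner_complex_def inner_complex_def
      algebra_simps scaleR_conv_of_real)
end

lemma cinner_add_right: "cinner x (y + z) = cinner x y + cinner x (z :: 'a :: chilbert_space)"
  by (metis cinner_add_left cinner_commute complex_cnj_add)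

lemma cinner_scaleC_right: "cinner x (c *\<^sub>C y) = cnj c * cinner x (y :: 'a :: chilbert_space)"
  by (metis cinner_scaleC_left cinner_commute complex_cnj_mult)

lemma cinner_self: "cinner x x = complex_of_real ((norm (x :: 'a :: chilbert_space))\<^sup>2)"
proof -
  have "Im (cinner x x) = 0"
    using arg_cong[OF cinner_commute[of x x], of Im] by simp
  moreover have "Re (cinner x x) = (norm x)\<^sup>2"
    by (simp add: inner_eq_Re_cinner[symmetric] power2_norm_eq_inner)
  ultimately show ?thesis by (simp add: complex_eq_iff)
qed

lemma norm_scaleC: "norm (c *\<^sub>C x) = norm c * norm (x :: 'a :: chilbert_space)"
proof -
  have "complex_of_real ((norm (c *\<^sub>C x))\<^sup>2) = complex_of_real ((norm c * norm x)\<^sup>2)"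
    unfolding cinner_self[symmetric] cinner_scaleC_left cinner_scaleC_right
    by (simp add: cinner_self power_mult_distrib complex_norm_square mult.commute
      flip: complex_norm_square)
  then show ?thesis by (simp add: power2_eq_iff_nonneg del: of_real_power of_real_mult)
qed

lemma norm_cinner_le: "norm (cinner x y) \<le> norm x * norm (y :: 'a :: chilbert_space)"
proof (cases "cinner x y = 0")
  case False
  define c where "c = cnj (cinner x y) / norm (cinner x y)"
  have [simp]: "norm c = 1" using False by (simp add: c_def norm_divide)
  have "c * cinner x y = norm (cinner x y)"
    using False
    by (simp add: c_def complex_norm_square[symmetric] mult.commute[of "cnj _"] power2_eq_square)
  then have "norm (cinner x y) = inner (c *\<^sub>C x) y"
    by (simp add: inner_eq_Re_cinner cinner_scaleC_left)
  also have "\<dots> \<le> norm (c *\<^sub>C x) * norm y" by (rule norm_cauchy_schwarz)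
  finally show ?thesis by (simp add: norm_scaleC)
qed simp


section \<open>Hilbert direct sums\<close>

text \<open>\<open>('i, 'a) hsum\<close> is the Hilbert space direct sum of copies of \<open>'a\<close> indexed by \<open>'i\<close>.\<close>

definition square_summable :: "('i \<Rightarrow> 'a :: real_normed_vector) \<Rightarrow> bool" where
  "square_summable f \<longleftrightarrow> (\<lambda>i. (norm (f i))\<^sup>2) summable_on UNIV"

typedef (overloaded) ('i, 'a) hsum = "{f :: 'i \<Rightarrow> 'a :: chilbert_space. square_summable f}"
  morphisms hsum_nth Abs_hsum
  by (rule exI[of _ "\<lambda>_. 0"]) (simp add: square_summable_def)

setup_lifting type_definition_hsum

lemma norm_add_square_le: "(norm (x + y :: 'a :: real_normed_vector))\<^sup>2 \<le> 2 * (norm x)\<^sup>2 + 2 * (norm y)\<^sup>2"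
proof -
  have "(norm (x + y))\<^sup>2 \<le> (norm x + norm y)\<^sup>2"
    by (simp add: norm_triangle_ineq power_mono)
  also have "\<dots> \<le> 2 * (norm x)\<^sup>2 + 2 * (norm y)\<^sup>2"
    using sum_squares_bound[of "norm x" "norm y"] by (simp add: power2_sum)
  finally show ?thesis .
qed

lemma square_summable_add:
  assumes "square_summable f" "square_summable g"
  shows "square_summable (\<lambda>i. f i + g i)"
proof -
  have "(\<lambda>i. 2 * (norm (f i))\<^sup>2 + 2 * (norm (g i))\<^sup>2) summable_on UNIV"
    using assms unfolding square_summable_def by (intro summable_on_add summable_on_cmult_right)
  then show ?thesis
    unfolding square_summable_def
    by (rule summable_on_comparison_test) (simp_all add: norm_add_square_le)
qed

lemma square_summable_scaleC:
  "square_summable f \<Longrightarrow> square_summable (\<lambda>i. c *\<^sub>C (f i :: 'a :: chilbert_space))"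
  unfolding square_summable_def norm_scaleC power_mult_distrib by (rule summable_on_cmult_right)

lemma square_summable_scaleR:
  "square_summable f \<Longrightarrow> square_summable (\<lambda>i. r *\<^sub>R (f i :: 'a :: chilbert_space))"
  unfolding scaleR_scaleC by (rule square_summable_scaleC)

lemma square_summable_uminus: "square_summable f \<Longrightarrow> square_summable (\<lambda>i. - f i)"
  unfolding square_summable_def by simp

lemma square_summable_diff:
  "square_summable f \<Longrightarrow> square_summable g \<Longrightarrow> square_summable (\<lambda>i. f i - g i)"
  using square_summable_add[of f "\<lambda>i. - g i"] square_summable_uminus[of g] by simp

lemma summable_norm_mult:
  assumes "square_summable f" "square_summable g"
  shows "(\<lambda>i. norm (f i) * norm (g i)) summable_on UNIV"
proof (rule summable_on_comparison_test)
  show "(\<lambda>i. (norm (f i))\<^sup>2 + (norm (g i))\<^sup>2) summable_on UNIV"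
    using assms unfolding square_summable_def by (rule summable_on_add)
  show "norm (f i) * norm (g i) \<le> (norm (f i))\<^sup>2 + (norm (g i))\<^sup>2" for i
    using sum_squares_bound[of "norm (f i)" "norm (g i)"]
      mult_nonneg_nonneg[OF norm_ge_zero[of "f i"] norm_ge_zero[of "g i"]] by linarith
qed simp

lemma summable_cinner:
  assumes "square_summable f" "square_summable g"
  shows "(\<lambda>i. cinner (f i) (g i)) summable_on UNIV"
  by (rule abs_summable_summable, rule summable_on_comparison_test[OF summable_norm_mult[OF assms]])
    (auto intro: norm_cinner_le)

instantiation hsum :: (type, chilbert_space) complex_vector
begin
lift_definition zero_hsum :: "('a, 'b) hsum" is "\<lambda>_. 0" by (simp add: square_summable_def)
lift_definition plus_hsum :: "('a, 'b) hsum \<Rightarrow> ('a, 'b) hsum \<Rightarrow> ('a, 'b) hsum"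
  is "\<lambda>f g i. f i + g i" by (rule square_summable_add)
lift_definition uminus_hsum :: "('a, 'b) hsum \<Rightarrow> ('a, 'b) hsum"
  is "\<lambda>f i. - f i" by (rule square_summable_uminus)
lift_definition minus_hsum :: "('a, 'b) hsum \<Rightarrow> ('a, 'b) hsum \<Rightarrow> ('a, 'b) hsum"
  is "\<lambda>f g i. f i - g i" by (rule square_summable_diff)
lift_definition scaleR_hsum :: "real \<Rightarrow> ('a, 'b) hsum \<Rightarrow> ('a, 'b) hsum"
  is "\<lambda>r f i. r *\<^sub>R f i" by (rule square_summable_scaleR)
lift_definition scaleC_hsum :: "complex \<Rightarrow> ('a, 'b) hsum \<Rightarrow> ('a, 'b) hsum"
  is "\<lambda>c f i. c *\<^sub>C f i" by (rule square_summable_scaleC)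
instance
  by standard (transfer; force simp: algebra_simps scaleR_scaleC scaleC_add_right scaleC_add_left
      scaleC_scaleC)+
end

lemma hsum_eqI: "(\<And>i. hsum_nth x i = hsum_nth y i) \<Longrightarrow> x = y"
  by (metis ext hsum_nth_inject)

lemma square_summable_nth: "square_summable (hsum_nth x)"
  using hsum_nth by blast

lemma hsum_nth_simps [simp]:
  "hsum_nth 0 i = 0"
  "hsum_nth (x + y) i = hsum_nth x i + hsum_nth y i"
  "hsum_nth (x - y) i = hsum_nth x i - hsum_nth y i"
  "hsum_nth (- x) i = - hsum_nth x i"
  "hsum_nth (r *\<^sub>R x) i = r *\<^sub>R hsum_nth x i"
  "hsum_nth (c *\<^sub>C x) i = c *\<^sub>C hsum_nth x i"
  by (transfer; simp)+

definition hsum_cinner :: "('i, 'a :: chilbert_space) hsum \<Rightarrow> ('i, 'a) hsum \<Rightarrow> complex" where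
  "hsum_cinner x y = (\<Sum>\<^sub>\<infinity>i. cinner (hsum_nth x i) (hsum_nth y i))"

lemma hsum_cinner_commute: "hsum_cinner x y = cnj (hsum_cinner y x)"
  unfolding hsum_cinner_def infsum_cnj[symmetric] by (rule infsum_cong) (rule cinner_commute)

lemma hsum_cinner_add_left: "hsum_cinner (x + y) z = hsum_cinner x z + hsum_cinner y z"
  unfolding hsum_cinner_def
  by (simp add: cinner_add_left infsum_add summable_cinner square_summable_nth)

lemma hsum_cinner_scaleC_left: "hsum_cinner (c *\<^sub>C x) y = c * hsum_cinner x y"
  unfolding hsum_cinner_def by (simp add: cinner_scaleC_left infsum_cmult_right')

lemma hsum_cinner_self: "hsum_cinner x x = complex_of_real (\<Sum>\<^sub>\<infinity>i. (norm (hsum_nth x i))\<^sup>2)"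
  unfolding hsum_cinner_def cinner_self
  by (rule infsumI, rule has_sum_of_real, rule has_sum_infsum)
    (use square_summable_nth[of x] in \<open>simp add: square_summable_def\<close>)

instantiation hsum :: (type, chilbert_space) real_inner
begin
definition inner_hsum :: "('a, 'b) hsum \<Rightarrow> ('a, 'b) hsum \<Rightarrow> real" where
  "inner_hsum x y = Re (hsum_cinner x y)"
definition norm_hsum :: "('a, 'b) hsum \<Rightarrow> real" where
  "norm_hsum x = sqrt (inner x x)"
definition sgn_hsum :: "('a, 'b) hsum \<Rightarrow> ('a, 'b) hsum" where
  "sgn_hsum x = x /\<^sub>R norm x"
definition dist_hsum :: "('a, 'b) hsum \<Rightarrow> ('a, 'b) hsum \<Rightarrow> real" where
  "dist_hsum x y = norm (x - y)"
definition uniformity_hsum :: "(('a, 'b) hsum \<times> ('a, 'b) hsum) filter" where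
  "uniformity_hsum = (INF e\<in>{0<..}. principal {(x, y). dist x y < e})"
definition open_hsum :: "('a, 'b) hsum set \<Rightarrow> bool" where
  "open_hsum U \<longleftrightarrow> (\<forall>x\<in>U. eventually (\<lambda>(x', y). x' = x \<longrightarrow> y \<in> U) uniformity)"
instance
proof
  fix x y z :: "('a, 'b) hsum" and r :: real
  show "inner x y = inner y x"
    unfolding inner_hsum_def by (subst hsum_cinner_commute) simp
  show "inner (x + y) z = inner x z + inner y z"
    by (simp add: inner_hsum_def hsum_cinner_add_left)
  show "inner (r *\<^sub>R x) y = r * inner x y"
    by (simp add: inner_hsum_def scaleR_scaleC hsum_cinner_scaleC_left)
  show "0 \<le> inner x x"
    by (simp add: inner_hsum_def hsum_cinner_self infsum_nonneg)
  show "inner x x = 0 \<longleftrightarrow> x = 0"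
  proof
    assume "inner x x = 0"
    then have 0: "(\<Sum>\<^sub>\<infinity>i. (norm (hsum_nth x i))\<^sup>2) = 0"
      by (simp add: inner_hsum_def hsum_cinner_self)
    have "(norm (hsum_nth x i))\<^sup>2 = 0" for i
      using nonneg_infsum_le_0D[of "\<lambda>i. (norm (hsum_nth x i))\<^sup>2" UNIV i] 0
        square_summable_nth[of x] by (simp add: square_summable_def)
    then show "x = 0" by (intro hsum_eqI) simp
  qed (simp add: inner_hsum_def hsum_cinner_def cinner_self)
qed (simp_all add: norm_hsum_def sgn_hsum_def dist_hsum_def uniformity_hsum_def open_hsum_def)
end

lemma norm_hsum_square: "(norm x)\<^sup>2 = (\<Sum>\<^sub>\<infinity>i. (norm (hsum_nth x i))\<^sup>2)"
  by (simp add: power2_norm_eq_inner inner_hsum_def hsum_cinner_self)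

lemma sum_norm_nth_le: "finite M \<Longrightarrow> (\<Sum>i\<in>M. (norm (hsum_nth x i))\<^sup>2) \<le> (norm x)\<^sup>2"
  unfolding norm_hsum_square using square_summable_nth[of x]
  by (intro finite_sum_le_infsum) (auto simp: square_summable_def)

lemma norm_nth_le: "norm (hsum_nth x i) \<le> norm x"
  using sum_norm_nth_le[of "{i}" x] by (simp add: power2_le_iff_abs_le)

lemma hsum_norm_leI:
  assumes "\<And>M. finite M \<Longrightarrow> (\<Sum>i\<in>M. (norm (hsum_nth x i))\<^sup>2) \<le> e\<^sup>2" "0 \<le> e"
  shows "norm x \<le> e"
proof (rule power2_le_imp_le)
  show "(norm x)\<^sup>2 \<le> e\<^sup>2"
    unfolding norm_hsum_square using assms square_summable_nth[of x]
    by (intro infsum_le_finite_sums) (auto simp: square_summable_def)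
qed fact

instance hsum :: (type, chilbert_space) banach
proof
  fix X :: "nat \<Rightarrow> ('a, 'b) hsum"
  assume X: "Cauchy X"
  have "Cauchy (\<lambda>n. hsum_nth (X n) i)" for i
  proof (rule CauchyI)
    fix e :: real assume "0 < e"
    then obtain N where "\<And>m n. m \<ge> N \<Longrightarrow> n \<ge> N \<Longrightarrow> norm (X m - X n) < e"
      using CauchyD[OF X] by metis
    moreover have "norm (hsum_nth (X m) i - hsum_nth (X n) i) \<le> norm (X m - X n)" for m n
      using norm_nth_le[of "X m - X n" i] by simp
    ultimately show "\<exists>N. \<forall>m\<ge>N. \<forall>n\<ge>N. norm (hsum_nth (X m) i - hsum_nth (X n) i) < e"
      by (meson le_less_trans)
  qed
  then have "\<exists>l. (\<lambda>n. hsum_nth (X n) i) \<longlonglongrightarrow> l" for i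
    by (simp add: Cauchy_convergent_iff convergent_def)
  then obtain l where l: "\<And>i. (\<lambda>n. hsum_nth (X n) i) \<longlonglongrightarrow> l i" by metis
  have bound: "(\<Sum>i\<in>M. (norm (hsum_nth (X m) i - l i))\<^sup>2) \<le> e\<^sup>2"
    if N: "\<And>m n. m \<ge> N \<Longrightarrow> n \<ge> N \<Longrightarrow> norm (X m - X n) < e" and "m \<ge> N" "finite M" for N m M e
  proof (rule tendsto_upperbound)
    show "(\<lambda>n. \<Sum>i\<in>M. (norm (hsum_nth (X m) i - hsum_nth (X n) i))\<^sup>2)
        \<longlonglongrightarrow> (\<Sum>i\<in>M. (norm (hsum_nth (X m) i - l i))\<^sup>2)"
      by (intro tendsto_intros l)
    show "\<forall>\<^sub>F n in sequentially. (\<Sum>i\<in>M. (norm (hsum_nth (X m) i - hsum_nth (X n) i))\<^sup>2) \<le> e\<^sup>2"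
    proof (rule eventually_sequentiallyI)
      fix n assume "n \<ge> N"
      have "(\<Sum>i\<in>M. (norm (hsum_nth (X m - X n) i))\<^sup>2) \<le> (norm (X m - X n))\<^sup>2"
        by (rule sum_norm_nth_le) fact
      also have "\<dots> \<le> e\<^sup>2"
        using N[OF \<open>m \<ge> N\<close> \<open>n \<ge> N\<close>] by (intro power_mono) auto
      finally show "(\<Sum>i\<in>M. (norm (hsum_nth (X m) i - hsum_nth (X n) i))\<^sup>2) \<le> e\<^sup>2" by simp
    qed
  qed simp
  have diff: "square_summable (\<lambda>i. hsum_nth (X m) i - l i)"
    if N: "\<And>m n. m \<ge> N \<Longrightarrow> n \<ge> N \<Longrightarrow> norm (X m - X n) < e" and "m \<ge> N" for N m e
    unfolding square_summable_def
    by (rule nonneg_bdd_above_summable_on) (auto intro!: bdd_aboveI bound[OF that])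
  obtain N where N: "\<And>m n. m \<ge> N \<Longrightarrow> n \<ge> N \<Longrightarrow> norm (X m - X n) < 1"
    using CauchyD[OF X zero_less_one] by metis
  have "square_summable (\<lambda>i. hsum_nth (X N) i - l i)"
    by (rule diff[of N 1]) (use N in auto)
  then have "square_summable (\<lambda>i. hsum_nth (X N) i - (hsum_nth (X N) i - l i))"
    by (rule square_summable_diff[OF square_summable_nth])
  then have "square_summable l" by simp
  then have L: "hsum_nth (Abs_hsum l) = l" by (simp add: Abs_hsum_inverse)
  have "X \<longlonglongrightarrow> Abs_hsum l"
  proof (rule LIMSEQ_I)
    fix e :: real assume "0 < e"
    then obtain N where N: "\<And>m n. m \<ge> N \<Longrightarrow> n \<ge> N \<Longrightarrow> norm (X m - X n) < e / 2"
      using CauchyD[OF X, of "e / 2"] by auto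
    have "norm (X m - Abs_hsum l) \<le> e / 2" if "m \<ge> N" for m
      using bound[OF N \<open>m \<ge> N\<close>] \<open>0 < e\<close> by (intro hsum_norm_leI) (simp_all add: L)
    then show "\<exists>N. \<forall>m\<ge>N. norm (X m - Abs_hsum l) < e"
      using \<open>0 < e\<close> by (intro exI[of _ N]) fastforce
  qed
  then show "convergent X" by (auto simp: convergent_def)
qed

instantiation hsum :: (type, chilbert_space) chilbert_space
begin
definition cinner_hsum :: "('a, 'b) hsum \<Rightarrow> ('a, 'b) hsum \<Rightarrow> complex" where
  "cinner_hsum = hsum_cinner"
instance
  by standard (simp_all add: cinner_hsum_def inner_hsum_def hsum_cinner_add_left
      hsum_cinner_scaleC_left, metis hsum_cinner_commute)
end


section \<open>Bounded operators\<close>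

definition bounded_clinear :: "('a :: chilbert_space \<Rightarrow> 'b :: chilbert_space) \<Rightarrow> bool" where
  "bounded_clinear f \<longleftrightarrow> bounded_linear f \<and> (\<forall>c x. f (c *\<^sub>C x) = c *\<^sub>C f x)"

typedef (overloaded) ('a, 'b) cblinfun
  = "{f :: 'a :: chilbert_space \<Rightarrow> 'b :: chilbert_space. bounded_clinear f}"
  morphisms cblinfun_apply CBlinfun
  by (rule exI[of _ "\<lambda>_. 0"]) (simp add: bounded_clinear_def complex_vector.scale_zero_right)

setup_lifting type_definition_cblinfun

notation cblinfun_apply (infixr "*\<^sub>V" 70)

lemma bounded_clinearD:
  assumes "bounded_clinear f"
  shows "bounded_linear f" "f (c *\<^sub>C x) = c *\<^sub>C f x"
  using assms by (auto simp: bounded_clinear_def)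

lemma bounded_linear_scaleC_right: "bounded_linear (\<lambda>x :: 'a :: chilbert_space. c *\<^sub>C x)"
  by (rule bounded_linear_intro[of _ "norm c"])
    (simp_all add: scaleC_add_right scaleR_scaleC scaleC_scaleC norm_scaleC mult.commute)

lemma bounded_clinear_intros:
  "bounded_clinear (\<lambda>x. 0)"
  "bounded_clinear (\<lambda>x. x)"
  "bounded_clinear f \<Longrightarrow> bounded_clinear g \<Longrightarrow> bounded_clinear (\<lambda>x. f x + g x)"
  "bounded_clinear f \<Longrightarrow> bounded_clinear g \<Longrightarrow> bounded_clinear (\<lambda>x. f x - g x)"
  "bounded_clinear f \<Longrightarrow> bounded_clinear (\<lambda>x. - f x)"
  "bounded_clinear f \<Longrightarrow> bounded_clinear (\<lambda>x. c *\<^sub>C f x)"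
  "bounded_clinear f \<Longrightarrow> bounded_clinear (\<lambda>x. r *\<^sub>R f x)"
  unfolding bounded_clinear_def
  by (auto intro: bounded_linear_intros bounded_linear_minus bounded_linear_compose[OF bounded_linear_scaleC_right]
      simp: scaleC_add_right complex_vector.scale_right_diff_distrib scaleR_scaleC scaleC_scaleC
        mult.commute)

lemma bounded_clinear_compose:
  "bounded_clinear f \<Longrightarrow> bounded_clinear g \<Longrightarrow> bounded_clinear (\<lambda>x. f (g x))"
  unfolding bounded_clinear_def by (auto intro: bounded_linear_compose)

instantiation cblinfun :: (chilbert_space, chilbert_space) complex_vector
begin
lift_definition zero_cblinfun :: "('a, 'b) cblinfun" is "\<lambda>x. 0"
  by (rule bounded_clinear_intros)
lift_definition plus_cblinfun :: "('a, 'b) cblinfun \<Rightarrow> ('a, 'b) cblinfun \<Rightarrow> ('a, 'b) cblinfun"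
  is "\<lambda>f g x. f x + g x" by (rule bounded_clinear_intros)
lift_definition uminus_cblinfun :: "('a, 'b) cblinfun \<Rightarrow> ('a, 'b) cblinfun"
  is "\<lambda>f x. - f x" by (rule bounded_clinear_intros)
lift_definition minus_cblinfun :: "('a, 'b) cblinfun \<Rightarrow> ('a, 'b) cblinfun \<Rightarrow> ('a, 'b) cblinfun"
  is "\<lambda>f g x. f x - g x" by (rule bounded_clinear_intros)
lift_definition scaleR_cblinfun :: "real \<Rightarrow> ('a, 'b) cblinfun \<Rightarrow> ('a, 'b) cblinfun"
  is "\<lambda>r f x. r *\<^sub>R f x" by (rule bounded_clinear_intros)
lift_definition scaleC_cblinfun :: "complex \<Rightarrow> ('a, 'b) cblinfun \<Rightarrow> ('a, 'b) cblinfun"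
  is "\<lambda>c f x. c *\<^sub>C f x" by (rule bounded_clinear_intros)
instance
  by standard (transfer; force simp: algebra_simps scaleR_scaleC scaleC_add_right scaleC_add_left
      scaleC_scaleC)+
end

instantiation cblinfun :: (chilbert_space, chilbert_space) real_normed_vector
begin
lift_definition norm_cblinfun :: "('a, 'b) cblinfun \<Rightarrow> real" is onorm .
definition sgn_cblinfun :: "('a, 'b) cblinfun \<Rightarrow> ('a, 'b) cblinfun" where
  "sgn_cblinfun f = f /\<^sub>R norm f"
definition dist_cblinfun :: "('a, 'b) cblinfun \<Rightarrow> ('a, 'b) cblinfun \<Rightarrow> real" where
  "dist_cblinfun f g = norm (f - g)"
definition uniformity_cblinfun :: "(('a, 'b) cblinfun \<times> ('a, 'b) cblinfun) filter" where
  "uniformity_cblinfun = (INF e\<in>{0<..}. principal {(x, y). dist x y < e})"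
definition open_cblinfun :: "('a, 'b) cblinfun set \<Rightarrow> bool" where
  "open_cblinfun U \<longleftrightarrow> (\<forall>x\<in>U. eventually (\<lambda>(x', y). x' = x \<longrightarrow> y \<in> U) uniformity)"
instance
proof
  fix f g :: "('a, 'b) cblinfun" and r :: real
  show "norm f = 0 \<longleftrightarrow> f = 0"
    by transfer (simp add: onorm_eq_0 bounded_clinearD fun_eq_iff)
  show "norm (f + g) \<le> norm f + norm g"
    by transfer (rule onorm_triangle; rule bounded_clinearD; assumption)
  show "norm (r *\<^sub>R f) = \<bar>r\<bar> * norm f"
    by transfer (rule onorm_scaleR; rule bounded_clinearD; assumption)
qed (simp_all add: sgn_cblinfun_def dist_cblinfun_def uniformity_cblinfun_def open_cblinfun_def)
end

lift_definition cid :: "('a :: chilbert_space, 'a) cblinfun" is "\<lambda>x. x"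
  by (rule bounded_clinear_intros)

lift_definition ccomp :: "('b :: chilbert_space, 'c :: chilbert_space) cblinfun
    \<Rightarrow> ('a :: chilbert_space, 'b) cblinfun \<Rightarrow> ('a, 'c) cblinfun" (infixl "o\<^sub>C" 70)
  is "\<lambda>f g x. f (g x)" by (rule bounded_clinear_compose)

text \<open>The operators defined by \<open>THE\<close> (adjoint, inverse, square root, and below tensor products of
  operators and values of series) are meaningful only where the describing property has a
  solution: \<open>cinverse\<close> on invertible and \<open>op_sqrt\<close> on positive operators.\<close>

definition adj :: "('a :: chilbert_space, 'b :: chilbert_space) cblinfun \<Rightarrow> ('b, 'a) cblinfun"
    ("_\<^sup>\<dagger>" [1000] 999) where
  "T\<^sup>\<dagger> = (THE S. \<forall>x y. cinner (T *\<^sub>V x) y = cinner x (S *\<^sub>V y))"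

definition cinverse :: "('a :: chilbert_space, 'a) cblinfun \<Rightarrow> ('a, 'a) cblinfun" where
  "cinverse T = (THE S. S o\<^sub>C T = cid \<and> T o\<^sub>C S = cid)"

definition positive_op :: "('a :: chilbert_space, 'a) cblinfun \<Rightarrow> bool" where
  "positive_op T \<longleftrightarrow> (\<forall>x. cinner (T *\<^sub>V x) x \<in> \<real> \<and> 0 \<le> Re (cinner (T *\<^sub>V x) x))"

definition op_le :: "('a :: chilbert_space, 'a) cblinfun \<Rightarrow> ('a, 'a) cblinfun \<Rightarrow> bool"
    (infix "\<le>\<^sub>C" 50) where
  "S \<le>\<^sub>C T \<longleftrightarrow> positive_op (T - S)"

definition op_sqrt :: "('a :: chilbert_space, 'a) cblinfun \<Rightarrow> ('a, 'a) cblinfun" where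
  "op_sqrt T = (THE S. positive_op S \<and> S o\<^sub>C S = T)"

definition defect :: "('a :: chilbert_space, 'b :: chilbert_space) cblinfun \<Rightarrow> ('a, 'a) cblinfun"
  where "defect A = op_sqrt (cid - A\<^sup>\<dagger> o\<^sub>C A)"

definition defect_star :: "('a :: chilbert_space, 'b :: chilbert_space) cblinfun \<Rightarrow> ('b, 'b) cblinfun"
  where "defect_star A = op_sqrt (cid - A o\<^sub>C A\<^sup>\<dagger>)"

definition frac_transform :: "('a :: chilbert_space, 'b :: chilbert_space) cblinfun
    \<Rightarrow> ('a, 'b) cblinfun \<Rightarrow> ('a, 'b) cblinfun" where
  "frac_transform A B = A - defect_star A o\<^sub>C cinverse (cid - B o\<^sub>C A\<^sup>\<dagger>) o\<^sub>C B o\<^sub>C defect A"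


section \<open>Hilbert space tensor products\<close>

text \<open>\<open>hilbert_tensor t\<close> says that \<open>'c\<close>, with elementary tensors \<open>t x u\<close>, is a Hilbert space
  tensor product of \<open>'a\<close> and \<open>'b\<close>, i.e. the completion of the algebraic tensor product in the
  inner product determined on elementary tensors. This fixes \<open>'c\<close> and \<open>t\<close> up to unitary
  equivalence.\<close>

definition hilbert_tensor ::
  "('a :: chilbert_space \<Rightarrow> 'b :: chilbert_space \<Rightarrow> 'c :: chilbert_space) \<Rightarrow> bool" where
  "hilbert_tensor t \<longleftrightarrow>
     (\<forall>x. Vector_Spaces.linear scaleC scaleC (\<lambda>u. t x u)) \<and>
     (\<forall>u. Vector_Spaces.linear scaleC scaleC (\<lambda>x. t x u)) \<and>
     (\<forall>x u y v. cinner (t x u) (t y v) = cinner x y * cinner u v) \<and>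
     closure (cspan {t x u | x u. True}) = UNIV"

definition op_tensor :: "('h :: chilbert_space \<Rightarrow> 'e :: chilbert_space \<Rightarrow> 'he :: chilbert_space)
    \<Rightarrow> ('k :: chilbert_space \<Rightarrow> 'g :: chilbert_space \<Rightarrow> 'kg :: chilbert_space)
    \<Rightarrow> ('h, 'k) cblinfun \<Rightarrow> ('e, 'g) cblinfun \<Rightarrow> ('he, 'kg) cblinfun" where
  "op_tensor s t X A = (THE T. \<forall>x u. T *\<^sub>V s x u = t (X *\<^sub>V x) (A *\<^sub>V u))"


section \<open>Row operators\<close>

text \<open>A tuple \<open>X \<in> B(H)\<^sup>n\<close> is represented by its row operator from the direct sum of \<open>n\<close> copies of
  \<open>H\<close> to \<open>H\<close>, so that \<open>norm X\<close> is the row norm and \<open>X o\<^sub>C X\<^sup>\<dagger>\<close> is \<open>\<Sum>\<^sub>i X\<^sub>i X\<^sub>i\<^sup>\<dagger>\<close>. The indices are the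
  elements of a type \<open>'n\<close>; letting \<open>'n\<close> range over the nonempty countable types gives
  \<open>n \<in> {1, 2, \<dots>} \<union> {\<infinity>}\<close>. Words over the generators are lists over \<open>'n\<close>.\<close>

lemma has_sum_hsum_single: "((\<lambda>j. (norm (if j = i then h else 0))\<^sup>2) has_sum (norm h)\<^sup>2) UNIV"
proof -
  have "((\<lambda>j. (norm (if j = i then h else 0))\<^sup>2) has_sum (norm h)\<^sup>2) {i}"
    using has_sum_finite[of "{i}" "\<lambda>j. (norm (if j = i then h else 0))\<^sup>2"] by simp
  then show ?thesis by (rule has_sum_cong_neutral[THEN iffD1, rotated -1]) auto
qed

lift_definition hsum_single :: "'n \<Rightarrow> 'h \<Rightarrow> ('n, 'h :: chilbert_space) hsum"
  is "\<lambda>i h j. if j = i then h else 0"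
  unfolding square_summable_def by (rule has_sum_imp_summable[OF has_sum_hsum_single])

lemma hsum_nth_single: "hsum_nth (hsum_single i h) j = (if j = i then h else 0)"
  by transfer simp

lemma norm_hsum_single: "norm (hsum_single i h) = norm h"
proof -
  have "(norm (hsum_single i h))\<^sup>2 = (norm h)\<^sup>2"
    unfolding norm_hsum_square hsum_nth_single by (rule infsumI[OF has_sum_hsum_single])
  then show ?thesis by simp
qed

lift_definition hsum_inj :: "'n \<Rightarrow> ('h :: chilbert_space, ('n, 'h) hsum) cblinfun"
  is hsum_single
  unfolding bounded_clinear_def
  by (auto intro!: bounded_linear_intro[of _ 1] hsum_eqI simp: hsum_nth_single norm_hsum_single
      complex_vector.scale_zero_right)

definition row_nth :: "(('n, 'h) hsum, 'h) cblinfun \<Rightarrow> 'n \<Rightarrow> ('h :: chilbert_space, 'h) cblinfun"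
  where "row_nth X i = X o\<^sub>C hsum_inj i"

definition row_word :: "(('n, 'h) hsum, 'h) cblinfun \<Rightarrow> 'n list \<Rightarrow> ('h :: chilbert_space, 'h) cblinfun"
  where "row_word X \<alpha> = foldr (\<lambda>i T. row_nth X i o\<^sub>C T) \<alpha> cid"

text \<open>Points of the ball of \<open>\<complex>\<^sup>n\<close> are elements \<open>z\<close> of \<open>('n, complex) hsum\<close> with \<open>norm z < 1\<close>;
  \<open>scalar_row z\<close> is the row \<open>[z\<^sub>1 I, z\<^sub>2 I, \<dots>]\<close>.\<close>

lemma scalar_row_summable:
  fixes z :: "('n, complex) hsum" and x :: "('n, 'h :: chilbert_space) hsum"
  shows "(\<lambda>i. norm (hsum_nth z i *\<^sub>C hsum_nth x i)) summable_on UNIV"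
  unfolding norm_scaleC by (intro summable_norm_mult square_summable_nth)

lemma scalar_row_bound:
  fixes z :: "('n, complex) hsum" and x :: "('n, 'h :: chilbert_space) hsum"
  shows "norm (\<Sum>\<^sub>\<infinity>i. hsum_nth z i *\<^sub>C hsum_nth x i) \<le> norm z * norm x"
proof -
  have "norm (\<Sum>\<^sub>\<infinity>i. hsum_nth z i *\<^sub>C hsum_nth x i) \<le> (\<Sum>\<^sub>\<infinity>i. norm (hsum_nth z i *\<^sub>C hsum_nth x i))"
    by (rule norm_infsum_bound[OF scalar_row_summable])
  also have "\<dots> \<le> norm z * norm x"
  proof (rule infsum_le_finite_sums[OF scalar_row_summable])
    fix M :: "'n set"
    assume "finite M"
    have L2_le: "L2_set (\<lambda>i. norm (hsum_nth y i)) M \<le> norm y"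
      for y :: "('n, 'a :: chilbert_space) hsum"
      unfolding L2_set_def using sum_norm_nth_le[OF \<open>finite M\<close>, of y]
      by (metis norm_ge_zero real_sqrt_le_mono real_sqrt_unique)
    have "(\<Sum>i\<in>M. norm (hsum_nth z i *\<^sub>C hsum_nth x i))
        \<le> L2_set (\<lambda>i. norm (hsum_nth z i)) M * L2_set (\<lambda>i. norm (hsum_nth x i)) M"
      using L2_set_mult_ineq[of "\<lambda>i. norm (hsum_nth z i)" "\<lambda>i. norm (hsum_nth x i)" M]
      by (simp add: norm_scaleC)
    also have "\<dots> \<le> norm z * norm x"
      by (intro mult_mono L2_le L2_set_nonneg norm_ge_zero)
    finally show "(\<Sum>i\<in>M. norm (hsum_nth z i *\<^sub>C hsum_nth x i)) \<le> norm z * norm x" .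
  qed
  finally show ?thesis .
qed

lemma bounded_clinear_scalar_row:
  fixes z :: "('n, complex) hsum"
  shows "bounded_clinear (\<lambda>x :: ('n, 'h :: chilbert_space) hsum. \<Sum>\<^sub>\<infinity>i. hsum_nth z i *\<^sub>C hsum_nth x i)"
proof -
  let ?f = "\<lambda>x :: ('n, 'h) hsum. \<Sum>\<^sub>\<infinity>i. hsum_nth z i *\<^sub>C hsum_nth x i"
  have summ: "(\<lambda>i. hsum_nth z i *\<^sub>C hsum_nth x i) summable_on UNIV" for x :: "('n, 'h) hsum"
    using abs_summable_summable[OF scalar_row_summable[of z x]] .
  have add: "?f (x + y) = ?f x + ?f y" for x y
    by (simp add: scaleC_add_right infsum_add[OF summ summ])
  have scale: "?f (c *\<^sub>C x) = c *\<^sub>C ?f x" for c x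
  proof -
    have "?f (c *\<^sub>C x) = (\<Sum>\<^sub>\<infinity>i. c *\<^sub>C hsum_nth z i *\<^sub>C hsum_nth x i)"
      by (simp add: scaleC_scaleC mult.commute)
    also have "\<dots> = c *\<^sub>C ?f x"
      using has_sum_bounded_linear[OF bounded_linear_scaleC_right has_sum_infsum[OF summ[of x]]]
      by (intro infsumI) (simp add: o_def)
    finally show ?thesis .
  qed
  have "bounded_linear ?f"
  proof (rule bounded_linear_intro[of _ "norm z"])
    show "?f (r *\<^sub>R x) = r *\<^sub>R ?f x" for r x
      unfolding scaleR_scaleC by (rule scale)
    show "norm (?f x) \<le> norm x * norm z" for x
      using scalar_row_bound[of z x] by (simp only: mult.commute)
  qed (rule add)
  with scale show ?thesis by (simp add: bounded_clinear_def)
qed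

lift_definition scalar_row :: "('n, complex) hsum \<Rightarrow> (('n, 'h) hsum, 'h :: chilbert_space) cblinfun"
  is "\<lambda>z x. \<Sum>\<^sub>\<infinity>i. hsum_nth z i *\<^sub>C hsum_nth x i"
  by (rule bounded_clinear_scalar_row)

definition scalar_word :: "('n, complex) hsum \<Rightarrow> 'n list \<Rightarrow> complex" where
  "scalar_word z \<alpha> = prod_list (map (hsum_nth z) \<alpha>)"

text \<open>In \<open>ball_auto\<close>, \<open>X o\<^sub>C (scalar_row z)\<^sup>\<dagger>\<close> is \<open>\<Sum>\<^sub>i cnj z\<^sub>i X\<^sub>i\<close>.\<close>

definition ball_auto ::
  "('n, complex) hsum \<Rightarrow> (('n, 'h) hsum, 'h) cblinfun \<Rightarrow> (('n, 'h) hsum, 'h :: chilbert_space) cblinfun"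
  where "ball_auto z X =
    scalar_row z
    - (sqrt (1 - (norm z)\<^sup>2) *\<^sub>R cid) o\<^sub>C cinverse (cid - X o\<^sub>C (scalar_row z)\<^sup>\<dagger>) o\<^sub>C X
      o\<^sub>C defect (scalar_row z)"


section \<open>Free holomorphic functions\<close>

text \<open>\<open>free_series_sums C T\<close>: the sum \<open>\<Sum>\<^sub>k \<Sum>\<^bsub>|\<alpha>| = k\<^esub> C \<alpha>\<close> exists and is \<open>T\<close>. The series in \<open>k\<close> converges
  in operator norm. The inner sums are finite for finite \<open>'n\<close>; for infinite \<open>'n\<close> they are
  taken unconditionally in the strong operator topology.\<close>

definition free_series_sums ::
  "('n list \<Rightarrow> ('a :: chilbert_space, 'b :: chilbert_space) cblinfun) \<Rightarrow> ('a, 'b) cblinfun \<Rightarrow> bool"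
  where
  "free_series_sums C T \<longleftrightarrow>
     (\<exists>P. (\<forall>k \<xi>. ((\<lambda>\<alpha>. C \<alpha> *\<^sub>V \<xi>) has_sum P k *\<^sub>V \<xi>) {\<alpha>. length \<alpha> = k}) \<and> P sums T)"

text \<open>\<open>F\<close> is the free holomorphic function on the open unit ball with coefficients \<open>A\<close>; only the
  values of \<open>F\<close> on the ball matter. Elements of the spatial tensor product of \<open>B(H)\<close> and \<open>B(E, G)\<close>
  are operators from \<open>H \<otimes> E\<close> to \<open>H \<otimes> G\<close>.\<close>

definition free_holomorphic :: "('h :: chilbert_space \<Rightarrow> 'e :: chilbert_space \<Rightarrow> 'he :: chilbert_space)
    \<Rightarrow> ('h \<Rightarrow> 'g :: chilbert_space \<Rightarrow> 'hg :: chilbert_space)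
    \<Rightarrow> ('n list \<Rightarrow> ('e, 'g) cblinfun)
    \<Rightarrow> ((('n, 'h) hsum, 'h) cblinfun \<Rightarrow> ('he, 'hg) cblinfun) \<Rightarrow> bool" where
  "free_holomorphic s t A F \<longleftrightarrow>
     (\<forall>X. norm X < 1 \<longrightarrow> free_series_sums (\<lambda>\<alpha>. op_tensor s t (row_word X \<alpha>) (A \<alpha>)) (F X))"

definition sup_norm :: "((('n, 'h :: chilbert_space) hsum, 'h) cblinfun
    \<Rightarrow> ('a :: chilbert_space, 'b :: chilbert_space) cblinfun) \<Rightarrow> ereal" where
  "sup_norm F = (SUP X\<in>{X. norm X < 1}. ereal (norm (F X)))"

text \<open>The value at a scalar point \<open>z\<close>, as an operator between the coefficient spaces; its
  identification with an operator from \<open>H \<otimes> E\<close> to \<open>H \<otimes> G\<close> is \<open>op_tensor s t cid (scalar_value A z)\<close>.\<close>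

definition scalar_value :: "('n list \<Rightarrow> ('e :: chilbert_space, 'g :: chilbert_space) cblinfun)
    \<Rightarrow> ('n, complex) hsum \<Rightarrow> ('e, 'g) cblinfun" where
  "scalar_value A z = (THE T. free_series_sums (\<lambda>\<alpha>. scalar_word z \<alpha> *\<^sub>C A \<alpha>) T)"

end

theory Submission
  imports Defs
begin

text \<open>Write \<open>F(z)\<close> for the value of \<open>F\<close> at the scalar row \<open>z\<close> and \<open>D\<close> for its defect
  \<open>(I - F(z) F(z)\<^sup>*)\<^sup>1\<^sup>/\<^sup>2\<close>. For a fractional transform \<open>\<Psi>\<close> of \<open>B\<close> at \<open>A\<close> the operator \<open>I - \<Psi> \<Psi>\<^sup>*\<close> is
  \<open>D\<^bsub>A\<^sup>*\<^esub> (I - B A\<^sup>*)\<^sup>-\<^sup>1 (I - B B\<^sup>*) (I - A B\<^sup>*)\<^sup>-\<^sup>1 D\<^bsub>A\<^sup>*\<^esub>\<close> (\<open>frac_transform_defect_identity\<close>), and the ball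
  automorphism is the fractional transform at a scalar row. Hence the two asserted inequalities say
  that one and the same operator is positive, and only the second needs an argument.

  Let \<open>T = (I - X z\<^sup>*)\<^sup>-\<^sup>1 (I - X X\<^sup>*)\<^sup>1\<^sup>/\<^sup>2\<close> and \<open>\<kappa> = 1 / (1 - \<bar>z\<bar>\<^sup>2)\<close>. In the Fock space model a contractive free
  holomorphic function becomes a contractive multi-analytic operator \<open>M\<close>, whose adjoint acts as
  \<open>F(X)\<^sup>*\<close> on the range of the Poisson kernel of \<open>X\<close> and as \<open>F(z)\<^sup>*\<close> on the multiples of a kernel vector of
  norm square \<open>\<kappa>\<close>; the cross Gram operator of these two pieces is \<open>T\<close>. Positivity of \<open>I - M M\<^sup>*\<close> on their sum
  is a positive two by two block form, and its Schur complement is the claim.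

  The proof keeps these two pieces and drops the Fock space. An infinite dimensional \<open>H\<close> contains
  \<open>H \<oplus> H\<close> isometrically, which leaves room for operators \<open>V\<^sub>1\<close>, \<open>V\<^sub>2\<close> on \<open>H\<close> with \<open>V\<^sub>1\<^sup>* V\<^sub>1 = I\<close>, \<open>V\<^sub>2\<^sup>* V\<^sub>2 = \<kappa> I\<close>,
  \<open>V\<^sub>1\<^sup>* V\<^sub>2 = t T\<close>, and for \<open>t < 1\<close> there is a strict row contraction \<open>Y\<close> on \<open>H\<close> with \<open>V\<^sub>1\<^sup>* Y\<^sub>i = X\<^sub>i V\<^sub>1\<^sup>*\<close> and
  \<open>V\<^sub>2\<^sup>* Y\<^sub>i = z\<^sub>i V\<^sub>2\<^sup>*\<close> (\<open>kernel_dilation_exists\<close>). Free holomorphic functions respect such intertwining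
  relations (\<open>free_holomorphic_intertwine\<close>), so contractivity of \<open>F(Y)\<close> gives the block form
  (\<open>kernel_form_nonneg\<close>) as \<open>t\<close> tends to \<open>1\<close>. The same form at \<open>X = 0\<close> shows that \<open>F(z)\<close> is a strict contraction
  (\<open>norm_scalar_value_less_one\<close>), so that its defect is invertible, and the Schur complement is taken in
  \<open>schwarz_pick_defect\<close>.

  The defects are square roots of operators \<open>I - x\<close> with \<open>x\<close> of norm less than \<open>1\<close>. Such a root is found as
  a fixed point near the identity, which also yields its commutation properties. Tensor products of
  operators and isometries are obtained by extending maps from total families.\<close>

section \<open>Algebra of bounded operators\<close>

lemma cblinfun_eqI: "(\<And>x. S *\<^sub>V x = T *\<^sub>V x) \<Longrightarrow> S = T"
  by (simp add: cblinfun_apply_inject[symmetric] fun_eq_iff)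

lemma cblinfun_apply_simps [simp]:
  "(0 :: ('a :: chilbert_space, 'b :: chilbert_space) cblinfun) *\<^sub>V x = 0"
  "(S + T) *\<^sub>V x = S *\<^sub>V x + T *\<^sub>V x"
  "(S - T) *\<^sub>V x = S *\<^sub>V x - T *\<^sub>V x"
  "(- T) *\<^sub>V x = - (T *\<^sub>V x)"
  "(r *\<^sub>R T) *\<^sub>V x = r *\<^sub>R (T *\<^sub>V x)"
  "(c *\<^sub>C T) *\<^sub>V x = c *\<^sub>C (T *\<^sub>V x)"
  by (transfer; simp)+

lemma cid_apply [simp]: "cid *\<^sub>V x = x"
  by transfer simp

lemma ccomp_apply [simp]: "(S o\<^sub>C T) *\<^sub>V x = S *\<^sub>V T *\<^sub>V x"
  by transfer simp

lemma bounded_clinear_cblinfun: "bounded_clinear (cblinfun_apply T)"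
  using cblinfun_apply by blast

lemmas bounded_linear_cblinfun = bounded_clinearD(1)[OF bounded_clinear_cblinfun]

lemma cblinfun_linear_simps:
  "T *\<^sub>V 0 = 0"
  "T *\<^sub>V (x + y) = T *\<^sub>V x + T *\<^sub>V y"
  "T *\<^sub>V (x - y) = T *\<^sub>V x - T *\<^sub>V y"
  "T *\<^sub>V (- x) = - (T *\<^sub>V x)"
  "T *\<^sub>V (r *\<^sub>R x) = r *\<^sub>R (T *\<^sub>V x)"
  "T *\<^sub>V (c *\<^sub>C x) = c *\<^sub>C (T *\<^sub>V x)"
  "T *\<^sub>V (\<Sum>i\<in>I. f i) = (\<Sum>i\<in>I. T *\<^sub>V f i)"
  using bounded_linear.linear[OF bounded_linear_cblinfun[of T]]
    bounded_clinearD(2)[OF bounded_clinear_cblinfun[of T]]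
  by (simp_all add: linear_0 linear_add linear_diff linear_neg linear_scale linear_sum)

lemmas cblinfun_algebra = cblinfun_linear_simps scaleR_add_right scaleR_diff_right

lemma cblinfun_apply_CBlinfun: "bounded_clinear f \<Longrightarrow> CBlinfun f *\<^sub>V x = f x"
  by (simp add: CBlinfun_inverse)

lemma ccomp_assoc: "(R o\<^sub>C S) o\<^sub>C T = R o\<^sub>C (S o\<^sub>C T)"
  by (rule cblinfun_eqI) simp

lemma cid_ccomp [simp]: "cid o\<^sub>C T = T" "T o\<^sub>C cid = T"
  by (rule cblinfun_eqI, simp)+

lemma ccomp_linear_simps:
  "(S + S') o\<^sub>C T = S o\<^sub>C T + S' o\<^sub>C T" "T o\<^sub>C (R + R') = T o\<^sub>C R + T o\<^sub>C R'"
  "(S - S') o\<^sub>C T = S o\<^sub>C T - S' o\<^sub>C T" "T o\<^sub>C (R - R') = T o\<^sub>C R - T o\<^sub>C R'"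
  "(r *\<^sub>R S) o\<^sub>C T = r *\<^sub>R (S o\<^sub>C T)" "T o\<^sub>C (r *\<^sub>R R) = r *\<^sub>R (T o\<^sub>C R)"
  by (rule cblinfun_eqI, simp add: cblinfun_linear_simps)+

lemma norm_cblinfun_apply: "norm (T *\<^sub>V x) \<le> norm T * norm x"
  by transfer (simp add: bounded_clinearD onorm)

lemma norm_cblinfun_leI: "(\<And>x. norm (T *\<^sub>V x) \<le> b * norm x) \<Longrightarrow> 0 \<le> b \<Longrightarrow> norm T \<le> b"
  by transfer (rule onorm_bound)

lemma norm_ccomp_le: "norm (S o\<^sub>C T) \<le> norm S * norm T"
proof (rule norm_cblinfun_leI)
  fix x
  have "norm (S *\<^sub>V T *\<^sub>V x) \<le> norm S * (norm T * norm x)"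
    by (meson mult_left_mono norm_cblinfun_apply norm_ge_zero order_trans)
  then show "norm ((S o\<^sub>C T) *\<^sub>V x) \<le> norm S * norm T * norm x" by (simp add: mult.assoc)
qed simp

lemma norm_cid_le: "norm cid \<le> 1"
  by (rule norm_cblinfun_leI) auto

text \<open>A Cauchy sequence converges among the real bounded linear maps, and complex linearity passes to
  the pointwise limit.\<close>

instance cblinfun :: (chilbert_space, chilbert_space) banach
proof
  fix X :: "nat \<Rightarrow> ('a, 'b) cblinfun"
  assume X: "Cauchy X"
  have lin: "bounded_linear (cblinfun_apply (X n))" for n
    by (rule bounded_linear_cblinfun)
  define B where "B n = Blinfun (cblinfun_apply (X n))" for n
  have B: "blinfun_apply (B n) x = X n *\<^sub>V x" for n x
    by (simp add: B_def bounded_linear_Blinfun_apply lin)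
  have "norm (B m - B n) = norm (X m - X n)" for m n
    by (simp add: norm_blinfun.rep_eq norm_cblinfun.rep_eq onorm_def blinfun.diff_left B)
  then have "Cauchy B"
    using X by (simp add: Cauchy_def dist_norm)
  then obtain L where L: "B \<longlonglongrightarrow> L"
    by (auto simp: Cauchy_convergent_iff convergent_def)
  have ptw: "(\<lambda>n. X n *\<^sub>V x) \<longlonglongrightarrow> blinfun_apply L x" for x
    using L by (auto simp flip: B intro!: tendsto_intros)
  have "blinfun_apply L (c *\<^sub>C x) = c *\<^sub>C blinfun_apply L x" for c x
  proof (rule LIMSEQ_unique)
    show "(\<lambda>n. X n *\<^sub>V (c *\<^sub>C x)) \<longlonglongrightarrow> blinfun_apply L (c *\<^sub>C x)" by (rule ptw)
    show "(\<lambda>n. X n *\<^sub>V (c *\<^sub>C x)) \<longlonglongrightarrow> c *\<^sub>C blinfun_apply L x"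
      unfolding cblinfun_linear_simps
      by (rule bounded_linear.tendsto[OF bounded_linear_scaleC_right ptw])
  qed
  then have "bounded_clinear (blinfun_apply L)"
    by (simp add: bounded_clinear_def blinfun.bounded_linear_right)
  then have T: "CBlinfun (blinfun_apply L) *\<^sub>V x = blinfun_apply L x" for x
    by (rule cblinfun_apply_CBlinfun)
  have "norm (X n - CBlinfun (blinfun_apply L)) = norm (B n - L)" for n
    by (simp add: norm_blinfun.rep_eq norm_cblinfun.rep_eq onorm_def blinfun.diff_left B T)
  then have "X \<longlonglongrightarrow> CBlinfun (blinfun_apply L)"
    using L by (simp add: LIMSEQ_iff)
  then show "convergent X" by (auto simp: convergent_def)
qed

lemma cinverse_eqI:
  assumes "S o\<^sub>C T = cid" "T o\<^sub>C S = cid"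
  shows "cinverse T = S"
  unfolding cinverse_def
proof (rule the_equality)
  fix R assume "R o\<^sub>C T = cid \<and> T o\<^sub>C R = cid"
  then show "R = S"
    using assms by (metis ccomp_assoc cid_ccomp)
qed (use assms in simp)

text \<open>A left and a right inverse arise as the fixed points of the contractions \<open>S \<mapsto> cid + S B\<close> and
  \<open>S \<mapsto> cid + B S\<close>; being one-sided inverses of the same operator, they coincide.\<close>

lemma cinverse_one_minus:
  fixes B :: "('a :: chilbert_space, 'a) cblinfun"
  assumes "norm B < 1"
  shows "cinverse (cid - B) o\<^sub>C (cid - B) = cid" "(cid - B) o\<^sub>C cinverse (cid - B) = cid"
proof -
  have "\<exists>!S. cid + B o\<^sub>C S = S"
  proof (rule banach_fix_type[of "norm B"])
    show "\<forall>S T. dist (cid + B o\<^sub>C S) (cid + B o\<^sub>C T) \<le> norm B * dist S T"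
    proof safe
      fix S T :: "('a, 'a) cblinfun"
      have "(cid + B o\<^sub>C S) - (cid + B o\<^sub>C T) = B o\<^sub>C (S - T)"
        by (simp add: ccomp_linear_simps)
      then show "dist (cid + B o\<^sub>C S) (cid + B o\<^sub>C T) \<le> norm B * dist S T"
        by (simp only: dist_norm norm_ccomp_le)
    qed
  qed (use assms in auto)
  then obtain S where S: "cid + B o\<^sub>C S = S" by blast
  have "\<exists>!S. cid + S o\<^sub>C B = S"
  proof (rule banach_fix_type[of "norm B"])
    show "\<forall>S T. dist (cid + S o\<^sub>C B) (cid + T o\<^sub>C B) \<le> norm B * dist S T"
    proof safe
      fix S T :: "('a, 'a) cblinfun"
      have "(cid + S o\<^sub>C B) - (cid + T o\<^sub>C B) = (S - T) o\<^sub>C B"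
        by (simp add: ccomp_linear_simps)
      then show "dist (cid + S o\<^sub>C B) (cid + T o\<^sub>C B) \<le> norm B * dist S T"
        by (simp only: dist_norm norm_ccomp_le mult.commute[of "norm B"])
    qed
  qed (use assms in auto)
  then obtain S' where S': "cid + S' o\<^sub>C B = S'" by blast
  have right: "(cid - B) o\<^sub>C S = cid"
    using S by (simp add: ccomp_linear_simps) (metis add_diff_cancel_right')
  have left: "S' o\<^sub>C (cid - B) = cid"
    using S' by (simp add: ccomp_linear_simps) (metis add_diff_cancel_right')
  have "S' = S"
    using left right by (metis ccomp_assoc cid_ccomp)
  with left right have "cinverse (cid - B) = S"
    by (intro cinverse_eqI) auto
  with left right \<open>S' = S\<close> show "cinverse (cid - B) o\<^sub>C (cid - B) = cid" "(cid - B) o\<^sub>C cinverse (cid - B) = cid"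
    by auto
qed

section \<open>Adjoints\<close>

text \<open>Minimising \<open>\<lambda>x. (norm x)\<^sup>2 / 2 - f x\<close> over the subspace gives both the Riesz representation
  theorem and orthogonal projections.\<close>

lemma riesz_on_subspace:
  fixes f :: "'a :: {real_inner, banach} \<Rightarrow> real"
  assumes S: "subspace S" and f: "bounded_linear f"
  shows "\<exists>v\<in>closure S. \<forall>y\<in>S. inner v y = f y"
proof -
  interpret f: bounded_linear f by fact
  define J where "J x = (norm x)\<^sup>2 / 2 - f x" for x
  obtain K where K: "\<And>x. norm (f x) \<le> norm x * K" using f.bounded by blast
  have lower: "- (K\<^sup>2) / 2 \<le> J x" for x
  proof -
    have "f x \<le> norm x * K" using K[of x] by simp
    moreover have "0 \<le> (norm x - K)\<^sup>2" by simp
    ultimately show ?thesis by (simp add: J_def power2_eq_square algebra_simps)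
  qed
  define m where "m = (INF x\<in>S. J x)"
  have bdd: "bdd_below (J ` S)"
    using lower by (intro bdd_belowI[of _ "- (K\<^sup>2) / 2"]) auto
  have ne: "S \<noteq> {}" using subspace_0[OF S] by auto
  have m: "m \<le> J x" if "x \<in> S" for x
    unfolding m_def by (rule cINF_lower[OF bdd that])
  have "\<exists>x\<in>S. J x < m + 1 / real (Suc n)" for n
    using cINF_less_iff[OF ne bdd, of "m + 1 / real (Suc n)"] unfolding m_def by simp
  then obtain x where xS: "\<And>n. x n \<in> S" and xm: "\<And>n. J (x n) < m + 1 / real (Suc n)"
    by metis
  have parallelogram: "(norm (a - b))\<^sup>2 / 4 = J a + J b - 2 * J ((1/2) *\<^sub>R (a + b))" for a b
    unfolding J_def power2_norm_eq_inner f.scaleR f.add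
    by (simp add: inner_simps inner_commute field_simps)
  have close: "(norm (x k - x n))\<^sup>2 / 4 \<le> 1 / real (Suc k) + 1 / real (Suc n)" for k n
  proof -
    have "m \<le> J ((1/2) *\<^sub>R (x k + x n))"
      by (intro m subspace_scale[OF S] subspace_add[OF S] xS)
    then show ?thesis using parallelogram[of "x k" "x n"] xm[of k] xm[of n] by linarith
  qed
  have "Cauchy x"
  proof (rule CauchyI)
    fix e :: real assume "0 < e"
    then obtain N where N: "1 / real (Suc N) < e\<^sup>2 / 8"
      using nat_approx_posE[of "e\<^sup>2 / 8"] by auto
    have "norm (x k - x n) < e" if "k \<ge> N" "n \<ge> N" for k n
    proof -
      have "1 / real (Suc k) \<le> 1 / real (Suc N)" "1 / real (Suc n) \<le> 1 / real (Suc N)"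
        using that by (simp_all add: frac_le)
      then have "(norm (x k - x n))\<^sup>2 < e\<^sup>2" using close[of k n] N by linarith
      then show ?thesis using \<open>0 < e\<close> by (rule power2_less_imp_less[OF _ less_imp_le])
    qed
    then show "\<exists>N. \<forall>k\<ge>N. \<forall>n\<ge>N. norm (x k - x n) < e" by blast
  qed
  then obtain v where v: "x \<longlonglongrightarrow> v" by (auto simp: Cauchy_convergent_iff convergent_def)
  have J_tendsto: "(\<lambda>n. J (x n + y)) \<longlonglongrightarrow> J (v + y)" for y
    unfolding J_def by (intro tendsto_intros v f.tendsto) simp
  have "J v \<le> m"
  proof (rule LIMSEQ_le)
    show "(\<lambda>n. J (x n)) \<longlonglongrightarrow> J v" using J_tendsto[of 0] by simp
    show "(\<lambda>n. m + 1 / real (Suc n)) \<longlonglongrightarrow> m"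
      using tendsto_add[OF tendsto_const LIMSEQ_inverse_real_of_nat, of m]
      by (simp add: inverse_eq_divide)
  qed (use xm less_imp_le in blast)
  have "inner v y = f y" if y: "y \<in> S" for y
  proof -
    define a b where "a = inner v y - f y" and "b = (norm y)\<^sup>2 / 2"
    have "0 \<le> b" by (simp add: b_def)
    have pos: "0 \<le> s * a + s\<^sup>2 * b" for s
    proof -
      have "m \<le> J (v + s *\<^sub>R y)"
      proof (rule LIMSEQ_le_const[OF J_tendsto])
        show "\<exists>N. \<forall>n\<ge>N. m \<le> J (x n + s *\<^sub>R y)"
          by (intro exI allI impI m subspace_add[OF S] subspace_scale[OF S] xS y)
      qed
      then have "J v \<le> J (v + s *\<^sub>R y)" using \<open>J v \<le> m\<close> by simp
      then show ?thesis
        unfolding J_def a_def b_def power2_norm_eq_inner f.scaleR f.add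
        by (simp add: inner_simps inner_commute algebra_simps power2_eq_square)
    qed
    have "0 \<le> (- a / (2 * b + 1)) * a + (- a / (2 * b + 1))\<^sup>2 * b" by (rule pos)
    also have "\<dots> = - (a\<^sup>2 * (b + 1)) / (2 * b + 1)\<^sup>2"
      using \<open>0 \<le> b\<close> by (simp add: power2_eq_square divide_simps) (simp add: algebra_simps)
    finally have "a\<^sup>2 * (b + 1) \<le> 0"
      using \<open>0 \<le> b\<close> by (simp add: divide_simps split: if_splits)
    then have "a\<^sup>2 \<le> 0" using \<open>0 \<le> b\<close> by (simp add: mult_le_0_iff)
    then show ?thesis by (simp add: a_def)
  qed
  moreover have "v \<in> closure S" using v xS by (auto simp: closure_sequential)
  ultimately show ?thesis by blast
qed

text \<open>Over \<open>\<complex>\<close> the real inner product determines \<open>cinner\<close>: its values at \<open>x\<close> and \<open>\<i> x\<close> are the real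
  part and minus the imaginary part. Adjoints can therefore be handled with \<open>inner\<close> throughout.\<close>

lemma cinner_eqI_inner:
  assumes "\<And>c. inner (c *\<^sub>C x) y = inner (c *\<^sub>C x') y'"
  shows "cinner x y = cinner x' y'"
  using assms[of 1] assms[of "\<i>"]
  by (simp add: inner_eq_Re_cinner cinner_scaleC_left complex_eq_iff)

lemma inner_scaleC_right: "inner x (c *\<^sub>C (y :: 'a :: chilbert_space)) = inner (cnj c *\<^sub>C x) y"
  unfolding inner_eq_Re_cinner cinner_scaleC_left cinner_scaleC_right by simp

lemma inner_ext: "(\<And>z. inner z x = inner z y) \<Longrightarrow> x = (y :: 'a :: real_inner)"
  using inner_eq_zero_iff[of "x - y"] by (simp add: inner_diff_right)

lemma adjoint_exists:
  fixes T :: "('a :: chilbert_space, 'b :: chilbert_space) cblinfun"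
  shows "\<exists>S. \<forall>x y. inner (T *\<^sub>V x) y = inner x (S *\<^sub>V y)"
proof -
  have "\<exists>v. \<forall>x. inner (T *\<^sub>V x) y = inner x v" for y
    using riesz_on_subspace[OF subspace_UNIV, of "\<lambda>x. inner (T *\<^sub>V x) y"]
      bounded_linear_compose[OF bounded_linear_inner_left bounded_linear_cblinfun, of T y]
    by (metis UNIV_I inner_commute)
  then obtain g where g: "\<And>x y. inner (T *\<^sub>V x) y = inner x (g y)" by metis
  have add: "g (y + z) = g y + g z" for y z
    by (rule inner_ext) (simp add: inner_add_right flip: g)
  have scale: "g (c *\<^sub>C y) = c *\<^sub>C g y" for c y
    by (rule inner_ext) (simp add: inner_scaleC_right cblinfun_linear_simps flip: g)
  have "norm (g y) \<le> norm y * norm T" for y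
  proof -
    have "norm (g y) * norm (g y) = inner (T *\<^sub>V g y) y"
      by (simp add: g flip: power2_norm_eq_inner power2_eq_square)
    also have "\<dots> \<le> norm (T *\<^sub>V g y) * norm y" by (rule norm_cauchy_schwarz)
    also have "\<dots> \<le> (norm T * norm (g y)) * norm y"
      by (intro mult_right_mono norm_cblinfun_apply) simp
    finally show ?thesis
      by (cases "norm (g y) = 0") (simp_all add: mult.commute mult.left_commute)
  qed
  then have "bounded_linear g"
    using add scale by (intro bounded_linear_intro[of _ "norm T"]) (simp_all add: scaleR_scaleC)
  with scale have "bounded_clinear g" by (simp add: bounded_clinear_def)
  then show ?thesis
    by (intro exI[of _ "CBlinfun g"]) (simp add: cblinfun_apply_CBlinfun g)
qed

lemma cinner_adj: "cinner (T *\<^sub>V x) y = cinner x (T\<^sup>\<dagger> *\<^sub>V y)"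
proof -
  obtain S where S: "\<And>x y. inner (T *\<^sub>V x) y = inner x (S *\<^sub>V y)" using adjoint_exists by blast
  have SC: "cinner (T *\<^sub>V x) y = cinner x (S *\<^sub>V y)" for x y
    by (rule cinner_eqI_inner) (simp add: S flip: cblinfun_linear_simps)
  have "T\<^sup>\<dagger> = S"
    unfolding adj_def
  proof (rule the_equality)
    fix R assume R: "\<forall>x y. cinner (T *\<^sub>V x) y = cinner x (R *\<^sub>V y)"
    show "R = S"
      by (rule cblinfun_eqI, rule inner_ext) (metis R SC inner_eq_Re_cinner)
  qed (simp add: SC)
  then show ?thesis by (simp add: SC)
qed

lemma inner_adj: "inner (T *\<^sub>V x) y = inner x (T\<^sup>\<dagger> *\<^sub>V y)"
  by (simp add: inner_eq_Re_cinner cinner_adj)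

lemma inner_adj': "inner x (T *\<^sub>V y) = inner (T\<^sup>\<dagger> *\<^sub>V x) y"
  by (metis inner_adj inner_commute)

lemma adj_eqI: "(\<And>x y. inner (T *\<^sub>V x) y = inner x (S *\<^sub>V y)) \<Longrightarrow> T\<^sup>\<dagger> = S"
  by (rule cblinfun_eqI, rule inner_ext) (metis inner_adj)

lemma adj_adj [simp]: "(T\<^sup>\<dagger>)\<^sup>\<dagger> = T"
  by (rule adj_eqI) (simp add: inner_adj')

lemma adj_simps [simp]:
  "(S o\<^sub>C T)\<^sup>\<dagger> = T\<^sup>\<dagger> o\<^sub>C S\<^sup>\<dagger>"
  "(P + Q)\<^sup>\<dagger> = P\<^sup>\<dagger> + Q\<^sup>\<dagger>"
  "(P - Q)\<^sup>\<dagger> = P\<^sup>\<dagger> - Q\<^sup>\<dagger>"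
  "(r *\<^sub>R P)\<^sup>\<dagger> = r *\<^sub>R P\<^sup>\<dagger>"
  "cid\<^sup>\<dagger> = cid"
  by (rule adj_eqI, simp add: inner_adj inner_add_left inner_add_right inner_diff_left inner_diff_right)+

lemma norm_adj [simp]: "norm (T\<^sup>\<dagger>) = norm T"
proof -
  have le: "norm (S\<^sup>\<dagger>) \<le> norm S" for S :: "('c :: chilbert_space, 'd :: chilbert_space) cblinfun"
  proof (rule norm_cblinfun_leI)
    fix y
    have "norm (S\<^sup>\<dagger> *\<^sub>V y) * norm (S\<^sup>\<dagger> *\<^sub>V y) = inner (S *\<^sub>V S\<^sup>\<dagger> *\<^sub>V y) y"
      by (simp add: inner_adj flip: power2_norm_eq_inner power2_eq_square)
    also have "\<dots> \<le> norm (S *\<^sub>V S\<^sup>\<dagger> *\<^sub>V y) * norm y" by (rule norm_cauchy_schwarz)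
    also have "\<dots> \<le> (norm S * norm (S\<^sup>\<dagger> *\<^sub>V y)) * norm y"
      by (intro mult_right_mono norm_cblinfun_apply) simp
    finally show "norm (S\<^sup>\<dagger> *\<^sub>V y) \<le> norm S * norm y"
      by (cases "norm (S\<^sup>\<dagger> *\<^sub>V y) = 0") (simp_all add: mult.commute mult.left_commute)
  qed simp
  show ?thesis using le[of T] le[of "T\<^sup>\<dagger>"] by simp
qed

lemma adj_cinverse_one_minus:
  assumes "norm B < 1"
  shows "(cinverse (cid - B))\<^sup>\<dagger> = cinverse (cid - B\<^sup>\<dagger>)"
proof (rule cinverse_eqI[symmetric])
  show "(cinverse (cid - B))\<^sup>\<dagger> o\<^sub>C (cid - B\<^sup>\<dagger>) = cid"
    using arg_cong[OF cinverse_one_minus(2)[OF assms], of adj] by simp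
  show "(cid - B\<^sup>\<dagger>) o\<^sub>C (cinverse (cid - B))\<^sup>\<dagger> = cid"
    using arg_cong[OF cinverse_one_minus(1)[OF assms], of adj] by simp
qed

lemma positive_opI:
  assumes "T\<^sup>\<dagger> = T" "\<And>x. 0 \<le> inner (T *\<^sub>V x) x"
  shows "positive_op T"
  unfolding positive_op_def
proof safe
  fix x
  have "cinner (T *\<^sub>V x) x = cnj (cinner (T *\<^sub>V x) x)"
    by (metis assms(1) cinner_adj cinner_commute)
  then show "cinner (T *\<^sub>V x) x \<in> \<real>" by (metis Reals_cnj_iff)
  show "0 \<le> Re (cinner (T *\<^sub>V x) x)" using assms(2) by (simp add: inner_eq_Re_cinner)
qed

section \<open>Square roots near the identity and defect operators\<close>

text \<open>The square root is \<open>cid - Z\<close>, where \<open>Z\<close> solves \<open>2 Z = x + Z\<^sup>2\<close>. On the ball of radius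
  \<open>\<rho> = 1 - sqrt (1 - norm x)\<close> the map \<open>Z \<mapsto> (x + Z\<^sup>2) / 2\<close> is a contraction with constant \<open>\<rho>\<close>.\<close>

lemma sqrt_one_minus_exists:
  fixes x :: "('a :: chilbert_space, 'a) cblinfun"
  assumes x: "norm x < 1"
  shows "\<exists>Z. norm Z < 1 \<and> (cid - Z) o\<^sub>C (cid - Z) = cid - x"
proof -
  define \<rho> where "\<rho> = 1 - sqrt (1 - norm x)"
  have \<rho>: "0 \<le> \<rho>" "\<rho> < 1" using x by (auto simp: \<rho>_def)
  have "(1 - \<rho>)\<^sup>2 = 1 - norm x" using x by (simp add: \<rho>_def)
  then have \<rho>2: "norm x + \<rho> * \<rho> = 2 * \<rho>" by (simp add: power2_eq_square algebra_simps)
  define f where "f Z = (1/2) *\<^sub>R (x + Z o\<^sub>C Z)" for Z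
  have "\<exists>!Z\<in>cball 0 \<rho>. f Z = Z"
  proof (rule Banach_fix[where c = \<rho>])
    show "f ` cball 0 \<rho> \<subseteq> cball 0 \<rho>"
    proof clarify
      fix Z :: "('a, 'a) cblinfun" assume "Z \<in> cball 0 \<rho>"
      then have "norm Z \<le> \<rho>" by simp
      then have "norm (Z o\<^sub>C Z) \<le> \<rho> * \<rho>"
        by (intro order_trans[OF norm_ccomp_le] mult_mono) (auto simp: \<rho>)
      then have "norm (x + Z o\<^sub>C Z) \<le> 2 * \<rho>"
        using norm_triangle_ineq[of x "Z o\<^sub>C Z"] \<rho>2 by linarith
      then show "f Z \<in> cball 0 \<rho>" by (simp add: f_def)
    qed
    fix Z W :: "('a, 'a) cblinfun" assume ZW: "Z \<in> cball 0 \<rho>" "W \<in> cball 0 \<rho>"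
    have diff: "f Z - f W = (1/2) *\<^sub>R (Z o\<^sub>C (Z - W) + (Z - W) o\<^sub>C W)"
      by (rule cblinfun_eqI) (simp add: f_def cblinfun_algebra)
    have "norm (Z o\<^sub>C (Z - W) + (Z - W) o\<^sub>C W) \<le> \<rho> * norm (Z - W) + norm (Z - W) * \<rho>"
      using ZW by (intro order_trans[OF norm_triangle_ineq] add_mono
          order_trans[OF norm_ccomp_le] mult_mono) (auto simp: \<rho>)
    then show "dist (f Z) (f W) \<le> \<rho> * dist Z W"
      unfolding dist_norm diff norm_scaleR by simp
  qed (use \<rho> in \<open>auto intro: complete_eq_closed[THEN iffD2]\<close>)
  then obtain Z where Z: "norm Z \<le> \<rho>" "f Z = Z" by auto
  have "x + Z o\<^sub>C Z = 2 *\<^sub>R f Z" by (simp add: f_def)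
  then have "x + Z o\<^sub>C Z = Z + Z" by (simp add: Z scaleR_2)
  then have "(cid - Z) o\<^sub>C (cid - Z) = cid - x"
    by (simp add: ccomp_linear_simps algebra_simps)
  with Z \<rho> show ?thesis by (intro exI[of _ Z]) auto
qed

text \<open>With \<open>S\<^sub>i = cid - Z\<^sub>i\<close>, the equation \<open>S\<^sub>2 Q + Q S\<^sub>1 = 0\<close> reads \<open>2 Q = Z\<^sub>2 Q + Q Z\<^sub>1\<close>, where the
  right-hand side has norm less than that of \<open>2 Q\<close> unless \<open>Q = 0\<close>. Uniqueness, self-adjointness and commutation
  properties of square roots all come from this.\<close>

lemma sylvester_zero:
  assumes "norm Z1 < 1" "norm Z2 < 1" "(cid - Z2) o\<^sub>C Q + Q o\<^sub>C (cid - Z1) = 0"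
  shows "Q = 0"
proof (rule ccontr)
  assume "Q \<noteq> 0"
  have "2 *\<^sub>R Q - (Z2 o\<^sub>C Q + Q o\<^sub>C Z1) = (cid - Z2) o\<^sub>C Q + Q o\<^sub>C (cid - Z1)"
    by (simp add: ccomp_linear_simps scaleR_2)
  then have "2 *\<^sub>R Q = Z2 o\<^sub>C Q + Q o\<^sub>C Z1"
    unfolding assms(3) by simp
  then have "2 * norm Q = norm (Z2 o\<^sub>C Q + Q o\<^sub>C Z1)"
    by (metis abs_numeral norm_scaleR)
  also have "\<dots> \<le> norm Z2 * norm Q + norm Q * norm Z1"
    by (intro order_trans[OF norm_triangle_ineq] add_mono norm_ccomp_le)
  also have "\<dots> < 1 * norm Q + norm Q * 1"
    using assms \<open>Q \<noteq> 0\<close> by (intro add_strict_mono mult_strict_right_mono mult_strict_left_mono) auto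
  finally show False by simp
qed

text \<open>With \<open>Q = W S\<^sub>1 - S\<^sub>2 W\<close> one has \<open>S\<^sub>2 Q + Q S\<^sub>1 = W S\<^sub>1\<^sup>2 - S\<^sub>2\<^sup>2 W\<close>, and the right-hand side vanishes.\<close>

lemma square_roots_intertwine:
  assumes "norm Z1 < 1" "norm Z2 < 1"
    and "W o\<^sub>C ((cid - Z1) o\<^sub>C (cid - Z1)) = ((cid - Z2) o\<^sub>C (cid - Z2)) o\<^sub>C W"
  shows "W o\<^sub>C (cid - Z1) = (cid - Z2) o\<^sub>C W"
proof -
  define S1 where "S1 = cid - Z1"
  define S2 where "S2 = cid - Z2"
  have "S2 o\<^sub>C (W o\<^sub>C S1 - S2 o\<^sub>C W) + (W o\<^sub>C S1 - S2 o\<^sub>C W) o\<^sub>C S1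
      = W o\<^sub>C (S1 o\<^sub>C S1) - (S2 o\<^sub>C S2) o\<^sub>C W"
    by (rule cblinfun_eqI) (simp add: cblinfun_algebra)
  then have "S2 o\<^sub>C (W o\<^sub>C S1 - S2 o\<^sub>C W) + (W o\<^sub>C S1 - S2 o\<^sub>C W) o\<^sub>C S1 = 0"
    using assms(3) by (simp add: S1_def S2_def)
  then have "W o\<^sub>C S1 - S2 o\<^sub>C W = 0"
    using assms(1,2) unfolding S1_def S2_def by (rule sylvester_zero[rotated 2])
  then show ?thesis by (simp add: S1_def S2_def)
qed

lemma op_sqrt_one_minus_exists:
  fixes x :: "('a :: chilbert_space, 'a) cblinfun"
  assumes x: "norm x < 1" and selfadj: "x\<^sup>\<dagger> = x"
  obtains Z where "norm Z < 1" "Z\<^sup>\<dagger> = Z" "(cid - Z) o\<^sub>C (cid - Z) = cid - x"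
    "positive_op (cid - Z)"
    "\<forall>R. positive_op R \<longrightarrow> R o\<^sub>C R = cid - x \<longrightarrow> R = cid - Z"
    "op_sqrt (cid - x) = cid - Z"
proof -
  obtain Z where Z: "norm Z < 1" and Z2: "(cid - Z) o\<^sub>C (cid - Z) = cid - x"
    using sqrt_one_minus_exists[OF x] by blast
  \<comment> \<open>\<open>cid - Z\<close> and its adjoint are both square roots near the identity, so they agree.\<close>
  have Z2': "(cid - Z\<^sup>\<dagger>) o\<^sub>C (cid - Z\<^sup>\<dagger>) = cid - x"
    using arg_cong[OF Z2, of adj] by (simp add: selfadj)
  have "cid o\<^sub>C (cid - Z) = (cid - Z\<^sup>\<dagger>) o\<^sub>C cid"
    by (rule square_roots_intertwine) (simp_all add: Z Z2 Z2')
  then have adj: "Z\<^sup>\<dagger> = Z" by simp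
  have bound: "(1 - norm Z) * (norm v)\<^sup>2 \<le> inner ((cid - Z) *\<^sub>V v) v" for v
  proof -
    have "inner (Z *\<^sub>V v) v \<le> norm (Z *\<^sub>V v) * norm v" by (rule norm_cauchy_schwarz)
    also have "\<dots> \<le> (norm Z * norm v) * norm v"
      by (intro mult_right_mono norm_cblinfun_apply) simp
    finally show ?thesis
      by (simp add: inner_diff_left power2_eq_square algebra_simps flip: power2_norm_eq_inner)
  qed
  have pos: "positive_op (cid - Z)"
  proof (rule positive_opI)
    show "0 \<le> inner ((cid - Z) *\<^sub>V v) v" for v
      using Z order_trans[OF _ bound[of v], of 0] by simp
  qed (simp add: adj)
  have unique: "R = cid - Z" if R: "positive_op R" "R o\<^sub>C R = cid - x" for R
  proof -
    \<comment> \<open>A second positive root \<open>R\<close> commutes with its own square, hence with \<open>cid - Z\<close>; then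
      \<open>R + (cid - Z)\<close>, which is bounded below, annihilates the difference of the two roots.\<close>
    have "R o\<^sub>C (cid - Z) = (cid - Z) o\<^sub>C R"
    proof (rule square_roots_intertwine[OF Z Z])
      show "R o\<^sub>C ((cid - Z) o\<^sub>C (cid - Z)) = ((cid - Z) o\<^sub>C (cid - Z)) o\<^sub>C R"
        unfolding Z2 R(2)[symmetric] by (rule ccomp_assoc[symmetric])
    qed
    then have comm: "R *\<^sub>V (cid - Z) *\<^sub>V v = (cid - Z) *\<^sub>V R *\<^sub>V v" for v
      by (metis ccomp_apply)
    have square: "R *\<^sub>V R *\<^sub>V v = (cid - Z) *\<^sub>V (cid - Z) *\<^sub>V v" for v
      using Z2 R(2) by (metis ccomp_apply)
    show ?thesis
    proof (rule cblinfun_eqI)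
      fix v
      define u where "u = R *\<^sub>V v - (cid - Z) *\<^sub>V v"
      have "R *\<^sub>V u + (cid - Z) *\<^sub>V u = 0"
        unfolding u_def cblinfun_linear_simps(3) comm square by simp
      then have "inner (R *\<^sub>V u) u + inner ((cid - Z) *\<^sub>V u) u = 0"
        by (simp flip: inner_add_left)
      moreover have "0 \<le> inner (R *\<^sub>V u) u"
        using R(1) by (simp add: positive_op_def inner_eq_Re_cinner)
      ultimately have "(1 - norm Z) * (norm u)\<^sup>2 \<le> 0" using bound[of u] by linarith
      then show "R *\<^sub>V v = (cid - Z) *\<^sub>V v"
        using Z by (simp add: mult_le_0_iff u_def)
    qed
  qed
  have "op_sqrt (cid - x) = cid - Z"
    unfolding op_sqrt_def
  proof (rule the_equality)
    show "positive_op (cid - Z) \<and> (cid - Z) o\<^sub>C (cid - Z) = cid - x" using pos Z2 by blast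
  qed (blast intro: unique)
  moreover have "\<forall>R. positive_op R \<longrightarrow> R o\<^sub>C R = cid - x \<longrightarrow> R = cid - Z"
    by (intro allI impI unique)
  ultimately show thesis using Z adj Z2 pos by (intro that[of Z])
qed

lemma op_sqrt_one_minus_eqI:
  assumes "norm x < 1" "x\<^sup>\<dagger> = x" "positive_op R" "R o\<^sub>C R = cid - x"
  shows "op_sqrt (cid - x) = R"
proof -
  obtain Z where "\<forall>R. positive_op R \<longrightarrow> R o\<^sub>C R = cid - x \<longrightarrow> R = cid - Z"
    and Z: "op_sqrt (cid - x) = cid - Z"
    by (rule op_sqrt_one_minus_exists[OF assms(1,2)]) (rule that; assumption)
  then have "R = cid - Z" using assms(3,4) by simp
  then show ?thesis using Z by simp
qed

text \<open>Applied below to defects: intertwiners of \<open>A A\<^sup>*\<close> and \<open>B B\<^sup>*\<close> also intertwine the defects, and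
  \<open>A\<close> itself intertwines \<open>A\<^sup>* A\<close> with \<open>A A\<^sup>*\<close>.\<close>

lemma op_sqrt_one_minus_intertwine:
  assumes "norm x < 1" "x\<^sup>\<dagger> = x" "norm y < 1" "y\<^sup>\<dagger> = y" "W o\<^sub>C x = y o\<^sub>C W"
  shows "W o\<^sub>C op_sqrt (cid - x) = op_sqrt (cid - y) o\<^sub>C W"
proof -
  obtain Zx where x: "norm Zx < 1" "(cid - Zx) o\<^sub>C (cid - Zx) = cid - x" "op_sqrt (cid - x) = cid - Zx"
    by (rule op_sqrt_one_minus_exists[OF assms(1,2)]) (rule that; assumption)
  obtain Zy where y: "norm Zy < 1" "(cid - Zy) o\<^sub>C (cid - Zy) = cid - y" "op_sqrt (cid - y) = cid - Zy"
    by (rule op_sqrt_one_minus_exists[OF assms(3,4)]) (rule that; assumption)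
  show ?thesis
    unfolding x(3) y(3)
  proof (rule square_roots_intertwine[OF x(1) y(1)])
    show "W o\<^sub>C ((cid - Zx) o\<^sub>C (cid - Zx)) = ((cid - Zy) o\<^sub>C (cid - Zy)) o\<^sub>C W"
      unfolding x(2) y(2) using assms(5) by (simp add: ccomp_linear_simps)
  qed
qed

lemma norm_ccomp_adj_less_one:
  assumes "norm A < 1"
  shows "norm (A o\<^sub>C A\<^sup>\<dagger>) < 1"
proof -
  have "norm (A o\<^sub>C A\<^sup>\<dagger>) \<le> norm A * norm A" using norm_ccomp_le[of A "A\<^sup>\<dagger>"] by simp
  also have "\<dots> < 1 * 1" using assms by (intro mult_strict_mono') auto
  finally show ?thesis by simp
qed

lemma defect_eq_defect_star: "defect A = defect_star (A\<^sup>\<dagger>)"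
  by (simp add: defect_def defect_star_def)

lemma defect_star_props:
  assumes "norm A < 1"
  shows "(defect_star A)\<^sup>\<dagger> = defect_star A"
    and "defect_star A o\<^sub>C defect_star A = cid - A o\<^sub>C A\<^sup>\<dagger>"
    and "\<exists>E. E o\<^sub>C defect_star A = cid \<and> defect_star A o\<^sub>C E = cid"
proof -
  have selfadj: "(A o\<^sub>C A\<^sup>\<dagger>)\<^sup>\<dagger> = A o\<^sub>C A\<^sup>\<dagger>" by simp
  obtain Z where Z: "norm Z < 1" "Z\<^sup>\<dagger> = Z" "(cid - Z) o\<^sub>C (cid - Z) = cid - A o\<^sub>C A\<^sup>\<dagger>"
    "op_sqrt (cid - A o\<^sub>C A\<^sup>\<dagger>) = cid - Z"
    by (rule op_sqrt_one_minus_exists[OF norm_ccomp_adj_less_one[OF assms] selfadj]) (rule that; assumption)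
  then have D: "defect_star A = cid - Z" by (simp add: defect_star_def)
  show "(defect_star A)\<^sup>\<dagger> = defect_star A"
    "defect_star A o\<^sub>C defect_star A = cid - A o\<^sub>C A\<^sup>\<dagger>"
    by (simp_all add: D Z)
  show "\<exists>E. E o\<^sub>C defect_star A = cid \<and> defect_star A o\<^sub>C E = cid"
    unfolding D using cinverse_one_minus[OF Z(1)] by blast
qed

lemma defect_star_intertwine:
  assumes "norm A < 1" "norm B < 1" "W o\<^sub>C (A o\<^sub>C A\<^sup>\<dagger>) = (B o\<^sub>C B\<^sup>\<dagger>) o\<^sub>C W"
  shows "W o\<^sub>C defect_star A = defect_star B o\<^sub>C W"
  unfolding defect_star_def using assms
  by (intro op_sqrt_one_minus_intertwine norm_ccomp_adj_less_one) auto

text \<open>Expand \<open>\<Psi> \<Psi>\<^sup>\<dagger>\<close> and move the defects outwards with \<open>A D\<^sub>A = D\<^bsub>A\<^sup>*\<^esub> A\<close>. With \<open>N = I - B A\<^sup>*\<close> and \<open>M\<close>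
  its inverse, everything has the form \<open>D\<^bsub>A\<^sup>*\<^esub> M (\<dots>) M\<^sup>* D\<^bsub>A\<^sup>*\<^esub>\<close>, and the bracket
  \<open>N N\<^sup>* + N A B\<^sup>* + B A\<^sup>* N\<^sup>* - B (I - A\<^sup>* A) B\<^sup>*\<close> collapses to \<open>I - B B\<^sup>*\<close>.\<close>

lemma frac_transform_defect_identity:
  fixes A B :: "('a :: chilbert_space, 'b :: chilbert_space) cblinfun"
  assumes A: "norm A < 1" and B: "norm B \<le> 1"
  shows "cid - frac_transform A B o\<^sub>C (frac_transform A B)\<^sup>\<dagger>
    = defect_star A o\<^sub>C cinverse (cid - B o\<^sub>C A\<^sup>\<dagger>) o\<^sub>C (cid - B o\<^sub>C B\<^sup>\<dagger>)
        o\<^sub>C cinverse (cid - A o\<^sub>C B\<^sup>\<dagger>) o\<^sub>C defect_star A"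
proof -
  define D' D M Ms where "D' = defect_star A" and "D = defect A"
    and "M = cinverse (cid - B o\<^sub>C A\<^sup>\<dagger>)" and "Ms = cinverse (cid - A o\<^sub>C B\<^sup>\<dagger>)"
  have A': "norm (A\<^sup>\<dagger>) < 1" using A by simp
  have "norm (B o\<^sub>C A\<^sup>\<dagger>) \<le> norm B * norm A" using norm_ccomp_le[of B "A\<^sup>\<dagger>"] by simp
  also have "\<dots> \<le> 1 * norm A" using B by (intro mult_right_mono) auto
  finally have BA: "norm (B o\<^sub>C A\<^sup>\<dagger>) < 1" using A by simp
  have Ms: "M\<^sup>\<dagger> = Ms"
    unfolding M_def Ms_def adj_cinverse_one_minus[OF BA] by simp
  have M_inv: "M *\<^sub>V v - M *\<^sub>V B *\<^sub>V A\<^sup>\<dagger> *\<^sub>V v = v" for v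
  proof -
    have "(M o\<^sub>C (cid - B o\<^sub>C A\<^sup>\<dagger>)) *\<^sub>V v = v"
      using cinverse_one_minus(1)[OF BA] by (simp only: M_def cid_apply)
    then show ?thesis by (simp add: cblinfun_algebra)
  qed
  have Ms_inv: "Ms *\<^sub>V v - A *\<^sub>V B\<^sup>\<dagger> *\<^sub>V Ms *\<^sub>V v = v" for v
  proof -
    have "((cid - A o\<^sub>C B\<^sup>\<dagger>) o\<^sub>C Ms) *\<^sub>V v = v"
      using cinverse_one_minus(2)[of "A o\<^sub>C B\<^sup>\<dagger>"] norm_adj[of "B o\<^sub>C A\<^sup>\<dagger>"] BA
      by (simp add: Ms_def)
    then show ?thesis by (simp add: cblinfun_algebra)
  qed
  have D: "D\<^sup>\<dagger> = D" "D'\<^sup>\<dagger> = D'"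
    and D2: "D' *\<^sub>V D' *\<^sub>V v = v - A *\<^sub>V A\<^sup>\<dagger> *\<^sub>V v" "D *\<^sub>V D *\<^sub>V w = w - A\<^sup>\<dagger> *\<^sub>V A *\<^sub>V w" for v w
    using defect_star_props(1,2)[OF A] defect_star_props(1,2)[OF A']
    unfolding D_def D'_def defect_eq_defect_star
    by (metis ccomp_apply cblinfun_apply_simps(3) cid_apply adj_adj)+
  have "A o\<^sub>C D = D' o\<^sub>C A"
    unfolding D_def D'_def defect_eq_defect_star
    by (rule defect_star_intertwine) (use A in \<open>simp_all add: ccomp_assoc\<close>)
  then have AD: "A *\<^sub>V D *\<^sub>V v = D' *\<^sub>V A *\<^sub>V v" for v by (metis ccomp_apply)
  have "A\<^sup>\<dagger> o\<^sub>C D' = D o\<^sub>C A\<^sup>\<dagger>"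
    unfolding D_def D'_def defect_eq_defect_star
    by (rule defect_star_intertwine) (use A in \<open>simp_all add: ccomp_assoc\<close>)
  then have DA: "D *\<^sub>V A\<^sup>\<dagger> *\<^sub>V v = A\<^sup>\<dagger> *\<^sub>V D' *\<^sub>V v" for v by (metis ccomp_apply)
  have "cid - (A - D' o\<^sub>C M o\<^sub>C B o\<^sub>C D) o\<^sub>C (A - D' o\<^sub>C M o\<^sub>C B o\<^sub>C D)\<^sup>\<dagger>
      = D' o\<^sub>C M o\<^sub>C (cid - B o\<^sub>C B\<^sup>\<dagger>) o\<^sub>C Ms o\<^sub>C D'"
  proof (rule cblinfun_eqI)
    fix v
    define u where "u = D' *\<^sub>V v"
    have "(cid - (A - D' o\<^sub>C M o\<^sub>C B o\<^sub>C D) o\<^sub>C (A - D' o\<^sub>C M o\<^sub>C B o\<^sub>C D)\<^sup>\<dagger>) *\<^sub>V v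
      = D' *\<^sub>V u + D' *\<^sub>V A *\<^sub>V B\<^sup>\<dagger> *\<^sub>V Ms *\<^sub>V u + D' *\<^sub>V M *\<^sub>V B *\<^sub>V A\<^sup>\<dagger> *\<^sub>V u
        - D' *\<^sub>V M *\<^sub>V B *\<^sub>V (B\<^sup>\<dagger> *\<^sub>V Ms *\<^sub>V u - A\<^sup>\<dagger> *\<^sub>V A *\<^sub>V B\<^sup>\<dagger> *\<^sub>V Ms *\<^sub>V u)"
      unfolding u_def by (simp add: cblinfun_algebra D Ms D2 AD DA)
    also have "\<dots> = D' *\<^sub>V (u + A *\<^sub>V B\<^sup>\<dagger> *\<^sub>V Ms *\<^sub>V u + M *\<^sub>V B *\<^sub>V A\<^sup>\<dagger> *\<^sub>V (u + A *\<^sub>V B\<^sup>\<dagger> *\<^sub>V Ms *\<^sub>V u)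
        - M *\<^sub>V B *\<^sub>V B\<^sup>\<dagger> *\<^sub>V Ms *\<^sub>V u)"
      by (simp add: cblinfun_algebra)
    also have "u + A *\<^sub>V B\<^sup>\<dagger> *\<^sub>V Ms *\<^sub>V u = Ms *\<^sub>V u"
      using Ms_inv[of u] by (simp add: algebra_simps)
    also have "Ms *\<^sub>V u + M *\<^sub>V B *\<^sub>V A\<^sup>\<dagger> *\<^sub>V Ms *\<^sub>V u = M *\<^sub>V Ms *\<^sub>V u"
      using M_inv[of "Ms *\<^sub>V u"] by (simp add: algebra_simps)
    finally show "(cid - (A - D' o\<^sub>C M o\<^sub>C B o\<^sub>C D) o\<^sub>C (A - D' o\<^sub>C M o\<^sub>C B o\<^sub>C D)\<^sup>\<dagger>) *\<^sub>V v
      = (D' o\<^sub>C M o\<^sub>C (cid - B o\<^sub>C B\<^sup>\<dagger>) o\<^sub>C Ms o\<^sub>C D') *\<^sub>V v"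
      by (simp add: u_def cblinfun_algebra)
  qed
  then show ?thesis
    unfolding frac_transform_def D'_def D_def M_def Ms_def .
qed

section \<open>Operators defined on total families\<close>

lemma cblinfun_ext_dense:
  assumes dense: "closure (cspan S) = UNIV" and eq: "\<And>x. x \<in> S \<Longrightarrow> T *\<^sub>V x = T' *\<^sub>V x"
  shows "T = T'"
proof (rule cblinfun_eqI)
  fix x
  have "complex_vector.subspace {x. T *\<^sub>V x = T' *\<^sub>V x}"
    by (auto simp: complex_vector.subspace_def cblinfun_linear_simps)
  then have "cspan S \<subseteq> {x. T *\<^sub>V x = T' *\<^sub>V x}"
    using eq by (intro complex_vector.span_minimal) auto
  moreover have "closed {x. T *\<^sub>V x = T' *\<^sub>V x}"
    by (intro closed_Collect_eq linear_continuous_on bounded_linear_cblinfun)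
  ultimately have "closure (cspan S) \<subseteq> {x. T *\<^sub>V x = T' *\<^sub>V x}"
    by (rule closure_minimal)
  then show "T *\<^sub>V x = T' *\<^sub>V x" using dense by auto
qed

text \<open>The linear relation between the combinations of the \<open>x i\<close> and the corresponding combinations
  of the \<open>y i\<close> is closed up under limits of sequences; the norm bound makes the result the graph
  of an operator.\<close>

lemma bounded_extension_exists:
  fixes x :: "'i \<Rightarrow> 'a :: chilbert_space" and y :: "'i \<Rightarrow> 'b :: chilbert_space"
  assumes dense: "closure (cspan (range x)) = UNIV"
    and bound: "\<And>I c. finite I \<Longrightarrow>
      norm (\<Sum>i\<in>I. c i *\<^sub>C y i) \<le> K * norm (\<Sum>i\<in>I. c i *\<^sub>C x i)"
  shows "\<exists>T. \<forall>i. T *\<^sub>V x i = y i"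
proof -
  define G where "G a b \<longleftrightarrow>
    (\<exists>I c. finite I \<and> a = (\<Sum>i\<in>I. c i *\<^sub>C x i) \<and> b = (\<Sum>i\<in>I. c i *\<^sub>C y i))" for a b
  have G_xy: "G (x i) (y i)" for i
    unfolding G_def by (rule exI[of _ "{i}"], rule exI[of _ "\<lambda>_. 1"]) simp
  have G_0: "G 0 0"
    unfolding G_def by (rule exI[of _ "{}"]) simp
  have G_bound: "norm b \<le> K * norm a" if "G a b" for a b
    using that bound unfolding G_def by blast
  have G_add: "G (a + a') (b + b')" if ab: "G a b" "G a' b'" for a a' b b'
  proof -
    obtain I c where I: "finite I" "a = (\<Sum>i\<in>I. c i *\<^sub>C x i)" "b = (\<Sum>i\<in>I. c i *\<^sub>C y i)"
      using ab(1) unfolding G_def by blast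
    obtain J d where J: "finite J" "a' = (\<Sum>i\<in>J. d i *\<^sub>C x i)" "b' = (\<Sum>i\<in>J. d i *\<^sub>C y i)"
      using ab(2) unfolding G_def by blast
    define e where "e i = (if i \<in> I then c i else 0) + (if i \<in> J then d i else 0)" for i
    have comb: "(\<Sum>i\<in>I \<union> J. e i *\<^sub>C z i) = (\<Sum>i\<in>I. c i *\<^sub>C z i) + (\<Sum>i\<in>J. d i *\<^sub>C z i)"
      for z :: "'i \<Rightarrow> 'c :: complex_vector"
    proof -
      have "(\<Sum>i\<in>I \<union> J. e i *\<^sub>C z i) = (\<Sum>i\<in>I \<union> J. if i \<in> I then c i *\<^sub>C z i else 0)
          + (\<Sum>i\<in>I \<union> J. if i \<in> J then d i *\<^sub>C z i else 0)"
        unfolding sum.distrib[symmetric] e_def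
        by (rule sum.cong[OF refl]) (simp add: scaleC_add_left)
      also have "(\<Sum>i\<in>I \<union> J. if i \<in> I then c i *\<^sub>C z i else 0) = (\<Sum>i\<in>I. c i *\<^sub>C z i)"
        using I(1) J(1) by (intro sum.mono_neutral_cong_right) auto
      also have "(\<Sum>i\<in>I \<union> J. if i \<in> J then d i *\<^sub>C z i else 0) = (\<Sum>i\<in>J. d i *\<^sub>C z i)"
        using I(1) J(1) by (intro sum.mono_neutral_cong_right) auto
      finally show ?thesis .
    qed
    have "finite (I \<union> J)" using I(1) J(1) by simp
    then show ?thesis
      unfolding G_def I(2,3) J(2,3) comb[symmetric] by blast
  qed
  have G_scale: "G (r *\<^sub>C a) (r *\<^sub>C b)" if ab: "G a b" for r a b
  proof -
    obtain I c where I: "finite I" "a = (\<Sum>i\<in>I. c i *\<^sub>C x i)" "b = (\<Sum>i\<in>I. c i *\<^sub>C y i)"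
      using ab unfolding G_def by blast
    show ?thesis
      unfolding G_def using I
      by (intro exI[of _ I] exI[of _ "\<lambda>i. r * c i"])
        (simp add: complex_vector.scale_sum_right scaleC_scaleC)
  qed
  have G_diff: "G (a - a') (b - b')" if "G a b" "G a' b'" for a a' b b'
    using G_add[OF that(1) G_scale[OF that(2), of "-1"]]
    by (simp add: complex_vector.scale_minus_left)

  define R where "R v w \<longleftrightarrow> (\<exists>a b. (\<forall>n :: nat. G (a n) (b n)) \<and> a \<longlonglongrightarrow> v \<and> b \<longlonglongrightarrow> w)" for v w
  have R_G: "R a b" if "G a b" for a b
    unfolding R_def using that by (intro exI[of _ "\<lambda>_. a"] exI[of _ "\<lambda>_. b"]) simp
  have R_add: "R (v + v') (w + w')" if R: "R v w" "R v' w'" for v v' w w'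
  proof -
    obtain a b a' b' where "\<forall>n. G (a n) (b n)" "a \<longlonglongrightarrow> v" "b \<longlonglongrightarrow> w"
      "\<forall>n. G (a' n) (b' n)" "a' \<longlonglongrightarrow> v'" "b' \<longlonglongrightarrow> w'"
      using R unfolding R_def by blast
    then show ?thesis
      unfolding R_def
      by (intro exI[of _ "\<lambda>n. a n + a' n"] exI[of _ "\<lambda>n. b n + b' n"])
        (auto intro: G_add tendsto_add)
  qed
  have R_scale: "R (r *\<^sub>C v) (r *\<^sub>C w)" if R: "R v w" for r v w
  proof -
    obtain a b where "\<forall>n. G (a n) (b n)" "a \<longlonglongrightarrow> v" "b \<longlonglongrightarrow> w"
      using R unfolding R_def by blast
    then show ?thesis
      unfolding R_def
      by (intro exI[of _ "\<lambda>n. r *\<^sub>C a n"] exI[of _ "\<lambda>n. r *\<^sub>C b n"])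
        (auto intro: G_scale bounded_linear.tendsto[OF bounded_linear_scaleC_right])
  qed
  have R_bound: "norm w \<le> K * norm v" if R: "R v w" for v w
  proof -
    obtain a b where ab: "\<forall>n. G (a n) (b n)" "a \<longlonglongrightarrow> v" "b \<longlonglongrightarrow> w"
      using R unfolding R_def by blast
    show ?thesis
    proof (rule LIMSEQ_le)
      show "(\<lambda>n. norm (b n)) \<longlonglongrightarrow> norm w" by (intro tendsto_intros ab)
      show "(\<lambda>n. K * norm (a n)) \<longlonglongrightarrow> K * norm v" by (intro tendsto_intros ab)
    qed (use ab(1) G_bound in blast)
  qed
  have R_total: "\<exists>w. R v w" for v
  proof -
    have "complex_vector.subspace {a. \<exists>b. G a b}"
      unfolding complex_vector.subspace_def using G_0 G_add G_scale by blast
    then have sub: "cspan (range x) \<subseteq> {a. \<exists>b. G a b}"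
      using G_xy by (intro complex_vector.span_minimal) auto
    have "v \<in> closure (cspan (range x))" by (simp add: dense)
    then obtain a where "\<forall>n. a n \<in> cspan (range x)" and a: "a \<longlonglongrightarrow> v"
      unfolding closure_sequential by blast
    then have "\<forall>n. \<exists>b. G (a n) b" using sub by blast
    then obtain b where ab: "\<And>n. G (a n) (b n)" by metis
    have "Cauchy b"
    proof (rule metric_CauchyI)
      fix e :: real assume "0 < e"
      define e' where "e' = e / (\<bar>K\<bar> + 1)"
      have "0 < e'" using \<open>0 < e\<close> by (simp add: e'_def)
      then obtain N where N: "\<And>m n. m \<ge> N \<Longrightarrow> n \<ge> N \<Longrightarrow> dist (a m) (a n) < e'"
        using metric_CauchyD[OF LIMSEQ_imp_Cauchy[OF a]] by meson
      have "dist (b m) (b n) < e" if "m \<ge> N" "n \<ge> N" for m n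
      proof -
        have "dist (b m) (b n) \<le> K * dist (a m) (a n)"
          unfolding dist_norm by (rule G_bound[OF G_diff[OF ab ab]])
        also have "\<dots> \<le> (\<bar>K\<bar> + 1) * dist (a m) (a n)" by (intro mult_right_mono) auto
        also have "\<dots> < (\<bar>K\<bar> + 1) * e'" using N[OF that] by (intro mult_strict_left_mono) auto
        also have "\<dots> = e" by (simp add: e'_def)
        finally show ?thesis .
      qed
      then show "\<exists>N. \<forall>m\<ge>N. \<forall>n\<ge>N. dist (b m) (b n) < e" by blast
    qed
    then obtain w where "b \<longlonglongrightarrow> w" by (auto simp: Cauchy_convergent_iff convergent_def)
    with a ab show ?thesis unfolding R_def by blast
  qed
  have R_unique: "w = w'" if "R v w" "R v w'" for v w w'
    using R_bound[OF R_add[OF that(1) R_scale[OF that(2), of "-1"]]]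
    by (simp add: complex_vector.scale_minus_left)
  obtain g where g: "\<And>v. R v (g v)" using R_total by metis
  have g_scale: "g (c *\<^sub>C v) = c *\<^sub>C g v" for c v
    by (rule R_unique[OF g R_scale[OF g]])
  have "bounded_linear g"
  proof (rule bounded_linear_intro[of _ K])
    show "g (u + v) = g u + g v" for u v by (rule R_unique[OF g R_add[OF g g]])
    show "g (r *\<^sub>R v) = r *\<^sub>R g v" for r v by (simp add: scaleR_scaleC g_scale)
    show "norm (g v) \<le> norm v * K" for v using R_bound[OF g] by (simp add: mult.commute)
  qed
  with g_scale have "bounded_clinear g" by (simp add: bounded_clinear_def)
  then have "CBlinfun g *\<^sub>V x i = y i" for i
    using R_unique[OF g R_G[OF G_xy]] by (simp add: cblinfun_apply_CBlinfun)
  then show ?thesis by blast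
qed

section \<open>Orthonormal sets\<close>

lemma cinner_zero [simp]: "cinner 0 x = 0" "cinner x 0 = 0"
proof -
  show "cinner 0 x = 0" using cinner_scaleC_left[of 0 x x] by simp
  then show "cinner x 0 = 0" by (metis cinner_commute complex_cnj_zero)
qed

lemma cinner_diff_left: "cinner (x - y) z = cinner x z - cinner y z"
  using cinner_add_left[of "x - y" y z] by simp

lemma cinner_sum_left: "cinner (\<Sum>i\<in>I. f i) z = (\<Sum>i\<in>I. cinner (f i) z)"
  by (induction I rule: infinite_finite_induct) (simp_all add: cinner_add_left)

lemma cinner_sum_right: "cinner z (\<Sum>i\<in>I. f i) = (\<Sum>i\<in>I. cinner z (f i))"
  by (induction I rule: infinite_finite_induct) (simp_all add: cinner_add_right)

definition orthonormal :: "'a :: chilbert_space set \<Rightarrow> bool" where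
  "orthonormal B \<longleftrightarrow> (\<forall>e\<in>B. \<forall>e'\<in>B. cinner e e' = (if e = e' then 1 else 0))"

lemma cinner_self_eq_1: "norm x = 1 \<Longrightarrow> cinner x x = 1"
  by (simp add: cinner_self)

lemma orthonormal_insert:
  assumes "orthonormal B" "norm r = 1" "\<And>e. e \<in> B \<Longrightarrow> cinner r e = 0"
  shows "orthonormal (insert r B)"
proof -
  have "cinner e r = 0" if "e \<in> B" for e
    using assms(3)[OF that] cinner_commute[of e r] by simp
  moreover have "r \<notin> B" using assms(3)[of r] cinner_self_eq_1[OF assms(2)] by auto
  ultimately show ?thesis
    using assms cinner_self_eq_1[OF assms(2)] by (auto simp: orthonormal_def)
qed

text \<open>One Gram--Schmidt step per vector of \<open>U\<close>.\<close>

lemma finite_orthonormal_expansion: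
  fixes U :: "'a :: chilbert_space set"
  assumes "finite U"
  shows "\<exists>B. finite B \<and> orthonormal B \<and> (\<forall>u\<in>U. u = (\<Sum>e\<in>B. cinner u e *\<^sub>C e))"
  using assms
proof (induction U)
  case empty
  show ?case by (rule exI[of _ "{}"]) (simp add: orthonormal_def)
next
  case (insert u U)
  then obtain B where B: "finite B" "orthonormal B"
    and exp: "\<And>v. v \<in> U \<Longrightarrow> v = (\<Sum>e\<in>B. cinner v e *\<^sub>C e)" by auto
  define p where "p = (\<Sum>e\<in>B. cinner u e *\<^sub>C e)"
  have perp_comb: "cinner (\<Sum>e\<in>B. c e *\<^sub>C e) r = 0" if "\<And>e. e \<in> B \<Longrightarrow> cinner e r = 0" for c r
    by (simp add: cinner_sum_left cinner_scaleC_left that)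
  have p: "cinner p e = cinner u e" if "e \<in> B" for e
  proof -
    have "cinner p e = (\<Sum>e'\<in>B. if e' = e then cinner u e' else 0)"
      unfolding p_def cinner_sum_left
      by (rule sum.cong) (use B(2) that in \<open>auto simp: orthonormal_def cinner_scaleC_left\<close>)
    then show ?thesis using B(1) that by simp
  qed
  show ?case
  proof (cases "u = p")
    case True
    then show ?thesis using B exp by (intro exI[of _ B]) (auto simp: p_def)
  next
    case False
    define r where "r = u - p"
    define f where "f = (1 / norm r) *\<^sub>R r"
    have "norm r \<noteq> 0" using False by (simp add: r_def)
    then have f: "norm f = 1" and r: "r = norm r *\<^sub>R f" by (simp_all add: f_def)
    have fe: "cinner f e = 0" if "e \<in> B" for e
      using p[OF that] by (simp add: f_def r_def scaleR_scaleC cinner_scaleC_left cinner_diff_left)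
    then have ef: "cinner e f = 0" if "e \<in> B" for e
      using cinner_commute[of e f] that by simp
    have "f \<notin> B" using fe cinner_self_eq_1[OF f] by auto
    have "v = (\<Sum>e\<in>insert f B. cinner v e *\<^sub>C e)" if "v \<in> U" for v
    proof -
      have "cinner v f = 0" by (subst exp[OF that]) (rule perp_comb[OF ef])
      then show ?thesis using exp[OF that] \<open>f \<notin> B\<close> B(1) by simp
    qed
    moreover have "u = (\<Sum>e\<in>insert f B. cinner u e *\<^sub>C e)"
    proof -
      have u: "u = p + norm r *\<^sub>R f" using r by (simp add: r_def)
      have "cinner p f = 0" unfolding p_def by (rule perp_comb[OF ef])
      then have "cinner u f = norm r"
        by (subst u) (simp add: cinner_add_left scaleR_scaleC cinner_scaleC_left cinner_self_eq_1[OF f])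
      then have "(\<Sum>e\<in>insert f B. cinner u e *\<^sub>C e) = norm r *\<^sub>R f + p"
        using \<open>f \<notin> B\<close> B(1) by (simp add: p_def scaleR_scaleC)
      then show ?thesis by (metis u add.commute)
    qed
    ultimately show ?thesis
      using orthonormal_insert[OF B(2) f fe] B(1)
      by (intro exI[of _ "insert f B"]) auto
  qed
qed

section \<open>Tensor products of operators\<close>

lemma hilbert_tensor_linear:
  assumes "hilbert_tensor t"
  shows "t (x + x') u = t x u + t x' u" "t (c *\<^sub>C x) u = c *\<^sub>C t x u"
    "t x (u + u') = t x u + t x u'" "t x (c *\<^sub>C u) = c *\<^sub>C t x u"
    "t (\<Sum>i\<in>I. f i) u = (\<Sum>i\<in>I. t (f i) u)" "t x (\<Sum>i\<in>I. g i) = (\<Sum>i\<in>I. t x (g i))"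
proof -
  have lin: "Vector_Spaces.linear scaleC scaleC (\<lambda>x. t x u)" "Vector_Spaces.linear scaleC scaleC (t x)" for x u
    using assms by (simp_all add: hilbert_tensor_def)
  note r = Vector_Spaces.linear.axioms(3)[OF lin(1)] and l = Vector_Spaces.linear.axioms(3)[OF lin(2)]
  show "t (x + x') u = t x u + t x' u" by (rule module_hom.add[OF r])
  show "t (c *\<^sub>C x) u = c *\<^sub>C t x u" by (rule module_hom.scale[OF r])
  show "t x (u + u') = t x u + t x u'" by (rule module_hom.add[OF l])
  show "t x (c *\<^sub>C u) = c *\<^sub>C t x u" by (rule module_hom.scale[OF l])
  show "t (\<Sum>i\<in>I. f i) u = (\<Sum>i\<in>I. t (f i) u)" by (rule module_hom.sum[OF r])
  show "t x (\<Sum>i\<in>I. g i) = (\<Sum>i\<in>I. t x (g i))" by (rule module_hom.sum[OF l])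
qed

lemma hilbert_tensor_cinner:
  "hilbert_tensor t \<Longrightarrow> cinner (t x u) (t y v) = cinner x y * cinner u v"
  by (simp add: hilbert_tensor_def)

lemma hilbert_tensor_swap:
  assumes "hilbert_tensor t"
  shows "hilbert_tensor (\<lambda>u x. t x u)"
proof -
  have "{t x u | u x. True} = {t x u | x u. True}" by auto
  then show ?thesis using assms by (simp add: hilbert_tensor_def mult.commute)
qed

lemma hilbert_tensor_total:
  assumes "hilbert_tensor t"
  shows "closure (cspan (range (\<lambda>(x, u). t x u))) = UNIV"
proof -
  have "range (\<lambda>(x, u). t x u) = {t x u | x u. True}" by auto
  then show ?thesis using assms by (simp add: hilbert_tensor_def)
qed

lemma tensor_ext:
  assumes "hilbert_tensor t" "\<And>x u. S *\<^sub>V t x u = T *\<^sub>V t x u"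
  shows "S = T"
  using hilbert_tensor_total[OF assms(1)] by (rule cblinfun_ext_dense) (auto simp: assms(2))

lemma norm_tensor_orthonormal_sum:
  assumes t: "hilbert_tensor t" and B: "finite B" "orthonormal B"
  shows "(norm (\<Sum>e\<in>B. t e (g e)))\<^sup>2 = (\<Sum>e\<in>B. (norm (g e))\<^sup>2)"
proof -
  have "complex_of_real ((norm (\<Sum>e\<in>B. t e (g e)))\<^sup>2)
      = (\<Sum>e\<in>B. \<Sum>e'\<in>B. if e = e' then cinner (g e) (g e') else 0)"
    unfolding cinner_self[symmetric] cinner_sum_left cinner_sum_right hilbert_tensor_cinner[OF t]
    using B(2) by (intro sum.cong) (auto simp: orthonormal_def)
  also have "\<dots> = (\<Sum>e\<in>B. complex_of_real ((norm (g e))\<^sup>2))"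
    using B(1) by (simp add: cinner_self)
  also have "\<dots> = complex_of_real (\<Sum>e\<in>B. (norm (g e))\<^sup>2)" by simp
  finally show ?thesis by (simp only: of_real_eq_iff)
qed

text \<open>Expanding the left factors in a finite orthonormal set turns a sum of elementary tensors into
  an orthogonal one, on which \<open>A\<close> acts summand by summand.\<close>

lemma norm_tensor_sum_le:
  fixes s :: "'h :: chilbert_space \<Rightarrow> 'e :: chilbert_space \<Rightarrow> 'he :: chilbert_space"
    and t :: "'h \<Rightarrow> 'g :: chilbert_space \<Rightarrow> 'hg :: chilbert_space"
  assumes s: "hilbert_tensor s" and t: "hilbert_tensor t" and I: "finite I"
  shows "norm (\<Sum>i\<in>I. t (p i) (A *\<^sub>V q i)) \<le> norm A * norm (\<Sum>i\<in>I. s (p i) (q i))"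
proof -
  obtain B where B: "finite B" "orthonormal B"
    and exp: "\<And>i. i \<in> I \<Longrightarrow> p i = (\<Sum>e\<in>B. cinner (p i) e *\<^sub>C e)"
    using finite_orthonormal_expansion[of "p ` I"] I by auto
  define g where "g e = (\<Sum>i\<in>I. cinner (p i) e *\<^sub>C q i)" for e
  have "(\<Sum>i\<in>I. s (p i) (q i)) = (\<Sum>i\<in>I. \<Sum>e\<in>B. s e (cinner (p i) e *\<^sub>C q i))"
    by (rule sum.cong[OF refl], subst exp) (simp_all add: hilbert_tensor_linear[OF s])
  also have "\<dots> = (\<Sum>e\<in>B. s e (g e))"
    unfolding g_def hilbert_tensor_linear(6)[OF s] by (rule sum.swap)
  finally have 1: "(\<Sum>i\<in>I. s (p i) (q i)) = (\<Sum>e\<in>B. s e (g e))" .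
  have "(\<Sum>i\<in>I. t (p i) (A *\<^sub>V q i)) = (\<Sum>i\<in>I. \<Sum>e\<in>B. t e (A *\<^sub>V (cinner (p i) e *\<^sub>C q i)))"
    by (rule sum.cong[OF refl], subst exp) (simp_all add: hilbert_tensor_linear[OF t] cblinfun_linear_simps)
  also have "\<dots> = (\<Sum>e\<in>B. t e (A *\<^sub>V g e))"
    unfolding g_def hilbert_tensor_linear(6)[OF t] cblinfun_linear_simps(7) by (rule sum.swap)
  finally have 2: "(\<Sum>i\<in>I. t (p i) (A *\<^sub>V q i)) = (\<Sum>e\<in>B. t e (A *\<^sub>V g e))" .
  have "(norm (\<Sum>e\<in>B. t e (A *\<^sub>V g e)))\<^sup>2 = (\<Sum>e\<in>B. (norm (A *\<^sub>V g e))\<^sup>2)"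
    by (rule norm_tensor_orthonormal_sum[OF t B])
  also have "\<dots> \<le> (\<Sum>e\<in>B. (norm A * norm (g e))\<^sup>2)"
    by (intro sum_mono power_mono norm_cblinfun_apply) auto
  also have "\<dots> = (norm A)\<^sup>2 * (norm (\<Sum>e\<in>B. s e (g e)))\<^sup>2"
    unfolding norm_tensor_orthonormal_sum[OF s B] power_mult_distrib sum_distrib_left ..
  finally have "(norm (\<Sum>e\<in>B. t e (A *\<^sub>V g e)))\<^sup>2 \<le> (norm A * norm (\<Sum>e\<in>B. s e (g e)))\<^sup>2"
    by (simp add: power_mult_distrib)
  then show ?thesis unfolding 1 2 by (rule power2_le_imp_le) simp
qed

text \<open>Composing this with the same statement for the swapped tensor products gives every operator
  \<open>X \<otimes> A\<close>.\<close>

lemma tensor_right_exists: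
  fixes s :: "'h :: chilbert_space \<Rightarrow> 'e :: chilbert_space \<Rightarrow> 'he :: chilbert_space"
    and t :: "'h \<Rightarrow> 'g :: chilbert_space \<Rightarrow> 'hg :: chilbert_space"
  assumes s: "hilbert_tensor s" and t: "hilbert_tensor t"
  shows "\<exists>T. \<forall>x u. T *\<^sub>V s x u = t x (A *\<^sub>V u)"
proof -
  have "\<exists>T. \<forall>i. T *\<^sub>V (case i of (x, u) \<Rightarrow> s x u) = (case i of (x, u) \<Rightarrow> t x (A *\<^sub>V u))"
  proof (rule bounded_extension_exists[OF hilbert_tensor_total[OF s], where K = "norm A"])
    fix I :: "('h \<times> 'e) set" and c assume "finite I"
    then show "norm (\<Sum>i\<in>I. c i *\<^sub>C (case i of (x, u) \<Rightarrow> t x (A *\<^sub>V u)))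
        \<le> norm A * norm (\<Sum>i\<in>I. c i *\<^sub>C (case i of (x, u) \<Rightarrow> s x u))"
      using norm_tensor_sum_le[OF s t, of I "\<lambda>i. c i *\<^sub>C fst i" A snd]
      by (simp add: hilbert_tensor_linear[OF s] hilbert_tensor_linear[OF t] case_prod_beta)
  qed
  then show ?thesis by fastforce
qed

context
  fixes s :: "'h :: chilbert_space \<Rightarrow> 'e :: chilbert_space \<Rightarrow> 'he :: chilbert_space"
    and t :: "'h \<Rightarrow> 'g :: chilbert_space \<Rightarrow> 'hg :: chilbert_space"
  assumes s: "hilbert_tensor s" and t: "hilbert_tensor t"
begin

lemma op_tensor_eqI:
  assumes "\<And>x u. T *\<^sub>V s x u = t (X *\<^sub>V x) (A *\<^sub>V u)"
  shows "op_tensor s t X A = T"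
  unfolding op_tensor_def
proof (rule the_equality)
  fix S assume "\<forall>x u. S *\<^sub>V s x u = t (X *\<^sub>V x) (A *\<^sub>V u)"
  then show "S = T" using assms by (intro tensor_ext[OF s]) simp
qed (simp add: assms)

lemma op_tensor_apply [simp]: "op_tensor s t X A *\<^sub>V s x u = t (X *\<^sub>V x) (A *\<^sub>V u)"
proof -
  obtain T1 where T1: "\<And>x u. T1 *\<^sub>V s x u = t x (A *\<^sub>V u)"
    using tensor_right_exists[OF s t] by blast
  obtain T2 where T2: "\<And>x u. T2 *\<^sub>V s x u = s (X *\<^sub>V x) u"
    using tensor_right_exists[OF hilbert_tensor_swap[OF s] hilbert_tensor_swap[OF s]] by blast
  have "op_tensor s t X A = T1 o\<^sub>C T2"
    by (rule op_tensor_eqI) (simp add: T1 T2)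
  then show ?thesis by (simp add: T1 T2)
qed

end

lemma op_tensor_cid:
  assumes t: "hilbert_tensor t"
  shows "op_tensor t t (S o\<^sub>C T) cid = op_tensor t t S cid o\<^sub>C op_tensor t t T cid"
    "op_tensor t t (S - T) cid = op_tensor t t S cid - op_tensor t t T cid"
    "op_tensor t t (r *\<^sub>R T) cid = r *\<^sub>R op_tensor t t T cid"
    "op_tensor t t cid cid = cid"
    "(op_tensor t t T cid)\<^sup>\<dagger> = op_tensor t t (T\<^sup>\<dagger>) cid"
proof -
  note [simp] = op_tensor_apply[OF t t]
  note lin = hilbert_tensor_linear[OF t]
  show "op_tensor t t (S o\<^sub>C T) cid = op_tensor t t S cid o\<^sub>C op_tensor t t T cid"
    by (rule op_tensor_eqI[OF t t]) simp
  show "op_tensor t t (S - T) cid = op_tensor t t S cid - op_tensor t t T cid"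
  proof (rule op_tensor_eqI[OF t t])
    show "(op_tensor t t S cid - op_tensor t t T cid) *\<^sub>V t x u = t ((S - T) *\<^sub>V x) (cid *\<^sub>V u)" for x u
      using lin(1)[of "S *\<^sub>V x - T *\<^sub>V x" "T *\<^sub>V x" u] by simp
  qed
  show "op_tensor t t (r *\<^sub>R T) cid = r *\<^sub>R op_tensor t t T cid"
    by (rule op_tensor_eqI[OF t t]) (simp add: scaleR_scaleC lin)
  show "op_tensor t t cid cid = cid"
    by (rule op_tensor_eqI[OF t t]) simp
  show "(op_tensor t t T cid)\<^sup>\<dagger> = op_tensor t t (T\<^sup>\<dagger>) cid"
  proof (rule tensor_ext[OF t])
    fix y v
    let ?a = "(op_tensor t t T cid)\<^sup>\<dagger> *\<^sub>V t y v" and ?b = "op_tensor t t (T\<^sup>\<dagger>) cid *\<^sub>V t y v"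
    have functional: "bounded_clinear (\<lambda>z. cinner z a)" for a :: 'c
    proof -
      have "bounded_linear (\<lambda>z. cinner z a)"
        by (rule bounded_linear_intro[of _ "norm a"])
          (simp_all add: cinner_add_left scaleR_scaleC cinner_scaleC_left norm_cinner_le scaleC_complex_def)
      then show ?thesis by (simp add: bounded_clinear_def cinner_scaleC_left scaleC_complex_def)
    qed
    have "cinner (t x u) ?a = cinner (t x u) ?b" for x u
    proof -
      have "cinner (t x u) ?a = cinner (T *\<^sub>V x) y * cinner u v"
        by (simp add: hilbert_tensor_cinner[OF t] flip: cinner_adj)
      then show ?thesis by (simp add: hilbert_tensor_cinner[OF t] cinner_adj)
    qed
    then have "CBlinfun (\<lambda>z. cinner z ?a) = CBlinfun (\<lambda>z. cinner z ?b)"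
      by (intro tensor_ext[OF t]) (simp only: cblinfun_apply_CBlinfun[OF functional])
    then have eq: "cinner z ?a = cinner z ?b" for z
      by (metis cblinfun_apply_CBlinfun[OF functional])
    show "?a = ?b" by (rule inner_ext) (simp only: inner_eq_Re_cinner eq)
  qed
qed

section \<open>Operators on direct sums\<close>

lemma adj_scaleC [simp]: "(c *\<^sub>C T)\<^sup>\<dagger> = cnj c *\<^sub>C T\<^sup>\<dagger>"
  by (rule adj_eqI) (simp add: inner_scaleC_right inner_adj' cblinfun_linear_simps)

lemma square_summable_apply: "square_summable f \<Longrightarrow> square_summable (\<lambda>i. V *\<^sub>V f i)"
  unfolding square_summable_def
proof (rule summable_on_comparison_test)
  show "(norm (V *\<^sub>V f i))\<^sup>2 \<le> (norm V)\<^sup>2 * (norm (f i))\<^sup>2" for i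
    using power_mono[OF norm_cblinfun_apply[of V "f i"], of 2] by (simp add: power_mult_distrib)
qed (auto intro: summable_on_cmult_right)

definition hsum_map :: "('a :: chilbert_space, 'b :: chilbert_space) cblinfun
    \<Rightarrow> (('n, 'a) hsum, ('n, 'b) hsum) cblinfun"
  where "hsum_map V = CBlinfun (\<lambda>x. Abs_hsum (\<lambda>i. V *\<^sub>V hsum_nth x i))"

lemma hsum_nth_map [simp]:
  fixes V :: "('a :: chilbert_space, 'b :: chilbert_space) cblinfun" and x :: "('n, 'a) hsum"
  shows "hsum_nth (hsum_map V *\<^sub>V x) i = V *\<^sub>V hsum_nth x i"
proof -
  define f where "f = (\<lambda>x :: ('n, 'a) hsum. Abs_hsum (\<lambda>i. V *\<^sub>V hsum_nth x i))"
  have nth: "hsum_nth (f x) i = V *\<^sub>V hsum_nth x i" for x i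
    by (simp add: f_def Abs_hsum_inverse square_summable_apply square_summable_nth)
  have scale: "f (c *\<^sub>C x) = c *\<^sub>C f x" for c x
    by (rule hsum_eqI) (simp add: nth hsum_nth_simps cblinfun_linear_simps)
  have "norm (f x) \<le> norm x * norm V" for x
  proof (rule hsum_norm_leI)
    fix M :: "'n set" assume M: "finite M"
    have "(\<Sum>i\<in>M. (norm (hsum_nth (f x) i))\<^sup>2) \<le> (\<Sum>i\<in>M. (norm V * norm (hsum_nth x i))\<^sup>2)"
      unfolding nth by (intro sum_mono power_mono norm_cblinfun_apply) auto
    also have "\<dots> = (norm V)\<^sup>2 * (\<Sum>i\<in>M. (norm (hsum_nth x i))\<^sup>2)"
      by (simp add: power_mult_distrib sum_distrib_left)
    also have "\<dots> \<le> (norm V)\<^sup>2 * (norm x)\<^sup>2"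
      by (intro mult_left_mono sum_norm_nth_le M) simp
    finally show "(\<Sum>i\<in>M. (norm (hsum_nth (f x) i))\<^sup>2) \<le> (norm x * norm V)\<^sup>2"
      by (simp add: power_mult_distrib mult.commute)
  qed simp
  then have "bounded_linear f"
    by (intro bounded_linear_intro[of _ "norm V"])
      (auto intro!: hsum_eqI simp: nth hsum_nth_simps cblinfun_linear_simps)
  with scale have "bounded_clinear f" by (simp add: bounded_clinear_def)
  then show ?thesis by (simp add: hsum_map_def cblinfun_apply_CBlinfun nth flip: f_def)
qed

lemma hsum_map_simps:
  "hsum_map (S o\<^sub>C T) = hsum_map S o\<^sub>C hsum_map T"
  "hsum_map (r *\<^sub>R T) = r *\<^sub>R hsum_map T"
  "hsum_map cid = cid"
  by (rule cblinfun_eqI, rule hsum_eqI, simp)+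

lemma adj_hsum_map [simp]: "(hsum_map V)\<^sup>\<dagger> = hsum_map (V\<^sup>\<dagger>)"
  by (rule adj_eqI) (simp add: inner_hsum_def hsum_cinner_def cinner_adj)

lemma hsum_inj_apply: "hsum_inj i *\<^sub>V h = hsum_single i h"
  by transfer simp

lemma hsum_map_inj: "hsum_map W o\<^sub>C hsum_inj i = hsum_inj i o\<^sub>C W"
  by (rule cblinfun_eqI, rule hsum_eqI)
    (simp add: hsum_inj_apply hsum_nth_single cblinfun_linear_simps)

lemma infsum_single:
  fixes f :: "'n \<Rightarrow> 'a :: {comm_monoid_add, t2_space}"
  assumes "\<And>j. j \<noteq> i \<Longrightarrow> f j = 0"
  shows "infsum f UNIV = f i"
proof -
  have "infsum f UNIV = infsum f {i}"
    by (rule infsum_cong_neutral) (auto simp: assms)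
  then show ?thesis by simp
qed

lemma adj_hsum_inj: "(hsum_inj i)\<^sup>\<dagger> *\<^sub>V y = hsum_nth y i"
proof (rule inner_ext)
  fix h
  have "inner h ((hsum_inj i)\<^sup>\<dagger> *\<^sub>V y) = inner (hsum_single i h) y"
    by (simp add: inner_adj[symmetric] hsum_inj_apply)
  also have "\<dots> = inner h (hsum_nth y i)"
    unfolding inner_hsum_def hsum_cinner_def inner_eq_Re_cinner
    by (subst infsum_single[of i]) (auto simp: hsum_nth_single)
  finally show "inner h ((hsum_inj i)\<^sup>\<dagger> *\<^sub>V y) = inner h (hsum_nth y i)" .
qed

lemma row_nth_scalar_row: "row_nth (scalar_row z) i = hsum_nth z i *\<^sub>C cid"
proof (rule cblinfun_eqI)
  fix h
  have "scalar_row z *\<^sub>V hsum_single i h = hsum_nth z i *\<^sub>C h"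
    unfolding scalar_row.rep_eq
    by (subst infsum_single[of i]) (auto simp: hsum_nth_single complex_vector.scale_zero_right)
  then show "row_nth (scalar_row z) i *\<^sub>V h = (hsum_nth z i *\<^sub>C cid) *\<^sub>V h"
    by (simp add: row_nth_def hsum_inj_apply)
qed

lemma hsum_nth_adj_scalar_row: "hsum_nth ((scalar_row z)\<^sup>\<dagger> *\<^sub>V h) i = cnj (hsum_nth z i) *\<^sub>C h"
proof -
  have "hsum_nth ((scalar_row z)\<^sup>\<dagger> *\<^sub>V h) i = (row_nth (scalar_row z) i)\<^sup>\<dagger> *\<^sub>V h"
    by (simp add: row_nth_def adj_hsum_inj)
  then show ?thesis by (simp add: row_nth_scalar_row)
qed

lemma scalar_row_ccomp_adj:
  "scalar_row z o\<^sub>C (scalar_row z)\<^sup>\<dagger> = (norm z)\<^sup>2 *\<^sub>R (cid :: ('h :: chilbert_space, 'h) cblinfun)"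
proof (rule cblinfun_eqI, rule inner_ext)
  fix h k :: 'h
  have "cinner k ((scalar_row z o\<^sub>C (scalar_row z)\<^sup>\<dagger>) *\<^sub>V h)
      = cinner ((scalar_row z)\<^sup>\<dagger> *\<^sub>V k) ((scalar_row z)\<^sup>\<dagger> *\<^sub>V h)"
    by (simp add: cinner_adj)
  also have "\<dots> = (\<Sum>\<^sub>\<infinity>i. complex_of_real ((norm (hsum_nth z i))\<^sup>2) * cinner k h)"
    unfolding cinner_hsum_def hsum_cinner_def
    by (rule infsum_cong)
      (simp add: hsum_nth_adj_scalar_row cinner_scaleC_left cinner_scaleC_right
        complex_norm_square mult.commute mult.left_commute del: of_real_power)
  also have "\<dots> = complex_of_real ((norm z)\<^sup>2) * cinner k h"
    unfolding infsum_cmult_left' cinner_self[symmetric] by (simp only: cinner_hsum_def hsum_cinner_def)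
  finally show "inner k ((scalar_row z o\<^sub>C (scalar_row z)\<^sup>\<dagger>) *\<^sub>V h) = inner k (((norm z)\<^sup>2 *\<^sub>R cid) *\<^sub>V h)"
    by (simp add: inner_eq_Re_cinner scaleR_scaleC cinner_scaleC_right del: of_real_power)
qed

lemma norm_scalar_row_le: "norm (scalar_row z) \<le> norm z"
  by (rule norm_cblinfun_leI) (simp_all add: scalar_row.rep_eq scalar_row_bound)

lemma hsum_map_adj_scalar_row: "hsum_map T o\<^sub>C (scalar_row z)\<^sup>\<dagger> = (scalar_row z)\<^sup>\<dagger> o\<^sub>C T"
  by (rule cblinfun_eqI, rule hsum_eqI) (simp add: hsum_nth_adj_scalar_row cblinfun_linear_simps)

lemma scalar_row_intertwine: "W o\<^sub>C scalar_row z = scalar_row z o\<^sub>C hsum_map W"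
  using arg_cong[OF hsum_map_adj_scalar_row[of "W\<^sup>\<dagger>" z], of adj] by simp

text \<open>For a scalar row one of the two defects is a scalar, so that the ball automorphism is a
  fractional transform.\<close>

lemma defect_star_scalar_row:
  assumes z: "norm z < 1"
  shows "defect_star (scalar_row z) = sqrt (1 - (norm z)\<^sup>2) *\<^sub>R (cid :: ('h :: chilbert_space, 'h) cblinfun)"
proof -
  define c where "c = sqrt (1 - (norm z)\<^sup>2)"
  have "(norm z)\<^sup>2 < 1" using z by (simp add: abs_square_less_1)
  then have c: "0 \<le> c" "c * c = 1 - (norm z)\<^sup>2" by (simp_all add: c_def)
  have "op_sqrt (cid - (norm z)\<^sup>2 *\<^sub>R cid) = c *\<^sub>R (cid :: ('h, 'h) cblinfun)"
  proof (rule op_sqrt_one_minus_eqI)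
    have "norm ((norm z)\<^sup>2 *\<^sub>R (cid :: ('h, 'h) cblinfun)) \<le> (norm z)\<^sup>2 * 1"
      unfolding norm_scaleR abs_power2 by (intro mult_left_mono norm_cid_le) simp
    then show "norm ((norm z)\<^sup>2 *\<^sub>R (cid :: ('h, 'h) cblinfun)) < 1"
      using \<open>(norm z)\<^sup>2 < 1\<close> by simp
    show "positive_op (c *\<^sub>R (cid :: ('h, 'h) cblinfun))"
      by (rule positive_opI) (use c in auto)
    show "c *\<^sub>R cid o\<^sub>C c *\<^sub>R cid = cid - (norm z)\<^sup>2 *\<^sub>R (cid :: ('h, 'h) cblinfun)"
      by (simp add: ccomp_linear_simps c(2) scaleR_left_diff_distrib)
  qed simp
  then show ?thesis by (simp add: defect_star_def scalar_row_ccomp_adj c_def)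
qed

lemma ball_auto_eq_frac_transform:
  "norm z < 1 \<Longrightarrow> ball_auto z X = frac_transform (scalar_row z) X"
  by (simp add: ball_auto_def frac_transform_def defect_star_scalar_row)

section \<open>Isometries with orthogonal ranges\<close>

lemma maximal_orthonormal_exists:
  "\<exists>B :: 'a :: chilbert_space set. orthonormal B \<and> (\<forall>r. (\<forall>e\<in>B. cinner r e = 0) \<longrightarrow> r = 0)"
proof -
  have "\<exists>M\<in>Collect orthonormal. \<forall>X\<in>Collect orthonormal. M \<subseteq> X \<longrightarrow> X = (M :: 'a set)"
  proof (rule subset_Zorn_nonempty)
    have "orthonormal ({} :: 'a set)" by (simp add: orthonormal_def)
    then show "Collect orthonormal \<noteq> ({} :: 'a set set)" by blast
    fix \<C> :: "'a set set" assume C: "\<C> \<noteq> {}" "subset.chain (Collect orthonormal) \<C>"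
    have "cinner e e' = (if e = e' then 1 else 0)" if e: "e \<in> \<Union>\<C>" "e' \<in> \<Union>\<C>" for e e'
    proof -
      obtain S S' where S: "e \<in> S" "S \<in> \<C>" "e' \<in> S'" "S' \<in> \<C>" using e by blast
      then have "S \<subseteq> S' \<or> S' \<subseteq> S" using C(2) unfolding subset.chain_def by blast
      then obtain T where T: "T \<in> \<C>" "e \<in> T" "e' \<in> T" using S by blast
      then have "orthonormal T" using C(2) unfolding subset.chain_def by blast
      then show ?thesis using T unfolding orthonormal_def by blast
    qed
    then show "\<Union>\<C> \<in> Collect orthonormal" unfolding orthonormal_def by blast
  qed
  then obtain B :: "'a set" where B: "orthonormal B"
    and max: "\<And>X. orthonormal X \<Longrightarrow> B \<subseteq> X \<Longrightarrow> X = B" by blast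
  have "r = 0" if r: "\<forall>e\<in>B. cinner r e = 0" for r
  proof (rule ccontr)
    assume "r \<noteq> 0"
    define f where "f = (1 / norm r) *\<^sub>R r"
    have f: "norm f = 1" using \<open>r \<noteq> 0\<close> by (simp add: f_def)
    have fe: "cinner f e = 0" if "e \<in> B" for e
      using r that by (simp add: f_def scaleR_scaleC cinner_scaleC_left)
    have "insert f B = B" by (rule max[OF orthonormal_insert[OF B f fe]]) auto
    then have "cinner f f = 0" by (intro fe) blast
    then show False using cinner_self_eq_1[OF f] by simp
  qed
  with B show ?thesis by blast
qed

text \<open>For any \<open>p\<close>, the projection \<open>v\<close> of \<open>p\<close> to the closed span of \<open>B\<close> leaves a residual \<open>p - v\<close>
  orthogonal to \<open>B\<close>.\<close>

lemma maximal_orthonormal_total: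
  fixes B :: "'a :: chilbert_space set"
  assumes max: "\<And>r. (\<forall>e\<in>B. cinner r e = 0) \<Longrightarrow> r = 0"
  shows "closure (cspan B) = UNIV"
proof -
  have "p \<in> closure (cspan B)" for p
  proof -
    have "subspace (cspan B)"
      by (auto simp: subspace_def complex_vector.span_zero complex_vector.span_add
          scaleR_scaleC complex_vector.span_scale)
    then obtain v where v: "v \<in> closure (cspan B)" and vp: "\<And>y. y \<in> cspan B \<Longrightarrow> inner v y = inner p y"
      using riesz_on_subspace[OF _ bounded_linear_inner_right, of "cspan B" p] by blast
    have "cinner (p - v) e = 0" if e: "e \<in> B" for e
    proof -
      have "inner (p - v) (c *\<^sub>C e) = 0" for c
        using vp[OF complex_vector.span_scale[OF complex_vector.span_base[OF e]]]
        by (simp add: inner_diff_left)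
      from this[of 1] this[of \<i>] show ?thesis
        by (simp add: inner_eq_Re_cinner cinner_scaleC_right complex_eq_iff)
    qed
    then have "p - v = 0" by (intro max) blast
    with v show ?thesis by simp
  qed
  then show ?thesis by blast
qed

lemma norm_orthonormal_sum:
  assumes B: "orthonormal B" and I: "finite I" and f: "inj_on f I" "f ` I \<subseteq> B"
  shows "(norm (\<Sum>i\<in>I. c i *\<^sub>C f i))\<^sup>2 = (\<Sum>i\<in>I. (norm (c i))\<^sup>2)"
proof -
  have "complex_of_real ((norm (\<Sum>i\<in>I. c i *\<^sub>C f i))\<^sup>2)
      = (\<Sum>i\<in>I. \<Sum>j\<in>I. if i = j then c i * cnj (c j) else 0)"
    unfolding cinner_self[symmetric]
  proof (subst cinner_sum_left, rule sum.cong[OF refl], subst cinner_sum_right, rule sum.cong[OF refl])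
    fix i j assume "i \<in> I" "j \<in> I"
    then have "f i \<in> B" "f j \<in> B" "f i = f j \<longleftrightarrow> i = j" using f by (auto dest: inj_onD)
    then show "cinner (c i *\<^sub>C f i) (c j *\<^sub>C f j) = (if i = j then c i * cnj (c j) else 0)"
      using B by (simp add: orthonormal_def cinner_scaleC_left cinner_scaleC_right)
  qed
  also have "\<dots> = complex_of_real (\<Sum>i\<in>I. (norm (c i))\<^sup>2)"
    using I by (simp add: complex_norm_square[symmetric])
  finally show ?thesis by (simp only: of_real_eq_iff)
qed

lemma isometry_from_injection:
  fixes B :: "'a :: chilbert_space set"
  assumes B: "orthonormal B" and total: "closure (cspan B) = UNIV"
    and f: "inj_on f B" "f ` B \<subseteq> B"
  shows "\<exists>J. \<forall>e\<in>B. J *\<^sub>V e = f e"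
proof -
  define x where "x e = (if e \<in> B then e else 0)" for e
  define y where "y e = (if e \<in> B then f e else 0)" for e
  have "\<exists>J. \<forall>e. J *\<^sub>V x e = y e"
  proof (rule bounded_extension_exists[where K = 1])
    have "B \<subseteq> range x" unfolding x_def by (auto simp: image_iff)
    then have "closure (cspan B) \<subseteq> closure (cspan (range x))"
      by (intro closure_mono complex_vector.span_mono)
    then show "closure (cspan (range x)) = UNIV" using total by auto
    fix I :: "'a set" and c assume I: "finite I"
    have restrict: "(\<Sum>e\<in>I. c e *\<^sub>C (if e \<in> B then g e else 0)) = (\<Sum>e\<in>I \<inter> B. c e *\<^sub>C g e)"
      for g :: "'a \<Rightarrow> 'a"
      using I by (intro sum.mono_neutral_cong_right) (auto simp: complex_vector.scale_zero_right)
    have "(norm (\<Sum>e\<in>I \<inter> B. c e *\<^sub>C f e))\<^sup>2 = (norm (\<Sum>e\<in>I \<inter> B. c e *\<^sub>C e))\<^sup>2"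
      using norm_orthonormal_sum[OF B, of "I \<inter> B" f c] norm_orthonormal_sum[OF B, of "I \<inter> B" "\<lambda>e. e" c]
        I f by (auto intro: inj_on_subset)
    then show "norm (\<Sum>e\<in>I. c e *\<^sub>C y e) \<le> 1 * norm (\<Sum>e\<in>I. c e *\<^sub>C x e)"
      unfolding x_def y_def restrict by simp
  qed
  then obtain J where J: "\<And>e. J *\<^sub>V x e = y e" by blast
  have "J *\<^sub>V e = f e" if "e \<in> B" for e
    using J[of e] that by (simp add: x_def y_def)
  then show ?thesis by blast
qed

text \<open>An orthonormal basis \<open>B\<close> is infinite, so there is a bijection from \<open>B + B\<close> onto \<open>B\<close>. Its two
  halves split the basis into disjoint parts, and each half extends to an isometry. In other words,
  \<open>H \<oplus> H\<close> embeds isometrically in \<open>H\<close>.\<close>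

lemma orthogonal_isometries_exist:
  assumes "\<nexists>B :: 'h :: chilbert_space set. finite B \<and> cspan B = UNIV"
  shows "\<exists>(J1 :: ('h, 'h) cblinfun) (J2 :: ('h, 'h) cblinfun).
    J1\<^sup>\<dagger> o\<^sub>C J1 = cid \<and> J2\<^sup>\<dagger> o\<^sub>C J2 = cid \<and> J1\<^sup>\<dagger> o\<^sub>C J2 = 0"
proof -
  obtain B :: "'h set" where B: "orthonormal B"
    and max: "\<And>r. (\<forall>e\<in>B. cinner r e = 0) \<Longrightarrow> r = 0"
    using maximal_orthonormal_exists by blast
  note total = maximal_orthonormal_total[OF max]
  have "infinite B"
  proof
    assume fin: "finite B"
    have "p \<in> cspan B" for p
    proof -
      define v where "v = (\<Sum>e\<in>B. cinner p e *\<^sub>C e)"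
      have "cinner (p - v) e = 0" if "e \<in> B" for e
      proof -
        have "cinner v e = (\<Sum>e'\<in>B. if e' = e then cinner p e else 0)"
          unfolding v_def cinner_sum_left
          by (rule sum.cong) (use B that in \<open>auto simp: orthonormal_def cinner_scaleC_left\<close>)
        then show ?thesis using fin that by (simp add: cinner_diff_left)
      qed
      then have "p - v = 0" by (intro max) blast
      moreover have "v \<in> cspan B"
        unfolding v_def by (intro complex_vector.span_sum complex_vector.span_scale complex_vector.span_base)
      ultimately show ?thesis by simp
    qed
    then have "cspan B = UNIV" by blast
    then show False using assms fin by blast
  qed
  then have "(card_of (B <+> B), card_of B) \<in> ordIso"
    using card_of_Plus_infinite1 card_of_mono1[of B B] by blast
  then obtain f where f: "bij_betw f (B <+> B) B"
    using card_of_ordIso by blast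
  then have inj: "inj_on f (B <+> B)" and into: "f ` (B <+> B) \<subseteq> B"
    by (auto simp: bij_betw_def)
  have inl: "inj_on (\<lambda>e. f (Inl e)) B" "(\<lambda>e. f (Inl e)) ` B \<subseteq> B"
    and inr: "inj_on (\<lambda>e. f (Inr e)) B" "(\<lambda>e. f (Inr e)) ` B \<subseteq> B"
    using inj into by (auto simp: inj_on_def)
  obtain J1 where J1: "\<And>e. e \<in> B \<Longrightarrow> J1 *\<^sub>V e = f (Inl e)"
    using isometry_from_injection[OF B total inl] by blast
  obtain J2 where J2: "\<And>e. e \<in> B \<Longrightarrow> J2 *\<^sub>V e = f (Inr e)"
    using isometry_from_injection[OF B total inr] by blast
  have fB: "cinner (f a) (f b) = (if a = b then 1 else 0)" if "a \<in> B <+> B" "b \<in> B <+> B" for a b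
  proof -
    have "f a \<in> B" "f b \<in> B" using that into by blast+
    then show ?thesis using B inj_on_eq_iff[OF inj that] unfolding orthonormal_def by simp
  qed
  have isometry: "J\<^sup>\<dagger> o\<^sub>C J = cid"
    if J: "\<And>e. e \<in> B \<Longrightarrow> J *\<^sub>V e = f (k e)" and k: "\<And>e. e \<in> B \<Longrightarrow> k e \<in> B <+> B" "inj k" for J k
  proof (rule cblinfun_ext_dense[OF total])
    fix e assume e: "e \<in> B"
    have "cinner (J\<^sup>\<dagger> *\<^sub>V J *\<^sub>V e - e) e' = 0" if e': "e' \<in> B" for e'
    proof -
      have "cinner (J\<^sup>\<dagger> *\<^sub>V J *\<^sub>V e) e' = cinner (f (k e)) (f (k e'))"
        by (simp add: cinner_adj J e e')
      also have "\<dots> = cinner e e'"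
        using fB[OF k(1)[OF e] k(1)[OF e']] B e e' k(2) by (simp add: orthonormal_def inj_eq)
      finally show ?thesis by (simp add: cinner_diff_left)
    qed
    then have "J\<^sup>\<dagger> *\<^sub>V J *\<^sub>V e - e = 0" by (intro max) blast
    then show "(J\<^sup>\<dagger> o\<^sub>C J) *\<^sub>V e = cid *\<^sub>V e" by simp
  qed
  have "J1\<^sup>\<dagger> o\<^sub>C J2 = 0"
  proof (rule cblinfun_ext_dense[OF total])
    fix e assume e: "e \<in> B"
    have "cinner (J1\<^sup>\<dagger> *\<^sub>V J2 *\<^sub>V e) e' = 0" if e': "e' \<in> B" for e'
      using fB[OF InrI[OF e] InlI[OF e']] e e' by (simp add: cinner_adj J1 J2)
    then show "(J1\<^sup>\<dagger> o\<^sub>C J2) *\<^sub>V e = 0 *\<^sub>V e" using max by simp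
  qed
  moreover have "J1\<^sup>\<dagger> o\<^sub>C J1 = cid" by (rule isometry[OF J1]) auto
  moreover have "J2\<^sup>\<dagger> o\<^sub>C J2 = cid" by (rule isometry[OF J2]) auto
  ultimately show ?thesis by blast
qed

section \<open>A strict row contraction realising two kernels\<close>

lemma norm_add_square: "(norm (a + b))\<^sup>2 = (norm a)\<^sup>2 + 2 * inner a b + (norm (b :: 'a :: real_inner))\<^sup>2"
  by (simp add: power2_norm_eq_inner inner_simps inner_commute)

lemma norm_adj_apply_square: "(norm (B\<^sup>\<dagger> *\<^sub>V v))\<^sup>2 = inner ((B o\<^sub>C B\<^sup>\<dagger>) *\<^sub>V v) v"
  by (simp add: power2_norm_eq_inner inner_adj)

lemma norm_apply_square: "(norm (B *\<^sub>V v))\<^sup>2 = inner v ((B\<^sup>\<dagger> o\<^sub>C B) *\<^sub>V v)"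
  by (simp add: power2_norm_eq_inner inner_adj)

lemma norm_pair_square:
  assumes "P\<^sup>\<dagger> o\<^sub>C P = cid" "P\<^sup>\<dagger> o\<^sub>C Q = R" "Q\<^sup>\<dagger> o\<^sub>C Q = \<kappa> *\<^sub>R cid"
  shows "(norm (P *\<^sub>V a + Q *\<^sub>V b))\<^sup>2 = (norm a)\<^sup>2 + 2 * inner a (R *\<^sub>V b) + \<kappa> * (norm b)\<^sup>2"
proof -
  have "inner (P *\<^sub>V a) (Q *\<^sub>V b) = inner a (R *\<^sub>V b)"
    using assms(2) by (simp add: inner_adj flip: ccomp_apply)
  then show ?thesis
    unfolding norm_add_square norm_apply_square[of P] norm_apply_square[of Q] assms(1,3)
    by (simp add: power2_norm_eq_inner)
qed

text \<open>In the full Fock space, let \<open>K\<close> be the Poisson kernel of \<open>X\<close>, i.e. \<open>K h = \<Sum>\<^sub>\<alpha> e\<^sub>\<alpha> \<otimes> D X\<^sub>\<alpha>\<^sup>* h\<close> with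
  \<open>D = (I - X X\<^sup>*)\<^sup>1\<^sup>/\<^sup>2\<close>, and let \<open>k\<^sub>z = \<Sum>\<^sub>\<alpha> cnj z\<^sub>\<alpha> e\<^sub>\<alpha>\<close>. Then \<open>ball_kernel z X\<close> is \<open>w \<mapsto> K\<^sup>* (k\<^sub>z \<otimes> w)\<close>, and
  the norm square of \<open>k\<^sub>z\<close> is \<open>1 / (1 - \<bar>z\<bar>\<^sup>2)\<close>. These are the inner products that
  \<open>kernel_dilation_exists\<close> reproduces.\<close>

definition ball_kernel :: "('n, complex) hsum \<Rightarrow> (('n, 'h) hsum, 'h) cblinfun
    \<Rightarrow> ('h :: chilbert_space, 'h) cblinfun"
  where "ball_kernel z X = cinverse (cid - X o\<^sub>C (scalar_row z)\<^sup>\<dagger>) o\<^sub>C defect_star X"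

lemma norm_ccomp_adj_scalar_row_less_one:
  assumes "norm X < 1" "norm z < 1"
  shows "norm (X o\<^sub>C (scalar_row z)\<^sup>\<dagger>) < 1"
proof -
  have "norm (X o\<^sub>C (scalar_row z)\<^sup>\<dagger>) \<le> norm X * norm (scalar_row z :: (('a, 'b) hsum, 'b) cblinfun)"
    using norm_ccomp_le[of X "(scalar_row z)\<^sup>\<dagger>"] by simp
  also have "\<dots> \<le> norm X * 1"
    using norm_scalar_row_le[of z, where ?'b = 'b] assms by (intro mult_left_mono) auto
  finally show ?thesis using assms by simp
qed

lemma ball_kernel_ccomp_adj:
  assumes X: "norm X < 1" and z: "norm z < 1"
  defines "\<Delta> \<equiv> sqrt (1 - (norm z)\<^sup>2) *\<^sub>R cid"
  shows "(1 - (norm z)\<^sup>2) *\<^sub>R (ball_kernel z X o\<^sub>C (ball_kernel z X)\<^sup>\<dagger>)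
    = \<Delta> o\<^sub>C cinverse (cid - X o\<^sub>C (scalar_row z)\<^sup>\<dagger>) o\<^sub>C (cid - X o\<^sub>C X\<^sup>\<dagger>)
        o\<^sub>C cinverse (cid - scalar_row z o\<^sub>C X\<^sup>\<dagger>) o\<^sub>C \<Delta>"
proof -
  have "(norm z)\<^sup>2 < 1" using z by (simp add: abs_square_less_1)
  have T: "(ball_kernel z X)\<^sup>\<dagger> = defect_star X o\<^sub>C cinverse (cid - scalar_row z o\<^sub>C X\<^sup>\<dagger>)"
    using adj_cinverse_one_minus[OF norm_ccomp_adj_scalar_row_less_one[OF X z]]
    by (simp add: ball_kernel_def defect_star_props(1)[OF X])
  show ?thesis
    unfolding T defect_star_props(2)[OF X, symmetric]
    using \<open>(norm z)\<^sup>2 < 1\<close> by (simp add: \<Delta>_def ball_kernel_def ccomp_linear_simps ccomp_assoc)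
qed

text \<open>By \<open>ball_kernel_ccomp_adj\<close> and the defect identity, \<open>(1 - \<bar>z\<bar>\<^sup>2) T T\<^sup>*\<close> is \<open>I - \<Phi> \<Phi>\<^sup>*\<close>, where \<open>\<Phi>\<close> is
  the ball automorphism at \<open>X\<close>.\<close>

lemma ball_kernel_bound:
  assumes X: "norm X < 1" and z: "norm z < 1"
  shows "(1 - (norm z)\<^sup>2) * (norm ((ball_kernel z X)\<^sup>\<dagger> *\<^sub>V v))\<^sup>2 \<le> (norm v)\<^sup>2"
proof -
  define \<Phi> where "\<Phi> = frac_transform (scalar_row z) X"
  have zr: "norm (scalar_row z :: (('a, 'b) hsum, 'b) cblinfun) < 1"
    using norm_scalar_row_le z by (rule le_less_trans)
  have "(1 - (norm z)\<^sup>2) *\<^sub>R (ball_kernel z X o\<^sub>C (ball_kernel z X)\<^sup>\<dagger>) = cid - \<Phi> o\<^sub>C \<Phi>\<^sup>\<dagger>"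
    unfolding ball_kernel_ccomp_adj[OF X z] \<Phi>_def
    by (subst frac_transform_defect_identity[OF zr]) (use X in \<open>simp_all add: defect_star_scalar_row[OF z]\<close>)
  from arg_cong[OF this, of "\<lambda>T. inner (T *\<^sub>V v) v"]
  have "(1 - (norm z)\<^sup>2) * inner ((ball_kernel z X o\<^sub>C (ball_kernel z X)\<^sup>\<dagger>) *\<^sub>V v) v
      = inner ((cid - \<Phi> o\<^sub>C \<Phi>\<^sup>\<dagger>) *\<^sub>V v) v"
    by (simp only: cblinfun_apply_simps(5) inner_scaleR_left)
  also have "\<dots> = (norm v)\<^sup>2 - (norm (\<Phi>\<^sup>\<dagger> *\<^sub>V v))\<^sup>2"
    unfolding norm_adj_apply_square by (simp add: inner_diff_left power2_norm_eq_inner)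
  finally show ?thesis unfolding norm_adj_apply_square using zero_le_power2[of "norm (\<Phi>\<^sup>\<dagger> *\<^sub>V v)"]
    by (simp add: norm_adj_apply_square)
qed

text \<open>The point is to find one strict row contraction \<open>Y\<close> on \<open>H\<close> whose adjoint acts like \<open>X\<^sup>*\<close> on the
  range of \<open>V\<^sub>1\<close> and like multiplication by \<open>cnj z\<^sub>i\<close> on the range of \<open>V\<^sub>2\<close>, although these ranges are not
  orthogonal. With \<open>t = 1\<close> this would be the compression of the left creation operators to the span of
  the vectors \<open>K h\<close> and \<open>k\<^sub>z \<otimes> w\<close>. There the defect form at \<open>V\<^sub>1 h + V\<^sub>2 w\<close> is the norm square of
  \<open>\<Delta> h + w\<close>, which degenerates; shrinking the cross term by \<open>t < 1\<close> turns it into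
  \<open>\<bar>\<Delta> h\<bar>\<^sup>2 + 2 t Re \<langle>\<Delta> h, w\<rangle> + \<bar>w\<bar>\<^sup>2\<close>, which is bounded below and makes \<open>Y\<close> a strict contraction.\<close>

lemma kernel_dilation_exists:
  fixes X :: "(('n, 'h :: chilbert_space) hsum, 'h) cblinfun" and z :: "('n, complex) hsum"
  assumes infinite_dim: "\<nexists>B :: 'h set. finite B \<and> cspan B = UNIV"
    and X: "norm X < 1" and z: "norm z < 1" and t: "0 \<le> t" "t < 1"
  defines "\<kappa> \<equiv> 1 / (1 - (norm z)\<^sup>2)"
  shows "\<exists>(V1 :: ('h, 'h) cblinfun) (V2 :: ('h, 'h) cblinfun) (Y :: (('n, 'h) hsum, 'h) cblinfun).
    norm Y < 1 \<and> V1\<^sup>\<dagger> o\<^sub>C V1 = cid \<and> V1\<^sup>\<dagger> o\<^sub>C V2 = t *\<^sub>R ball_kernel z X \<and> V2\<^sup>\<dagger> o\<^sub>C V2 = \<kappa> *\<^sub>R cid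
    \<and> V1\<^sup>\<dagger> o\<^sub>C Y = X o\<^sub>C hsum_map (V1\<^sup>\<dagger>) \<and> V2\<^sup>\<dagger> o\<^sub>C Y = scalar_row z o\<^sub>C hsum_map (V2\<^sup>\<dagger>)"
proof -
  obtain J1 J2 :: "('h, 'h) cblinfun"
    where J: "J1\<^sup>\<dagger> o\<^sub>C J1 = cid" "J2\<^sup>\<dagger> o\<^sub>C J2 = cid" "J1\<^sup>\<dagger> o\<^sub>C J2 = 0"
    using orthogonal_isometries_exist[OF infinite_dim] by blast
  have "(0 :: ('h, 'h) cblinfun)\<^sup>\<dagger> = 0" by (rule adj_eqI) simp
  then have J21: "J2\<^sup>\<dagger> o\<^sub>C J1 = 0" using arg_cong[OF J(3), of adj] by simp
  have Ja: "J1\<^sup>\<dagger> *\<^sub>V J1 *\<^sub>V v = v" "J2\<^sup>\<dagger> *\<^sub>V J2 *\<^sub>V v = v" "J1\<^sup>\<dagger> *\<^sub>V J2 *\<^sub>V v = 0"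
    "J2\<^sup>\<dagger> *\<^sub>V J1 *\<^sub>V v = 0" for v
    by (simp_all add: J J21 flip: ccomp_apply)
  define T where "T = ball_kernel z X"
  define zr where "zr = (scalar_row z :: (('n, 'h) hsum, 'h) cblinfun)"
  define \<Delta> where "\<Delta> = defect_star X"
  have z2: "(norm z)\<^sup>2 < 1" using z by (simp add: abs_square_less_1)
  then have \<kappa>: "1 \<le> \<kappa>" "\<kappa> * (1 - (norm z)\<^sup>2) = 1" by (simp_all add: \<kappa>_def)
  have \<Delta>: "\<Delta>\<^sup>\<dagger> = \<Delta>" "\<Delta> *\<^sub>V \<Delta> *\<^sub>V v = v - X *\<^sub>V X\<^sup>\<dagger> *\<^sub>V v" for v
    using defect_star_props(1,2)[OF X] by (simp_all add: \<Delta>_def flip: ccomp_apply)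
  have T_eq: "T *\<^sub>V w - X *\<^sub>V zr\<^sup>\<dagger> *\<^sub>V T *\<^sub>V w = \<Delta> *\<^sub>V w" for w
  proof -
    have "(cid - X o\<^sub>C zr\<^sup>\<dagger>) o\<^sub>C T = \<Delta>"
      using cinverse_one_minus(2)[OF norm_ccomp_adj_scalar_row_less_one[OF X z]]
      by (simp add: T_def ball_kernel_def zr_def \<Delta>_def flip: ccomp_assoc)
    then have "((cid - X o\<^sub>C zr\<^sup>\<dagger>) o\<^sub>C T) *\<^sub>V w = \<Delta> *\<^sub>V w" by simp
    then show ?thesis by simp
  qed

  \<comment> \<open>\<open>V2\<close> is \<open>t J1 T + J2 D\<close>, so \<open>V2\<^sup>* V2 = \<kappa>\<close> forces \<open>D\<^sup>* D = \<kappa> (I - A\<^sup>* A)\<close>; the factor \<open>t < 1\<close> makes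
    \<open>A\<close> a strict contraction and hence \<open>D\<close> invertible.\<close>
  define A where "A = (t / sqrt \<kappa>) *\<^sub>R T"
  have "norm (A\<^sup>\<dagger>) \<le> t"
  proof (rule norm_cblinfun_leI)
    fix v
    have "(norm (A\<^sup>\<dagger> *\<^sub>V v))\<^sup>2 = t\<^sup>2 * ((1 - (norm z)\<^sup>2) * (norm (T\<^sup>\<dagger> *\<^sub>V v))\<^sup>2)"
      using \<kappa>(1) z2 by (simp add: A_def power_mult_distrib power_divide \<kappa>_def)
    also have "\<dots> \<le> t\<^sup>2 * (norm v)\<^sup>2"
      unfolding T_def by (intro mult_left_mono ball_kernel_bound[OF X z]) simp
    finally have "(norm (A\<^sup>\<dagger> *\<^sub>V v))\<^sup>2 \<le> (t * norm v)\<^sup>2" by (simp add: power_mult_distrib)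
    then show "norm (A\<^sup>\<dagger> *\<^sub>V v) \<le> t * norm v" by (rule power2_le_imp_le) (simp add: t)
  qed fact
  then have A: "norm (A\<^sup>\<dagger>) < 1" using t by simp
  obtain E0 where E0: "E0 o\<^sub>C defect_star (A\<^sup>\<dagger>) = cid" "defect_star (A\<^sup>\<dagger>) o\<^sub>C E0 = cid"
    using defect_star_props(3)[OF A] by blast
  define D where "D = sqrt \<kappa> *\<^sub>R defect_star (A\<^sup>\<dagger>)"
  define E where "E = (1 / sqrt \<kappa>) *\<^sub>R E0"
  have ED: "E *\<^sub>V D *\<^sub>V v = v" for v
  proof -
    have "(E0 o\<^sub>C defect_star (A\<^sup>\<dagger>)) *\<^sub>V v = v" using E0 by simp
    then show ?thesis using \<kappa>(1) by (simp add: E_def D_def cblinfun_linear_simps)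
  qed
  have DE: "D *\<^sub>V E *\<^sub>V v = v" for v
  proof -
    have "(defect_star (A\<^sup>\<dagger>) o\<^sub>C E0) *\<^sub>V v = v" using E0 by simp
    then show ?thesis using \<kappa>(1) by (simp add: E_def D_def cblinfun_linear_simps)
  qed
  have DD: "D\<^sup>\<dagger> o\<^sub>C D = \<kappa> *\<^sub>R cid - t\<^sup>2 *\<^sub>R (T\<^sup>\<dagger> o\<^sub>C T)"
  proof -
    have "D\<^sup>\<dagger> o\<^sub>C D = \<kappa> *\<^sub>R (cid - A\<^sup>\<dagger> o\<^sub>C A)"
      using \<kappa>(1) defect_star_props(1,2)[OF A] by (simp add: D_def ccomp_linear_simps)
    also have "A\<^sup>\<dagger> o\<^sub>C A = (t\<^sup>2 / \<kappa>) *\<^sub>R (T\<^sup>\<dagger> o\<^sub>C T)"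
      using \<kappa>(1) by (simp add: A_def ccomp_linear_simps power2_eq_square)
    finally show ?thesis using \<kappa>(1) by (simp add: scaleR_diff_right)
  qed

  define V2 where "V2 = t *\<^sub>R (J1 o\<^sub>C T) + J2 o\<^sub>C D"
  \<comment> \<open>\<open>Ya\<close> is the adjoint row: it sends \<open>V1 h + V2 w\<close> to \<open>V1 X\<^sup>* h + V2 z\<^sup>* w\<close> and vanishes on the orthogonal
    complement of the ranges of \<open>J1\<close> and \<open>J2\<close>; \<open>h\<close> and \<open>w\<close> are read off with \<open>J1\<^sup>*\<close> and \<open>E J2\<^sup>*\<close>.\<close>
  define Ya where "Ya = hsum_map J1 o\<^sub>C X\<^sup>\<dagger> o\<^sub>C (J1\<^sup>\<dagger> - t *\<^sub>R (T o\<^sub>C E o\<^sub>C J2\<^sup>\<dagger>))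
    + hsum_map V2 o\<^sub>C zr\<^sup>\<dagger> o\<^sub>C E o\<^sub>C J2\<^sup>\<dagger>"
  have V12: "J1\<^sup>\<dagger> o\<^sub>C V2 = t *\<^sub>R T"
    by (rule cblinfun_eqI) (simp add: V2_def cblinfun_linear_simps Ja)
  have V22: "V2\<^sup>\<dagger> o\<^sub>C V2 = \<kappa> *\<^sub>R cid"
  proof -
    have "V2\<^sup>\<dagger> o\<^sub>C V2 = t\<^sup>2 *\<^sub>R (T\<^sup>\<dagger> o\<^sub>C T) + D\<^sup>\<dagger> o\<^sub>C D"
      by (rule cblinfun_eqI) (simp add: V2_def cblinfun_linear_simps Ja power2_eq_square)
    then show ?thesis by (simp add: DD)
  qed
  have Y1: "Ya o\<^sub>C J1 = hsum_map J1 o\<^sub>C X\<^sup>\<dagger>"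
    by (rule cblinfun_eqI) (simp add: Ya_def cblinfun_linear_simps Ja)
  have Y2: "Ya o\<^sub>C V2 = hsum_map V2 o\<^sub>C zr\<^sup>\<dagger>"
    by (rule cblinfun_eqI) (simp add: Ya_def cblinfun_linear_simps Ja V2_def ED)

  \<comment> \<open>\<open>L\<close> bounds the square of \<open>Ya y\<close> by \<open>\<bar>\<Delta> h\<bar>\<^sup>2 + \<bar>w\<bar>\<^sup>2\<close>, and the defect form is at least \<open>1 - t\<close>
    times the same quantity.\<close>
  define L where "L = 2 / (1 - (norm X)\<^sup>2) + 2 * \<kappa>"
  have X2: "(norm X)\<^sup>2 < 1" using X by (simp add: abs_square_less_1)
  then have "0 < L" using \<kappa>(1) by (simp add: L_def add_pos_pos)
  define c where "c = (1 - t) / L"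
  have "0 < c" using t \<open>0 < L\<close> by (simp add: c_def)
  have contraction: "(1 + c) * (norm (Ya *\<^sub>V y))\<^sup>2 \<le> (norm y)\<^sup>2" for y
  proof -
    define w where "w = E *\<^sub>V J2\<^sup>\<dagger> *\<^sub>V y"
    define h where "h = J1\<^sup>\<dagger> *\<^sub>V y - t *\<^sub>R (T *\<^sub>V w)"
    define a where "a = X\<^sup>\<dagger> *\<^sub>V h"
    define b where "b = zr\<^sup>\<dagger> *\<^sub>V w"
    have y1: "J1\<^sup>\<dagger> *\<^sub>V y = h + t *\<^sub>R (T *\<^sub>V w)" by (simp add: h_def)
    have y2: "J2\<^sup>\<dagger> *\<^sub>V y = D *\<^sub>V w" by (simp add: w_def DE)
    have Yy: "Ya *\<^sub>V y = hsum_map J1 *\<^sub>V a + hsum_map V2 *\<^sub>V b"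
      by (simp add: Ya_def a_def b_def h_def w_def)
    have bessel: "(norm (J1\<^sup>\<dagger> *\<^sub>V y))\<^sup>2 + (norm (J2\<^sup>\<dagger> *\<^sub>V y))\<^sup>2 \<le> (norm y)\<^sup>2"
    proof -
      let ?p = "J1 *\<^sub>V J1\<^sup>\<dagger> *\<^sub>V y" and ?q = "J2 *\<^sub>V J2\<^sup>\<dagger> *\<^sub>V y"
      have p: "inner y ?p = (norm (J1\<^sup>\<dagger> *\<^sub>V y))\<^sup>2" "inner ?p ?p = (norm (J1\<^sup>\<dagger> *\<^sub>V y))\<^sup>2"
        and q: "inner y ?q = (norm (J2\<^sup>\<dagger> *\<^sub>V y))\<^sup>2" "inner ?q ?q = (norm (J2\<^sup>\<dagger> *\<^sub>V y))\<^sup>2"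
        and pq: "inner ?p ?q = 0"
        unfolding inner_adj'[of y J1] inner_adj'[of y J2] inner_adj[of J1] inner_adj[of J2] Ja
        by (simp_all add: power2_norm_eq_inner)
      have "0 \<le> (norm (y - ?p - ?q))\<^sup>2" by simp
      also have "\<dots> = (norm y)\<^sup>2 - (norm (J1\<^sup>\<dagger> *\<^sub>V y))\<^sup>2 - (norm (J2\<^sup>\<dagger> *\<^sub>V y))\<^sup>2"
        unfolding power2_norm_eq_inner[of "y - ?p - ?q"]
        by (simp add: inner_diff_left inner_diff_right p q pq inner_commute[of ?p y] inner_commute[of ?q y]
            inner_commute[of ?q ?p] power2_norm_eq_inner[of y])
      finally show ?thesis by simp
    qed
    have "(norm (D *\<^sub>V w))\<^sup>2 = \<kappa> * (norm w)\<^sup>2 - t\<^sup>2 * (norm (T *\<^sub>V w))\<^sup>2"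
      unfolding norm_apply_square DD by (simp add: inner_diff_right power2_norm_eq_inner)
    then have lower: "(norm h)\<^sup>2 + 2 * t * inner h (T *\<^sub>V w) + \<kappa> * (norm w)\<^sup>2 \<le> (norm y)\<^sup>2"
      using bessel unfolding y1 y2 norm_add_square by (simp add: power_mult_distrib mult.assoc)
    have ip: "inner a (hsum_map T *\<^sub>V b) = inner h (X *\<^sub>V zr\<^sup>\<dagger> *\<^sub>V T *\<^sub>V w)"
    proof -
      have "hsum_map T *\<^sub>V b = zr\<^sup>\<dagger> *\<^sub>V T *\<^sub>V w"
        unfolding b_def zr_def by (metis ccomp_apply hsum_map_adj_scalar_row)
      then show ?thesis by (simp add: a_def inner_adj)
    qed
    have "(norm b)\<^sup>2 = (norm z)\<^sup>2 * (norm w)\<^sup>2"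
      unfolding b_def zr_def norm_adj_apply_square scalar_row_ccomp_adj by (simp add: power2_norm_eq_inner)
    have upper: "(norm (Ya *\<^sub>V y))\<^sup>2 = (norm a)\<^sup>2 + 2 * t * inner h (X *\<^sub>V zr\<^sup>\<dagger> *\<^sub>V T *\<^sub>V w) + \<kappa> * (norm b)\<^sup>2"
      unfolding Yy
      by (subst norm_pair_square[of "hsum_map J1" "hsum_map V2" "t *\<^sub>R hsum_map T" \<kappa>])
        (simp_all add: ip J(1) V12 V22 hsum_map_simps(2,3) flip: hsum_map_simps(1))
    have h\<Delta>: "inner h (T *\<^sub>V w) - inner h (X *\<^sub>V zr\<^sup>\<dagger> *\<^sub>V T *\<^sub>V w) = inner (\<Delta> *\<^sub>V h) w"
      by (simp add: inner_adj \<Delta>(1) T_eq flip: inner_diff_right)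
    have \<Delta>h: "(norm (\<Delta> *\<^sub>V h))\<^sup>2 = (norm h)\<^sup>2 - (norm a)\<^sup>2"
      unfolding norm_apply_square by (simp add: \<Delta> inner_diff_right a_def inner_adj'[of h X] power2_norm_eq_inner)
    have "\<kappa> * (norm w)\<^sup>2 - \<kappa> * (norm b)\<^sup>2 = (norm w)\<^sup>2"
    proof -
      have "\<kappa> * (norm w)\<^sup>2 - \<kappa> * (norm b)\<^sup>2 = (\<kappa> * (1 - (norm z)\<^sup>2)) * (norm w)\<^sup>2"
        by (simp add: \<open>(norm b)\<^sup>2 = _\<close> algebra_simps)
      then show ?thesis by (simp add: \<kappa>(2))
    qed
    moreover have "- t * ((norm (\<Delta> *\<^sub>V h))\<^sup>2 + (norm w)\<^sup>2) \<le> 2 * t * inner (\<Delta> *\<^sub>V h) w"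
    proof -
      have "0 \<le> (norm (\<Delta> *\<^sub>V h + w))\<^sup>2" by simp
      then have "- ((norm (\<Delta> *\<^sub>V h))\<^sup>2 + (norm w)\<^sup>2) \<le> 2 * inner (\<Delta> *\<^sub>V h) w"
        unfolding norm_add_square by simp
      from mult_left_mono[OF this t(1)] show ?thesis by (simp add: algebra_simps)
    qed
    moreover have "2 * t * inner h (T *\<^sub>V w) - 2 * t * inner h (X *\<^sub>V zr\<^sup>\<dagger> *\<^sub>V T *\<^sub>V w)
        = 2 * t * inner (\<Delta> *\<^sub>V h) w"
      unfolding h\<Delta>[symmetric] by (simp add: right_diff_distrib)
    ultimately have gap: "(1 - t) * ((norm (\<Delta> *\<^sub>V h))\<^sup>2 + (norm w)\<^sup>2) \<le> (norm y)\<^sup>2 - (norm (Ya *\<^sub>V y))\<^sup>2"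
      using lower upper \<Delta>h by (simp add: left_diff_distrib)
    have "(norm (Ya *\<^sub>V y))\<^sup>2 \<le> L * ((norm (\<Delta> *\<^sub>V h))\<^sup>2 + (norm w)\<^sup>2)"
    proof -
      have "(norm (Ya *\<^sub>V y))\<^sup>2 \<le> 2 * (norm (hsum_map J1 *\<^sub>V a))\<^sup>2 + 2 * (norm (hsum_map V2 *\<^sub>V b))\<^sup>2"
        unfolding Yy by (rule norm_add_square_le)
      also have "\<dots> = 2 * (norm a)\<^sup>2 + 2 * \<kappa> * (norm b)\<^sup>2"
        unfolding norm_apply_square[of "hsum_map J1"] norm_apply_square[of "hsum_map V2"] adj_hsum_map
          hsum_map_simps(1)[symmetric] J(1) V22
        by (simp add: hsum_map_simps power2_norm_eq_inner)
      also have "\<dots> \<le> 2 * (norm h)\<^sup>2 + 2 * \<kappa> * (norm w)\<^sup>2"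
      proof -
        have "(norm a)\<^sup>2 \<le> (norm h)\<^sup>2" using \<Delta>h zero_le_power2[of "norm (\<Delta> *\<^sub>V h)"] by linarith
        moreover have "(norm b)\<^sup>2 \<le> (norm w)\<^sup>2"
          unfolding \<open>(norm b)\<^sup>2 = _\<close> using z2 mult_right_mono[of "(norm z)\<^sup>2" 1 "(norm w)\<^sup>2"] by simp
        ultimately show ?thesis using \<kappa>(1) by (intro add_mono mult_left_mono) auto
      qed
      also have "\<dots> \<le> 2 / (1 - (norm X)\<^sup>2) * (norm (\<Delta> *\<^sub>V h))\<^sup>2 + 2 * \<kappa> * (norm w)\<^sup>2"
      proof -
        have "(norm a)\<^sup>2 \<le> (norm X)\<^sup>2 * (norm h)\<^sup>2"
          using power_mono[OF norm_cblinfun_apply[of "X\<^sup>\<dagger>" h], of 2]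
          by (simp add: a_def power_mult_distrib)
        then have "(1 - (norm X)\<^sup>2) * (norm h)\<^sup>2 \<le> (norm (\<Delta> *\<^sub>V h))\<^sup>2"
          using \<Delta>h by (simp add: left_diff_distrib)
        then show ?thesis using X2 by (simp add: field_simps)
      qed
      also have "\<dots> \<le> L * ((norm (\<Delta> *\<^sub>V h))\<^sup>2 + (norm w)\<^sup>2)"
        using X2 \<kappa>(1) by (simp add: L_def algebra_simps)
      finally show ?thesis .
    qed
    then have "c * (norm (Ya *\<^sub>V y))\<^sup>2 \<le> c * (L * ((norm (\<Delta> *\<^sub>V h))\<^sup>2 + (norm w)\<^sup>2))"
      using \<open>0 < c\<close> by (intro mult_left_mono) auto
    also have "\<dots> = (1 - t) * ((norm (\<Delta> *\<^sub>V h))\<^sup>2 + (norm w)\<^sup>2)"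
      using \<open>0 < L\<close> by (simp add: c_def)
    finally show ?thesis using gap by (simp add: distrib_right)
  qed
  have "norm Ya \<le> sqrt (1 / (1 + c))"
  proof (rule norm_cblinfun_leI)
    fix y
    have "(norm (Ya *\<^sub>V y))\<^sup>2 \<le> 1 / (1 + c) * (norm y)\<^sup>2"
      using contraction[of y] \<open>0 < c\<close> by (simp add: field_simps)
    then have "norm (Ya *\<^sub>V y) \<le> sqrt (1 / (1 + c) * (norm y)\<^sup>2)"
      by (rule real_le_rsqrt)
    then show "norm (Ya *\<^sub>V y) \<le> sqrt (1 / (1 + c)) * norm y"
      unfolding real_sqrt_mult by simp
  qed (use \<open>0 < c\<close> in simp)
  also have "\<dots> < 1" using \<open>0 < c\<close> by simp
  finally have "norm (Ya\<^sup>\<dagger>) < 1" by simp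
  moreover have "J1\<^sup>\<dagger> o\<^sub>C Ya\<^sup>\<dagger> = X o\<^sub>C hsum_map (J1\<^sup>\<dagger>)"
    using arg_cong[OF Y1, of adj] by simp
  moreover have "V2\<^sup>\<dagger> o\<^sub>C Ya\<^sup>\<dagger> = scalar_row z o\<^sub>C hsum_map (V2\<^sup>\<dagger>)"
    using arg_cong[OF Y2, of adj] by (simp add: zr_def)
  ultimately show ?thesis using J(1) V12 V22 unfolding T_def by blast
qed

section \<open>Free holomorphic functions and intertwining operators\<close>

text \<open>Operators pass through both the strong inner sums and the norm-convergent outer sum, so an
  intertwining relation need only be checked term by term.\<close>

lemma free_series_intertwine:
  assumes "free_series_sums C T" "free_series_sums C' T'"
    and comm: "\<And>\<alpha>. W2 o\<^sub>C C \<alpha> = C' \<alpha> o\<^sub>C W1"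
  shows "W2 o\<^sub>C T = T' o\<^sub>C W1"
proof -
  obtain P where P: "\<And>k \<xi>. ((\<lambda>\<alpha>. C \<alpha> *\<^sub>V \<xi>) has_sum P k *\<^sub>V \<xi>) {\<alpha>. length \<alpha> = k}" "P sums T"
    using assms(1) unfolding free_series_sums_def by blast
  obtain P' where P': "\<And>k \<xi>. ((\<lambda>\<alpha>. C' \<alpha> *\<^sub>V \<xi>) has_sum P' k *\<^sub>V \<xi>) {\<alpha>. length \<alpha> = k}" "P' sums T'"
    using assms(2) unfolding free_series_sums_def by blast
  have P_eq: "W2 o\<^sub>C P k = P' k o\<^sub>C W1" for k
  proof (rule cblinfun_eqI)
    fix \<xi>
    have comm': "W2 *\<^sub>V C \<alpha> *\<^sub>V \<xi> = C' \<alpha> *\<^sub>V W1 *\<^sub>V \<xi>" for \<alpha>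
      using comm[of \<alpha>] by (metis ccomp_apply)
    have "((\<lambda>\<alpha>. W2 *\<^sub>V C \<alpha> *\<^sub>V \<xi>) has_sum W2 *\<^sub>V P k *\<^sub>V \<xi>) {\<alpha>. length \<alpha> = k}"
      by (rule has_sum_bounded_linear[OF bounded_linear_cblinfun P(1), unfolded o_def])
    then have "((\<lambda>\<alpha>. C' \<alpha> *\<^sub>V W1 *\<^sub>V \<xi>) has_sum W2 *\<^sub>V P k *\<^sub>V \<xi>) {\<alpha>. length \<alpha> = k}"
      by (simp only: comm')
    then have "W2 *\<^sub>V P k *\<^sub>V \<xi> = P' k *\<^sub>V W1 *\<^sub>V \<xi>"
      using P'(1) by (rule has_sum_unique)
    then show "(W2 o\<^sub>C P k) *\<^sub>V \<xi> = (P' k o\<^sub>C W1) *\<^sub>V \<xi>" by simp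
  qed
  have "bounded_linear (\<lambda>S. W2 o\<^sub>C S)"
    by (rule bounded_linear_intro[of _ "norm W2"])
      (simp_all add: ccomp_linear_simps norm_ccomp_le mult.commute[of _ "norm W2"])
  then have "(\<lambda>k. W2 o\<^sub>C P k) sums (W2 o\<^sub>C T)" using P(2) by (rule bounded_linear.sums)
  moreover have "bounded_linear (\<lambda>S. S o\<^sub>C W1)"
    by (rule bounded_linear_intro[of _ "norm W1"]) (simp_all add: ccomp_linear_simps norm_ccomp_le)
  then have "(\<lambda>k. P' k o\<^sub>C W1) sums (T' o\<^sub>C W1)" using P'(2) by (rule bounded_linear.sums)
  ultimately show ?thesis unfolding P_eq by (rule sums_unique2)
qed

lemma free_series_unique:
  assumes "free_series_sums C T" "free_series_sums C T'"
  shows "T = T'"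
  using free_series_intertwine[OF assms, of cid cid] by simp

lemma free_series_compose:
  assumes "free_series_sums C T"
  shows "free_series_sums (\<lambda>\<alpha>. W2 o\<^sub>C C \<alpha> o\<^sub>C W1) (W2 o\<^sub>C T o\<^sub>C W1)"
proof -
  obtain P where P: "\<And>k \<xi>. ((\<lambda>\<alpha>. C \<alpha> *\<^sub>V \<xi>) has_sum P k *\<^sub>V \<xi>) {\<alpha>. length \<alpha> = k}" "P sums T"
    using assms unfolding free_series_sums_def by blast
  have "((\<lambda>\<alpha>. W2 *\<^sub>V C \<alpha> *\<^sub>V W1 *\<^sub>V \<xi>) has_sum W2 *\<^sub>V P k *\<^sub>V W1 *\<^sub>V \<xi>) {\<alpha>. length \<alpha> = k}" for k \<xi>
    by (rule has_sum_bounded_linear[OF bounded_linear_cblinfun P(1), unfolded o_def])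
  moreover have "bounded_linear (\<lambda>S. W2 o\<^sub>C S)"
    by (rule bounded_linear_intro[of _ "norm W2"])
      (simp_all add: ccomp_linear_simps norm_ccomp_le mult.commute[of _ "norm W2"])
  then have "(\<lambda>k. W2 o\<^sub>C P k) sums (W2 o\<^sub>C T)" using P(2) by (rule bounded_linear.sums)
  moreover have "bounded_linear (\<lambda>S. S o\<^sub>C W1)"
    by (rule bounded_linear_intro[of _ "norm W1"]) (simp_all add: ccomp_linear_simps norm_ccomp_le)
  ultimately show ?thesis
    unfolding free_series_sums_def
    by (intro exI[of _ "\<lambda>k. W2 o\<^sub>C P k o\<^sub>C W1"]) (auto intro: bounded_linear.sums)
qed

lemma row_word_intertwine:
  fixes X Y :: "(('n, 'h :: chilbert_space) hsum, 'h) cblinfun"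
  assumes "W o\<^sub>C Y = X o\<^sub>C hsum_map W"
  shows "W o\<^sub>C row_word Y \<alpha> = row_word X \<alpha> o\<^sub>C W"
proof (induction \<alpha>)
  case Nil
  show ?case by (simp add: row_word_def)
next
  case (Cons i \<alpha>)
  have "W o\<^sub>C row_nth Y i = row_nth X i o\<^sub>C W"
    unfolding row_nth_def
    by (metis assms ccomp_assoc hsum_map_inj)
  moreover have "row_word Z (i # \<alpha>) = row_nth Z i o\<^sub>C row_word Z \<alpha>" for Z :: "(('n, 'h) hsum, 'h) cblinfun"
    by (simp add: row_word_def)
  ultimately show ?case using Cons by (metis ccomp_assoc)
qed

text \<open>This is the sense in which a free holomorphic function respects intertwiners: \<open>W Y\<^sub>i = X\<^sub>i W\<close> for
  all \<open>i\<close> gives \<open>W Y\<^sub>\<alpha> = X\<^sub>\<alpha> W\<close> for all words.\<close>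

lemma free_holomorphic_intertwine:
  assumes s: "hilbert_tensor s" and t: "hilbert_tensor t" and F: "free_holomorphic s t A F"
    and "norm X < 1" "norm Y < 1" and W: "W o\<^sub>C Y = X o\<^sub>C hsum_map W"
  shows "op_tensor t t W cid o\<^sub>C F Y = F X o\<^sub>C op_tensor s s W cid"
proof (rule free_series_intertwine)
  show "free_series_sums (\<lambda>\<alpha>. op_tensor s t (row_word Y \<alpha>) (A \<alpha>)) (F Y)"
    "free_series_sums (\<lambda>\<alpha>. op_tensor s t (row_word X \<alpha>) (A \<alpha>)) (F X)"
    using assms(4,5) F unfolding free_holomorphic_def by blast+
  fix \<alpha>
  show "op_tensor t t W cid o\<^sub>C op_tensor s t (row_word Y \<alpha>) (A \<alpha>)
      = op_tensor s t (row_word X \<alpha>) (A \<alpha>) o\<^sub>C op_tensor s s W cid"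
  proof (rule tensor_ext[OF s])
    fix x u
    have "W *\<^sub>V row_word Y \<alpha> *\<^sub>V x = row_word X \<alpha> *\<^sub>V W *\<^sub>V x"
      using row_word_intertwine[OF W, of \<alpha>] by (metis ccomp_apply)
    then show "(op_tensor t t W cid o\<^sub>C op_tensor s t (row_word Y \<alpha>) (A \<alpha>)) *\<^sub>V s x u
        = (op_tensor s t (row_word X \<alpha>) (A \<alpha>) o\<^sub>C op_tensor s s W cid) *\<^sub>V s x u"
      by (simp add: op_tensor_apply[OF s t] op_tensor_apply[OF s s] op_tensor_apply[OF t t])
  qed
qed

definition tensor_slice :: "('a :: chilbert_space \<Rightarrow> 'b :: chilbert_space \<Rightarrow> 'c :: chilbert_space)
    \<Rightarrow> 'a \<Rightarrow> ('b, 'c) cblinfun"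
  where "tensor_slice t x = CBlinfun (t x)"

lemma tensor_slice_apply:
  assumes t: "hilbert_tensor t"
  shows "tensor_slice t x *\<^sub>V u = t x u"
proof -
  have "norm (t x u) = norm x * norm u" for u
  proof -
    have "complex_of_real ((norm (t x u))\<^sup>2) = complex_of_real ((norm x * norm u)\<^sup>2)"
      unfolding cinner_self[symmetric] hilbert_tensor_cinner[OF t]
      by (simp add: cinner_self power_mult_distrib)
    then show ?thesis by (simp only: of_real_eq_iff) (simp add: power2_eq_iff_nonneg)
  qed
  then have "bounded_linear (t x)"
    by (intro bounded_linear_intro[of _ "norm x"])
      (simp_all add: hilbert_tensor_linear[OF t] scaleR_scaleC)
  then have "bounded_clinear (t x)"
    by (simp add: bounded_clinear_def hilbert_tensor_linear[OF t])
  then show ?thesis by (simp add: tensor_slice_def cblinfun_apply_CBlinfun)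
qed

lemma adj_tensor_slice_apply:
  assumes t: "hilbert_tensor t"
  shows "(tensor_slice t e)\<^sup>\<dagger> *\<^sub>V t x g = cinner x e *\<^sub>C g"
proof (rule inner_ext)
  fix g'
  have "cinner g' ((tensor_slice t e)\<^sup>\<dagger> *\<^sub>V t x g) = cinner g' (cinner x e *\<^sub>C g)"
    using cinner_commute[of e x]
    by (simp add: tensor_slice_apply[OF t] hilbert_tensor_cinner[OF t] cinner_scaleC_right flip: cinner_adj)
  then show "inner g' ((tensor_slice t e)\<^sup>\<dagger> *\<^sub>V t x g) = inner g' (cinner x e *\<^sub>C g)"
    by (simp add: inner_eq_Re_cinner)
qed

lemma row_word_scalar_row: "row_word (scalar_row z) \<alpha> = scalar_word z \<alpha> *\<^sub>C cid"
proof (induction \<alpha>)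
  case Nil
  show ?case by (simp add: row_word_def scalar_word_def)
next
  case (Cons i \<alpha>)
  then show ?case
    by (intro cblinfun_eqI) (simp add: row_word_def scalar_word_def row_nth_scalar_row scaleC_scaleC)
qed

text \<open>Compressing the series of \<open>F\<close> at the scalar row to a slice \<open>e \<otimes> E\<close>, \<open>e \<otimes> G\<close> with a unit vector
  \<open>e\<close> shows that the scalar series converges; slices at arbitrary vectors then identify \<open>F\<close> at the
  scalar row with \<open>I \<otimes> F(z)\<close>.\<close>

lemma op_tensor_scalar_value:
  fixes s :: "'h :: chilbert_space \<Rightarrow> 'e :: chilbert_space \<Rightarrow> 'he :: chilbert_space"
    and t :: "'h \<Rightarrow> 'g :: chilbert_space \<Rightarrow> 'hg :: chilbert_space"
  assumes s: "hilbert_tensor s" and t: "hilbert_tensor t" and F: "free_holomorphic s t A F"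
    and z: "norm z < 1" and e: "norm (e :: 'h) = 1"
  shows "op_tensor s t cid (scalar_value A z) = F (scalar_row z)"
proof -
  define C where "C \<alpha> = op_tensor s t (row_word (scalar_row z) \<alpha>) (A \<alpha>)" for \<alpha>
  have zr: "norm (scalar_row z :: (('a, 'h) hsum, 'h) cblinfun) < 1"
    using norm_scalar_row_le z by (rule le_less_trans)
  have C: "free_series_sums C (F (scalar_row z))"
    using F zr unfolding free_holomorphic_def C_def by blast
  have C_apply: "C \<alpha> *\<^sub>V s x u = t x (scalar_word z \<alpha> *\<^sub>C (A \<alpha> *\<^sub>V u))" for \<alpha> x u
    by (simp add: C_def op_tensor_apply[OF s t] row_word_scalar_row hilbert_tensor_linear[OF t])
  have compress: "(tensor_slice t e)\<^sup>\<dagger> o\<^sub>C C \<alpha> o\<^sub>C tensor_slice s e = scalar_word z \<alpha> *\<^sub>C A \<alpha>" for \<alpha>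
    by (rule cblinfun_eqI)
      (simp add: tensor_slice_apply[OF s] C_apply adj_tensor_slice_apply[OF t] cinner_self_eq_1[OF e])
  have sums: "free_series_sums (\<lambda>\<alpha>. scalar_word z \<alpha> *\<^sub>C A \<alpha>)
      ((tensor_slice t e)\<^sup>\<dagger> o\<^sub>C F (scalar_row z) o\<^sub>C tensor_slice s e)"
    using free_series_compose[OF C] unfolding compress[symmetric] .
  then have value_sums: "free_series_sums (\<lambda>\<alpha>. scalar_word z \<alpha> *\<^sub>C A \<alpha>) (scalar_value A z)"
    unfolding scalar_value_def by (rule theI) (rule free_series_unique[OF _ sums])
  show ?thesis
  proof (rule op_tensor_eqI[OF s t])
    fix x u
    have "tensor_slice t x o\<^sub>C scalar_value A z = F (scalar_row z) o\<^sub>C tensor_slice s x"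
    proof (rule free_series_intertwine[OF value_sums C])
      show "tensor_slice t x o\<^sub>C scalar_word z \<alpha> *\<^sub>C A \<alpha> = C \<alpha> o\<^sub>C tensor_slice s x" for \<alpha>
        by (rule cblinfun_eqI) (simp add: tensor_slice_apply[OF s] tensor_slice_apply[OF t] C_apply)
    qed
    then have "(F (scalar_row z) o\<^sub>C tensor_slice s x) *\<^sub>V u = (tensor_slice t x o\<^sub>C scalar_value A z) *\<^sub>V u"
      by simp
    then show "F (scalar_row z) *\<^sub>V s x u = t (cid *\<^sub>V x) (scalar_value A z *\<^sub>V u)"
      by (simp add: tensor_slice_apply[OF s] tensor_slice_apply[OF t])
  qed
qed

section \<open>The Schwarz--Pick inequality\<close>

lemma norm_le_sup_norm: "sup_norm F \<le> 1 \<Longrightarrow> norm X < 1 \<Longrightarrow> norm (F X) \<le> 1"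
  unfolding sup_norm_def by (auto simp: SUP_le_iff one_ereal_def)

lemma norm_op_tensor_pair_square:
  assumes t: "hilbert_tensor t"
    and "V1\<^sup>\<dagger> o\<^sub>C V1 = cid" "V1\<^sup>\<dagger> o\<^sub>C V2 = R" "V2\<^sup>\<dagger> o\<^sub>C V2 = \<kappa> *\<^sub>R cid"
  shows "(norm (op_tensor t t V1 cid *\<^sub>V a + op_tensor t t V2 cid *\<^sub>V b))\<^sup>2
    = (norm a)\<^sup>2 + 2 * inner a (op_tensor t t R cid *\<^sub>V b) + \<kappa> * (norm b)\<^sup>2"
  by (rule norm_pair_square) (simp_all add: op_tensor_cid[OF t] assms(2-4) flip: op_tensor_cid(1)[OF t])

lemma ball_kernel_zero: "ball_kernel z 0 = (cid :: ('h :: chilbert_space, 'h) cblinfun)"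
proof -
  have zero: "0 o\<^sub>C S = 0" for S
    by (rule cblinfun_eqI) simp
  have "op_sqrt (cid - 0) = (cid :: ('h, 'h) cblinfun)"
  proof (rule op_sqrt_one_minus_eqI)
    show "(0 :: ('h, 'h) cblinfun)\<^sup>\<dagger> = 0" by (rule adj_eqI) simp
    show "positive_op (cid :: ('h, 'h) cblinfun)" by (rule positive_opI) auto
  qed simp_all
  moreover have "cinverse (cid :: ('h, 'h) cblinfun) = cid"
    by (rule cinverse_eqI) simp_all
  ultimately show ?thesis by (simp add: ball_kernel_def defect_star_def zero)
qed

locale bounded_free_holomorphic =
  fixes tE :: "'h :: chilbert_space \<Rightarrow> 'e :: chilbert_space \<Rightarrow> 'he :: chilbert_space"
    and tG :: "'h \<Rightarrow> 'g :: chilbert_space \<Rightarrow> 'hg :: chilbert_space"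
    and A :: "'n list \<Rightarrow> ('e, 'g) cblinfun"
    and F :: "(('n, 'h) hsum, 'h) cblinfun \<Rightarrow> ('he, 'hg) cblinfun"
  assumes infinite_dim: "\<nexists>B :: 'h set. finite B \<and> cspan B = UNIV"
    and tE: "hilbert_tensor tE" and tG: "hilbert_tensor tG"
    and holomorphic: "free_holomorphic tE tG A F"
    and bounded: "\<And>X. norm X < 1 \<Longrightarrow> norm (F X) \<le> 1"
begin

abbreviation ampE :: "('h, 'h) cblinfun \<Rightarrow> ('he, 'he) cblinfun" where "ampE W \<equiv> op_tensor tE tE W cid"
abbreviation ampG :: "('h, 'h) cblinfun \<Rightarrow> ('hg, 'hg) cblinfun" where "ampG W \<equiv> op_tensor tG tG W cid"

lemma amp_scalar_row_commute:
  assumes "norm z < 1"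
  shows "ampG W o\<^sub>C F (scalar_row z) = F (scalar_row z) o\<^sub>C ampE W"
    and "ampE W o\<^sub>C (F (scalar_row z))\<^sup>\<dagger> = (F (scalar_row z))\<^sup>\<dagger> o\<^sub>C ampG W"
proof -
  have zr: "norm (scalar_row z :: (('n, 'h) hsum, 'h) cblinfun) < 1"
    using norm_scalar_row_le assms by (rule le_less_trans)
  show comm: "ampG W o\<^sub>C F (scalar_row z) = F (scalar_row z) o\<^sub>C ampE W" for W
    by (rule free_holomorphic_intertwine[OF tE tG holomorphic zr zr scalar_row_intertwine])
  show "ampE W o\<^sub>C (F (scalar_row z))\<^sup>\<dagger> = (F (scalar_row z))\<^sup>\<dagger> o\<^sub>C ampG W"
    using arg_cong[OF comm[of "W\<^sup>\<dagger>"], of adj] by (simp add: op_tensor_cid(5)[OF tE] op_tensor_cid(5)[OF tG])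
qed

text \<open>The heart of the matter. By the two intertwining relations of \<open>kernel_dilation_exists\<close>, the
  adjoint of \<open>F(Y)\<close> sends \<open>u = V\<^sub>1 h + V\<^sub>2 w\<close> to \<open>V\<^sub>1 F(X)\<^sup>* h + V\<^sub>2 F(z)\<^sup>* w\<close> (with \<open>V\<^sub>i\<close> amplified to the tensor
  products). Since \<open>F(Y)\<close> is a contraction, \<open>\<bar>F(Y)\<^sup>* u\<bar>\<^sup>2 \<le> \<bar>u\<bar>\<^sup>2\<close>; expanding both sides with the known Gram
  matrix and letting \<open>t \<rightarrow> 1\<close> gives the claim.\<close>

lemma kernel_form_nonneg:
  fixes X :: "(('n, 'h) hsum, 'h) cblinfun" and z :: "('n, complex) hsum"
  assumes X: "norm X < 1" and z: "norm z < 1"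
  defines "\<kappa> \<equiv> 1 / (1 - (norm z)\<^sup>2)" and "Fz \<equiv> F (scalar_row z)"
  shows "0 \<le> (norm h)\<^sup>2 - (norm ((F X)\<^sup>\<dagger> *\<^sub>V h))\<^sup>2
    + 2 * inner h ((cid - F X o\<^sub>C Fz\<^sup>\<dagger>) *\<^sub>V ampG (ball_kernel z X) *\<^sub>V w)
    + \<kappa> * ((norm w)\<^sup>2 - (norm (Fz\<^sup>\<dagger> *\<^sub>V w))\<^sup>2)" (is "0 \<le> ?a + 2 * ?b + ?c")
proof -
  have zr: "norm (scalar_row z :: (('n, 'h) hsum, 'h) cblinfun) < 1"
    using norm_scalar_row_le z by (rule le_less_trans)
  have scaled: "0 \<le> ?a + 2 * t * ?b + ?c" if t: "0 \<le> t" "t < 1" for t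
  proof -
    obtain V1 V2 :: "('h, 'h) cblinfun" and Y :: "(('n, 'h) hsum, 'h) cblinfun"
      where Y: "norm Y < 1"
      and V: "V1\<^sup>\<dagger> o\<^sub>C V1 = cid" "V1\<^sup>\<dagger> o\<^sub>C V2 = t *\<^sub>R ball_kernel z X" "V2\<^sup>\<dagger> o\<^sub>C V2 = \<kappa> *\<^sub>R cid"
      and Y1: "V1\<^sup>\<dagger> o\<^sub>C Y = X o\<^sub>C hsum_map (V1\<^sup>\<dagger>)"
      and Y2: "V2\<^sup>\<dagger> o\<^sub>C Y = scalar_row z o\<^sub>C hsum_map (V2\<^sup>\<dagger>)"
      using kernel_dilation_exists[OF infinite_dim X z t] unfolding \<kappa>_def by blast
    define u where "u = ampG V1 *\<^sub>V h + ampG V2 *\<^sub>V w"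
    have F1: "(F Y)\<^sup>\<dagger> o\<^sub>C ampG V1 = ampE V1 o\<^sub>C (F X)\<^sup>\<dagger>"
      using arg_cong[OF free_holomorphic_intertwine[OF tE tG holomorphic X Y Y1], of adj]
      by (simp add: op_tensor_cid(5)[OF tE] op_tensor_cid(5)[OF tG])
    have F2: "(F Y)\<^sup>\<dagger> o\<^sub>C ampG V2 = ampE V2 o\<^sub>C Fz\<^sup>\<dagger>"
      using arg_cong[OF free_holomorphic_intertwine[OF tE tG holomorphic zr Y Y2], of adj]
      by (simp add: op_tensor_cid(5)[OF tE] op_tensor_cid(5)[OF tG] Fz_def)
    have "(F Y)\<^sup>\<dagger> *\<^sub>V u = ((F Y)\<^sup>\<dagger> o\<^sub>C ampG V1) *\<^sub>V h + ((F Y)\<^sup>\<dagger> o\<^sub>C ampG V2) *\<^sub>V w"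
      by (simp add: u_def cblinfun_linear_simps)
    then have Fu: "(F Y)\<^sup>\<dagger> *\<^sub>V u = ampE V1 *\<^sub>V (F X)\<^sup>\<dagger> *\<^sub>V h + ampE V2 *\<^sub>V Fz\<^sup>\<dagger> *\<^sub>V w"
      unfolding F1 F2 by simp
    have "norm ((F Y)\<^sup>\<dagger> *\<^sub>V u) \<le> norm (F Y) * norm u"
      using norm_cblinfun_apply[of "(F Y)\<^sup>\<dagger>" u] by simp
    also have "\<dots> \<le> 1 * norm u" by (intro mult_right_mono bounded Y) simp
    finally have "(norm ((F Y)\<^sup>\<dagger> *\<^sub>V u))\<^sup>2 \<le> (norm u)\<^sup>2" by (simp add: power_mono)
    then have le: "(norm ((F X)\<^sup>\<dagger> *\<^sub>V h))\<^sup>2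
        + 2 * inner ((F X)\<^sup>\<dagger> *\<^sub>V h) (t *\<^sub>R (ampE (ball_kernel z X) *\<^sub>V Fz\<^sup>\<dagger> *\<^sub>V w))
        + \<kappa> * (norm (Fz\<^sup>\<dagger> *\<^sub>V w))\<^sup>2
      \<le> (norm h)\<^sup>2 + 2 * inner h (t *\<^sub>R (ampG (ball_kernel z X) *\<^sub>V w)) + \<kappa> * (norm w)\<^sup>2"
      unfolding Fu unfolding u_def norm_op_tensor_pair_square[OF tE V] norm_op_tensor_pair_square[OF tG V]
        op_tensor_cid(3)[OF tE] op_tensor_cid(3)[OF tG] cblinfun_apply_simps .
    have "ampE (ball_kernel z X) *\<^sub>V Fz\<^sup>\<dagger> *\<^sub>V w = Fz\<^sup>\<dagger> *\<^sub>V ampG (ball_kernel z X) *\<^sub>V w"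
      unfolding Fz_def by (metis amp_scalar_row_commute(2)[OF z] ccomp_apply)
    then have "inner h (ampG (ball_kernel z X) *\<^sub>V w)
        - inner ((F X)\<^sup>\<dagger> *\<^sub>V h) (ampE (ball_kernel z X) *\<^sub>V Fz\<^sup>\<dagger> *\<^sub>V w) = ?b"
      by (simp add: inner_diff_right inner_adj)
    then have "2 * t * ?b = 2 * t * inner h (ampG (ball_kernel z X) *\<^sub>V w)
        - 2 * t * inner ((F X)\<^sup>\<dagger> *\<^sub>V h) (ampE (ball_kernel z X) *\<^sub>V Fz\<^sup>\<dagger> *\<^sub>V w)"
      by (metis right_diff_distrib)
    then show ?thesis using le by (simp add: right_diff_distrib)
  qed
  show ?thesis
  proof (rule LIMSEQ_le_const)
    have "(\<lambda>n. ?a + 2 * (1 - inverse (real (Suc n))) * ?b + ?c) \<longlonglongrightarrow> ?a + 2 * (1 - 0) * ?b + ?c"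
      by (intro tendsto_intros LIMSEQ_inverse_real_of_nat)
    then show "(\<lambda>n. ?a + 2 * (1 - inverse (real (Suc n))) * ?b + ?c) \<longlonglongrightarrow> ?a + 2 * ?b + ?c" by simp
    show "\<exists>N. \<forall>n\<ge>N. 0 \<le> ?a + 2 * (1 - inverse (real (Suc n))) * ?b + ?c"
      by (intro exI allI impI scaled) (simp_all add: inverse_eq_divide)
  qed
qed

text \<open>At \<open>X = 0\<close> the kernel is the identity, and \<open>h = - (I - F(0) F(z)\<^sup>*) w\<close> turns the form inequality
  into \<open>(1 - \<bar>z\<bar>\<^sup>2) \<bar>h\<bar>\<^sup>2 \<le> \<bar>w\<bar>\<^sup>2 - \<bar>F(z)\<^sup>* w\<bar>\<^sup>2\<close>. The left-hand side dominates a positive multiple of \<open>\<bar>w\<bar>\<^sup>2\<close>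
  because \<open>F(0)\<close> is a strict contraction.\<close>

lemma norm_scalar_value_less_one:
  assumes F0: "norm (F 0) < 1" and z: "norm z < 1"
  shows "norm (F (scalar_row z)) < 1"
proof -
  define Fz where "Fz = F (scalar_row z)"
  define \<kappa> where "\<kappa> = 1 / (1 - (norm z)\<^sup>2)"
  define \<delta> where "\<delta> = (1 - norm (F 0))\<^sup>2 * (1 - (norm z)\<^sup>2)"
  have z2: "(norm z)\<^sup>2 < 1" using z by (simp add: abs_square_less_1)
  then have "0 < \<delta>" using F0 by (simp add: \<delta>_def)
  have "\<delta> \<le> 1 * 1" unfolding \<delta>_def using F0 z2 by (intro mult_mono power_le_one) auto
  have "norm (scalar_row z :: (('n, 'h) hsum, 'h) cblinfun) < 1"
    using norm_scalar_row_le z by (rule le_less_trans)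
  then have Fz: "norm Fz \<le> 1" unfolding Fz_def by (rule bounded)
  have "norm (Fz\<^sup>\<dagger>) \<le> sqrt (1 - \<delta>)"
  proof (rule norm_cblinfun_leI)
    fix w
    define g where "g = (cid - F 0 o\<^sub>C Fz\<^sup>\<dagger>) *\<^sub>V w"
    have "0 \<le> (norm (- g))\<^sup>2 - (norm ((F 0)\<^sup>\<dagger> *\<^sub>V (- g)))\<^sup>2 + 2 * inner (- g) g
        + \<kappa> * ((norm w)\<^sup>2 - (norm (Fz\<^sup>\<dagger> *\<^sub>V w))\<^sup>2)"
      using kernel_form_nonneg[of 0 z "- g" w] z
      unfolding \<kappa>_def Fz_def g_def ball_kernel_zero op_tensor_cid(4)[OF tG] by simp
    then have "(norm g)\<^sup>2 + (norm ((F 0)\<^sup>\<dagger> *\<^sub>V (- g)))\<^sup>2 \<le> \<kappa> * ((norm w)\<^sup>2 - (norm (Fz\<^sup>\<dagger> *\<^sub>V w))\<^sup>2)"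
      by (simp add: power2_norm_eq_inner)
    then have "(norm g)\<^sup>2 \<le> \<kappa> * ((norm w)\<^sup>2 - (norm (Fz\<^sup>\<dagger> *\<^sub>V w))\<^sup>2)"
      using zero_le_power2[of "norm ((F 0)\<^sup>\<dagger> *\<^sub>V (- g))"] by linarith
    then have upper: "(1 - (norm z)\<^sup>2) * (norm g)\<^sup>2 \<le> (norm w)\<^sup>2 - (norm (Fz\<^sup>\<dagger> *\<^sub>V w))\<^sup>2"
      using z2 by (simp add: \<kappa>_def field_simps)
    have "norm (F 0 *\<^sub>V Fz\<^sup>\<dagger> *\<^sub>V w) \<le> norm (F 0) * norm w"
    proof -
      have "norm (F 0 *\<^sub>V Fz\<^sup>\<dagger> *\<^sub>V w) \<le> norm (F 0) * norm (Fz\<^sup>\<dagger> *\<^sub>V w)" by (rule norm_cblinfun_apply)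
      also have "norm (Fz\<^sup>\<dagger> *\<^sub>V w) \<le> norm Fz * norm w" using norm_cblinfun_apply[of "Fz\<^sup>\<dagger>" w] by simp
      also have "\<dots> \<le> 1 * norm w" by (intro mult_right_mono Fz) simp
      finally show ?thesis by (simp add: mult_left_mono)
    qed
    then have "(1 - norm (F 0)) * norm w \<le> norm g"
      using norm_triangle_ineq2[of w "F 0 *\<^sub>V Fz\<^sup>\<dagger> *\<^sub>V w"] by (simp add: g_def left_diff_distrib)
    then have "((1 - norm (F 0)) * norm w)\<^sup>2 \<le> (norm g)\<^sup>2"
      using F0 by (intro power_mono) auto
    then have "\<delta> * (norm w)\<^sup>2 \<le> (1 - (norm z)\<^sup>2) * (norm g)\<^sup>2"
      using z2 mult_left_mono[of _ _ "1 - (norm z)\<^sup>2"] by (simp add: \<delta>_def power_mult_distrib mult_ac)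
    with upper have "(norm (Fz\<^sup>\<dagger> *\<^sub>V w))\<^sup>2 \<le> (1 - \<delta>) * (norm w)\<^sup>2" by (simp add: left_diff_distrib)
    then have "norm (Fz\<^sup>\<dagger> *\<^sub>V w) \<le> sqrt ((1 - \<delta>) * (norm w)\<^sup>2)" by (rule real_le_rsqrt)
    then show "norm (Fz\<^sup>\<dagger> *\<^sub>V w) \<le> sqrt (1 - \<delta>) * norm w" by (simp add: real_sqrt_mult)
  qed (use \<open>\<delta> \<le> 1 * 1\<close> in simp)
  also have "\<dots> < 1" using \<open>0 < \<delta>\<close> by simp
  finally show ?thesis by (simp add: Fz_def)
qed

text \<open>For fixed \<open>h\<close> the form inequality is a quadratic inequality in \<open>w\<close>, and minimising it in \<open>w\<close> is a
  Schur complement. For \<open>h = (I - F(z) F(X)\<^sup>*)\<^sup>-\<^sup>1 D v\<close> the minimiser is \<open>w = - (1 - \<bar>z\<bar>\<^sup>2) D\<^sup>-\<^sup>1 (T\<^sup>* \<otimes> I) v\<close>,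
  because \<open>D\<close> commutes with every \<open>W \<otimes> I\<close>.\<close>

lemma schwarz_pick_defect:
  fixes X :: "(('n, 'h) hsum, 'h) cblinfun" and z :: "('n, complex) hsum"
  assumes X: "norm X < 1" and z: "norm z < 1" and F0: "norm (F 0) < 1"
  defines "Fz \<equiv> F (scalar_row z)" and "T \<equiv> ball_kernel z X"
  shows "ampG ((1 - (norm z)\<^sup>2) *\<^sub>R (T o\<^sub>C T\<^sup>\<dagger>))
    \<le>\<^sub>C defect_star Fz o\<^sub>C cinverse (cid - F X o\<^sub>C Fz\<^sup>\<dagger>) o\<^sub>C (cid - F X o\<^sub>C (F X)\<^sup>\<dagger>)
        o\<^sub>C cinverse (cid - Fz o\<^sub>C (F X)\<^sup>\<dagger>) o\<^sub>C defect_star Fz"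
proof -
  have Fz: "norm Fz < 1" unfolding Fz_def by (rule norm_scalar_value_less_one[OF F0 z])
  define D where "D = defect_star Fz"
  define M where "M = cinverse (cid - F X o\<^sub>C Fz\<^sup>\<dagger>)"
  define Ms where "Ms = cinverse (cid - Fz o\<^sub>C (F X)\<^sup>\<dagger>)"
  define k where "k = 1 - (norm z)\<^sup>2"
  define Q where "Q = D o\<^sub>C M o\<^sub>C (cid - F X o\<^sub>C (F X)\<^sup>\<dagger>) o\<^sub>C Ms o\<^sub>C D"
  have k: "0 < k" using z by (simp add: k_def abs_square_less_1)
  have "norm (F X o\<^sub>C Fz\<^sup>\<dagger>) \<le> norm (F X) * norm Fz" using norm_ccomp_le[of "F X" "Fz\<^sup>\<dagger>"] by simp
  also have "\<dots> \<le> 1 * norm Fz" by (intro mult_right_mono bounded X) simp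
  finally have small: "norm (F X o\<^sub>C Fz\<^sup>\<dagger>) < 1" using Fz by simp
  then have small': "norm (Fz o\<^sub>C (F X)\<^sup>\<dagger>) < 1" using norm_adj[of "F X o\<^sub>C Fz\<^sup>\<dagger>"] by simp
  have M: "M\<^sup>\<dagger> = Ms" unfolding M_def Ms_def adj_cinverse_one_minus[OF small] by simp
  have Ms: "Ms\<^sup>\<dagger> = M" using M by (metis adj_adj)
  have Ms_inv: "(cid - Fz o\<^sub>C (F X)\<^sup>\<dagger>) *\<^sub>V Ms *\<^sub>V v = v" for v
    using cinverse_one_minus(2)[OF small'] unfolding Ms_def by (metis ccomp_apply cid_apply)
  have D: "D\<^sup>\<dagger> = D" "D o\<^sub>C D = cid - Fz o\<^sub>C Fz\<^sup>\<dagger>"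
    unfolding D_def by (rule defect_star_props(1,2)[OF Fz])+
  obtain E where E: "D o\<^sub>C E = cid"
    using defect_star_props(3)[OF Fz] unfolding D_def by blast
  have DE: "D *\<^sub>V E *\<^sub>V v = v" for v using E by (metis ccomp_apply cid_apply)
  have comm: "ampG W o\<^sub>C D = D o\<^sub>C ampG W" for W
    unfolding D_def
  proof (rule defect_star_intertwine[OF Fz Fz])
    show "ampG W o\<^sub>C (Fz o\<^sub>C Fz\<^sup>\<dagger>) = (Fz o\<^sub>C Fz\<^sup>\<dagger>) o\<^sub>C ampG W"
      unfolding Fz_def by (metis amp_scalar_row_commute[OF z] ccomp_assoc)
  qed
  have nonneg: "k * (norm (ampG (T\<^sup>\<dagger>) *\<^sub>V v))\<^sup>2 \<le> inner (Q *\<^sub>V v) v" for v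
  proof -
    define p where "p = ampG (T\<^sup>\<dagger>) *\<^sub>V v"
    define h where "h = Ms *\<^sub>V D *\<^sub>V v"
    define w where "w = - k *\<^sub>R (E *\<^sub>V p)"
    have "inner h ((cid - F X o\<^sub>C Fz\<^sup>\<dagger>) *\<^sub>V ampG T *\<^sub>V w)
        = inner ((cid - Fz o\<^sub>C (F X)\<^sup>\<dagger>) *\<^sub>V h) (ampG T *\<^sub>V w)"
      by (subst inner_adj') simp
    also have "\<dots> = inner (D *\<^sub>V v) (ampG T *\<^sub>V w)"
      unfolding h_def Ms_inv ..
    also have "\<dots> = inner (ampG (T\<^sup>\<dagger>) *\<^sub>V D *\<^sub>V v) w"
      by (subst inner_adj') (simp add: op_tensor_cid(5)[OF tG])
    also have "ampG (T\<^sup>\<dagger>) *\<^sub>V D *\<^sub>V v = D *\<^sub>V p"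
      unfolding p_def by (metis comm ccomp_apply)
    also have "inner (D *\<^sub>V p) w = - k * (norm p)\<^sup>2"
      by (simp add: inner_adj D(1) w_def cblinfun_linear_simps DE power2_norm_eq_inner)
    finally have cross: "inner h ((cid - F X o\<^sub>C Fz\<^sup>\<dagger>) *\<^sub>V ampG T *\<^sub>V w) = - k * (norm p)\<^sup>2" .
    have "(norm w)\<^sup>2 - (norm (Fz\<^sup>\<dagger> *\<^sub>V w))\<^sup>2 = (norm (D *\<^sub>V w))\<^sup>2"
      unfolding norm_apply_square D norm_adj_apply_square
      by (simp add: inner_diff_right power2_norm_eq_inner inner_adj)
    also have "\<dots> = k * k * (norm p)\<^sup>2"
      by (simp add: w_def cblinfun_linear_simps DE power_mult_distrib power2_eq_square)
    finally have last: "1 / (1 - (norm z)\<^sup>2) * ((norm w)\<^sup>2 - (norm (Fz\<^sup>\<dagger> *\<^sub>V w))\<^sup>2) = k * (norm p)\<^sup>2"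
      using k by (simp add: k_def)
    have "inner (Q *\<^sub>V v) v = inner ((cid - F X o\<^sub>C (F X)\<^sup>\<dagger>) *\<^sub>V h) h"
      unfolding Q_def h_def by (simp only: ccomp_apply inner_adj[of D] inner_adj[of M] D(1) M)
    also have "\<dots> = (norm h)\<^sup>2 - (norm ((F X)\<^sup>\<dagger> *\<^sub>V h))\<^sup>2"
      unfolding norm_adj_apply_square by (simp add: inner_diff_left power2_norm_eq_inner)
    finally have "inner (Q *\<^sub>V v) v = (norm h)\<^sup>2 - (norm ((F X)\<^sup>\<dagger> *\<^sub>V h))\<^sup>2" .
    then show ?thesis
      using kernel_form_nonneg[OF X z, of h w] cross last
      unfolding Fz_def T_def p_def by simp
  qed
  have "positive_op (Q - ampG (k *\<^sub>R (T o\<^sub>C T\<^sup>\<dagger>)))"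
  proof (rule positive_opI)
    show "(Q - ampG (k *\<^sub>R (T o\<^sub>C T\<^sup>\<dagger>)))\<^sup>\<dagger> = Q - ampG (k *\<^sub>R (T o\<^sub>C T\<^sup>\<dagger>))"
      by (simp add: Q_def op_tensor_cid(5)[OF tG] D(1) M Ms ccomp_assoc)
    fix v
    have "inner (ampG (k *\<^sub>R (T o\<^sub>C T\<^sup>\<dagger>)) *\<^sub>V v) v = k * (norm (ampG (T\<^sup>\<dagger>) *\<^sub>V v))\<^sup>2"
      unfolding norm_apply_square op_tensor_cid(5)[OF tG] adj_adj
      by (simp add: op_tensor_cid[OF tG] inner_commute)
    then show "0 \<le> inner ((Q - ampG (k *\<^sub>R (T o\<^sub>C T\<^sup>\<dagger>))) *\<^sub>V v) v"
      using nonneg[of v] by (simp add: inner_diff_left)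
  qed
  then show ?thesis
    unfolding op_le_def Q_def D_def M_def Ms_def k_def .
qed

end

theorem theorem7p1:
  fixes tE :: "'h :: chilbert_space \<Rightarrow> 'e :: chilbert_space \<Rightarrow> 'he :: chilbert_space"
    and tG :: "'h \<Rightarrow> 'g :: chilbert_space \<Rightarrow> 'hg :: chilbert_space"
    and A :: "'n :: countable list \<Rightarrow> ('e, 'g) cblinfun"
    and F :: "(('n, 'h) hsum, 'h) cblinfun \<Rightarrow> ('he, 'hg) cblinfun"
  assumes H_separable: "separable_space (euclidean :: 'h topology)"
    and H_infinite_dim: "\<nexists>B :: 'h set. finite B \<and> cspan B = UNIV"
    and tensor_HE: "hilbert_tensor tE"
    and tensor_HG: "hilbert_tensor tG"
    and F_holomorphic: "free_holomorphic tE tG A F"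
    and F_bounded: "sup_norm F \<le> 1"
    and F_zero: "norm (F 0) < 1"
  shows "\<forall>(z :: ('n, complex) hsum) (X :: (('n, 'h) hsum, 'h) cblinfun).
    norm z < 1 \<longrightarrow> norm X < 1 \<longrightarrow>
    (let Fz = op_tensor tE tG cid (scalar_value A z);
         \<Psi> = frac_transform Fz (F X);
         \<Phi> = ball_auto z X;
         zr = scalar_row z :: (('n, 'h) hsum, 'h) cblinfun;
         \<Delta> = sqrt (1 - (norm z)\<^sup>2) *\<^sub>R (cid :: ('h, 'h) cblinfun)
     in \<Psi> o\<^sub>C \<Psi>\<^sup>\<dagger> \<le>\<^sub>C op_tensor tG tG (\<Phi> o\<^sub>C \<Phi>\<^sup>\<dagger>) cid
      \<and> op_tensor tG tG
          (\<Delta> o\<^sub>C cinverse (cid - X o\<^sub>C zr\<^sup>\<dagger>) o\<^sub>C (cid - X o\<^sub>C X\<^sup>\<dagger>)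
             o\<^sub>C cinverse (cid - zr o\<^sub>C X\<^sup>\<dagger>) o\<^sub>C \<Delta>) cid
        \<le>\<^sub>C defect_star Fz o\<^sub>C cinverse (cid - F X o\<^sub>C Fz\<^sup>\<dagger>) o\<^sub>C (cid - F X o\<^sub>C (F X)\<^sup>\<dagger>)
             o\<^sub>C cinverse (cid - Fz o\<^sub>C (F X)\<^sup>\<dagger>) o\<^sub>C defect_star Fz)"
proof (intro allI impI)
  fix z :: "('n, complex) hsum" and X :: "(('n, 'h) hsum, 'h) cblinfun"
  assume z: "norm z < 1" and X: "norm X < 1"
  interpret bounded_free_holomorphic tE tG A F
    by unfold_locales
      (use H_infinite_dim tensor_HE tensor_HG F_holomorphic norm_le_sup_norm[OF F_bounded] in auto)
  have "\<exists>h :: 'h. h \<noteq> 0"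
  proof (rule ccontr)
    assume "\<not> (\<exists>h :: 'h. h \<noteq> 0)"
    then have "cspan {} = (UNIV :: 'h set)" by auto
    then show False using H_infinite_dim by blast
  qed
  then obtain h :: 'h where "h \<noteq> 0" by blast
  then have "norm ((1 / norm h) *\<^sub>R h) = 1" by simp
  then have Fz: "op_tensor tE tG cid (scalar_value A z) = F (scalar_row z)"
    by (rule op_tensor_scalar_value[OF tensor_HE tensor_HG F_holomorphic z])
  define zr where "zr = (scalar_row z :: (('n, 'h) hsum, 'h) cblinfun)"
  define \<Psi> where "\<Psi> = frac_transform (F zr) (F X)"
  define \<Phi> where "\<Phi> = ball_auto z X"
  define \<Delta> where "\<Delta> = sqrt (1 - (norm z)\<^sup>2) *\<^sub>R (cid :: ('h, 'h) cblinfun)"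
  define R where "R = \<Delta> o\<^sub>C cinverse (cid - X o\<^sub>C zr\<^sup>\<dagger>) o\<^sub>C (cid - X o\<^sub>C X\<^sup>\<dagger>)
    o\<^sub>C cinverse (cid - zr o\<^sub>C X\<^sup>\<dagger>) o\<^sub>C \<Delta>"
  define Q where "Q = defect_star (F zr) o\<^sub>C cinverse (cid - F X o\<^sub>C (F zr)\<^sup>\<dagger>)
    o\<^sub>C (cid - F X o\<^sub>C (F X)\<^sup>\<dagger>) o\<^sub>C cinverse (cid - F zr o\<^sub>C (F X)\<^sup>\<dagger>) o\<^sub>C defect_star (F zr)"
  have RQ: "ampG R \<le>\<^sub>C Q"
    using schwarz_pick_defect[OF X z F_zero]
    unfolding ball_kernel_ccomp_adj[OF X z] R_def Q_def \<Delta>_def zr_def .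
  have "norm zr < 1" unfolding zr_def using norm_scalar_row_le z by (rule le_less_trans)
  then have \<Phi>: "cid - \<Phi> o\<^sub>C \<Phi>\<^sup>\<dagger> = R"
    unfolding \<Phi>_def ball_auto_eq_frac_transform[OF z] zr_def[symmetric]
    by (subst frac_transform_defect_identity)
      (use X in \<open>simp_all add: R_def \<Delta>_def zr_def defect_star_scalar_row[OF z]\<close>)
  have "norm (F zr) < 1" unfolding zr_def by (rule norm_scalar_value_less_one[OF F_zero z])
  then have \<Psi>: "cid - \<Psi> o\<^sub>C \<Psi>\<^sup>\<dagger> = Q"
    unfolding \<Psi>_def Q_def by (rule frac_transform_defect_identity) (rule bounded[OF X])
  have "ampG (\<Phi> o\<^sub>C \<Phi>\<^sup>\<dagger>) - \<Psi> o\<^sub>C \<Psi>\<^sup>\<dagger> = Q - ampG R"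
    unfolding \<Phi>[symmetric] \<Psi>[symmetric] op_tensor_cid(2)[OF tensor_HG] op_tensor_cid(4)[OF tensor_HG]
    by simp
  then have "\<Psi> o\<^sub>C \<Psi>\<^sup>\<dagger> \<le>\<^sub>C ampG (\<Phi> o\<^sub>C \<Phi>\<^sup>\<dagger>)"
    using RQ unfolding op_le_def by simp
  with RQ show "let Fz = op_tensor tE tG cid (scalar_value A z);
         \<Psi> = frac_transform Fz (F X);
         \<Phi> = ball_auto z X;
         zr = scalar_row z :: (('n, 'h) hsum, 'h) cblinfun;
         \<Delta> = sqrt (1 - (norm z)\<^sup>2) *\<^sub>R (cid :: ('h, 'h) cblinfun)
     in \<Psi> o\<^sub>C \<Psi>\<^sup>\<dagger> \<le>\<^sub>C op_tensor tG tG (\<Phi> o\<^sub>C \<Phi>\<^sup>\<dagger>) cid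
      \<and> op_tensor tG tG
          (\<Delta> o\<^sub>C cinverse (cid - X o\<^sub>C zr\<^sup>\<dagger>) o\<^sub>C (cid - X o\<^sub>C X\<^sup>\<dagger>)
             o\<^sub>C cinverse (cid - zr o\<^sub>C X\<^sup>\<dagger>) o\<^sub>C \<Delta>) cid
        \<le>\<^sub>C defect_star Fz o\<^sub>C cinverse (cid - F X o\<^sub>C Fz\<^sup>\<dagger>) o\<^sub>C (cid - F X o\<^sub>C (F X)\<^sup>\<dagger>)
             o\<^sub>C cinverse (cid - Fz o\<^sub>C (F X)\<^sup>\<dagger>) o\<^sub>C defect_star Fz"
    unfolding Let_def Fz R_def Q_def \<Psi>_def \<Phi>_def \<Delta>_def zr_def by blast
qed

end
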